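(* Fix $\mathrm{x}>0$ and $r>0$, and let $K_1,K_2,K_3,K_4,K_6,L_2,L_3>0$, $K_5\ge0$, $L_1\ge0$. There exist a (sufficiently large) constant $M=M(K_1,\dots,K_5,L_1,L_2,r)>0$, a constant $M_2=M_2(K_6,L_3,\overline\lambda_0)>0$ and a constant $K=K(K_1,\dots,K_5,L_1,L_2,L_3,\overline\lambda_0,r)>0$ for which the following holds. Suppose that the assumptions (Basic), (Curvature), (Smoothness), (Hessian regularity), (Fluctuation) and (Warm start) stated in the context hold with these constants; in particular the phase transition time $t_0$ is any integer with $t_0\ge\lceil M(p\log(p\vee3)+\mathrm{x})\rceil$. Then, on $\mathscr E_{1:4}(\mathrm{x})=\bigcap_{j=1}^4\mathscr E_j(\mathrm{x})$, for every $t\in\mathbb N$ with $t>M_2t_0$, $$d_V\big(Q_{\mathrm{BvM},t},\Pi_t\big)\le K\,\epsilon_{\mathrm{app},t},$$ $$d_V\big(\Pi_t,\Pi(\cdot\mid\mathbf D_{1:t})\big)\le K\,\epsilon_{\mathrm{app},t}+d_V\big(Q_{\mathrm{BvM},t},\Pi(\cdot\mid\mathbf D_{1:t})\big),$$ where $$\epsilon_{\mathrm{app},t}=\sqrt{\frac{\log^2(t/t_0)\,(p\log t+\mathrm{x})^2}{t}}.$$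
   Context: Setting. $p\in\mathbb N$, $\Theta=\mathbb R^p$. $(Y_t)_{t\in\mathbb N}$ is a sequence of observations; for each $t$, $p_{t,\theta}(\cdot)$, $\theta\in\Theta$, is a parametrized probability density for $Y_t$, and $\ell_t(\theta)=-\log p_{t,\theta}(Y_t)$. The model is correctly specified: for every $t$, $(Y_1,\dots,Y_t)$ has joint density $\prod_{s\le t}p_{s,\theta_\star}$ for a true parameter $\theta_\star\in\Theta$; $\mathbb P_{\theta_\star}$ and $\mathbb E$ denote the corresponding probability and expectation. $\|\cdot\|_2$ is the Euclidean norm of vectors and the operator norm of matrices; $\langle\cdot,\cdot\rangle$ is the entrywise inner product of vectors/matrices; $z^{\otimes2}=zz^\top$; $\preceq$ is the Loewner order; $a\vee b=\max(a,b)$; $\inf\emptyset=\infty$. $\Theta_r=\{\theta\in\Theta:\|\theta-\theta_\star\|_2\le r\}$; $F_{t,\theta}=\sum_{s=1}^t\nabla^2\ell_s(\theta)$. $d_V(P,Q)=\sup_A|P(A)-Q(A)|$ (supremum over measurable sets) is the total variation distance. Algorithm. Let $\theta_0\in\mathbb R^p$ and $\Omega_0$ a symmetric positive definite $p\times p$ matrix. Define $\hat\theta_t^{\mathrm{MAP}}=\operatorname{argmin}_{\theta\in\Theta}\{\sum_{s=1}^t\ell_s(\theta)+\tfrac12\|\Omega_0^{1/2}(\theta-\theta_0)\|_2^2\}$ and $\hat\theta_t^{\mathrm{ML}}=\operatorname{argmin}_{\theta\in\Theta}\sum_{s=1}^t\ell_s(\theta)$. Fix $t_0\in\mathbb N$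 (the phase transition time). For $1\le t\le t_0$ set $\theta_t=\hat\theta_t^{\mathrm{MAP}}$, $\Omega_t=\Omega_0+\sum_{s=1}^t\nabla^2\ell_s(\hat\theta_t^{\mathrm{MAP}})$. For $t>t_0$ set $\Omega_t=\Omega_{t-1}+H_t$ and $\theta_t=\theta_{t-1}-\Omega_t^{-1}g_t$, where $g_t=\nabla\ell_t(\theta_{t-1})$ and $H_t=\nabla^2\ell_t(\theta_{t-1})$ (assumed symmetric positive semi-definite). Exit time: $t_{\mathrm{exit}}=\inf\{t\in\mathbb N:t>t_0,\ \theta_t\notin\Theta_r\}$. Distributions: $\Pi_t=N(\theta_t,\Omega_t^{-1})$; $Q_{\mathrm{BvM},t}=N(\hat\theta_t^{\mathrm{ML}},F_{t,\theta_\star}^{-1})$; $\Pi(\cdot\mid\mathbf D_{1:t})$ is the posterior distribution of $\theta$ given $\mathbf D_{1:t}=(Y_1,\dots,Y_t)$ under the prior $N(\theta_0,\Omega_0^{-1})$, i.e. the distribution with density proportional to $\exp(-\sum_{s\le t}\ell_s(\theta))$ with respect to the prior. Assumptions. $\bar K>0$ and $C>0$ denote universal constants. (Basic) Each $\theta\mapsto\ell_t(\theta)$ is at least twice differentiable; $\theta_\star$ is the unique minimizer of $\theta\mapsto\mathbb E\ell_t(\theta)$ for every $t$; $(\theta_0,\Omega_0)$ is non-random with $0<\underline\lambda_0\le\lambda_{\min}(\Omega_0)\le\lambda_{\max}(\Omega_0)\le\overline\lambda_0\le\bar K$. (Curvature) There is an event $\mathscr E_1(\mathrm{x})$ with $\mathbb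 P_{\theta_\star}(\mathscr E_1(\mathrm{x}))\ge1-e^{-\mathrm{x}}$ on which, for all $t\in\mathbb N$ with $t\ge K_1(p+\mathrm{x})$, $\inf_{\{\bar\theta_s\}_{s=1}^t\subset\Theta_r}\lambda_{\min}(\sum_{s=1}^t\nabla^2\ell_s(\bar\theta_s))\ge K_2t$. (Smoothness) For all $t\in\mathbb N$ and $\theta,\theta'\in\Theta_r$ there is $\phi_t(\theta,\theta')\ge0$ with $\phi_t(\theta,\theta')\le L_1\|\theta-\theta'\|_2$ and $\nabla^2\ell_t(\theta)\preceq(1+\phi_t(\theta,\theta'))\nabla^2\ell_t(\tilde\theta)$ for some $\tilde\theta$ on the line segment between $\theta$ and $\theta'$ satisfying $\ell_t(\theta)=\ell_t(\theta')+\langle\nabla\ell_t(\theta'),\theta-\theta'\rangle+\tfrac12\langle\nabla^2\ell_t(\tilde\theta),(\theta-\theta')^{\otimes2}\rangle$. Moreover $\max_{t\in\mathbb N}\sup_{\theta\in\Theta_r}\|\nabla^2\ell_t(\theta)\|_2\le L_2$. (Hessian regularity) For all $\theta,\theta'\in\Theta_r$, $\max_{t\in\mathbb N}\|\nabla^2\ell_t(\theta)-\nabla^2\ell_t(\theta')\|_2\le L_3\|\theta-\theta'\|_2$; and for all $\theta,\theta+h\in\Theta_r$ and $t\in\mathbb N$, $(1+e^{K_6\|h\|_2})^{-1}F_{t,\theta}\preceq F_{t,\theta+h}\preceq(1+e^{K_6\|h\|_2})F_{t,\theta}$. (Fluctuation) $t_0\ge K_1(p+\mathrm{x})$. There is an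 event $\mathscr E_2(\mathrm{x})$ with $\mathbb P_{\theta_\star}(\mathscr E_2(\mathrm{x}))\ge1-e^{-\mathrm{x}}$ on which $\sum_{s=t_0+1}^t\{\ell_s(\theta_\star)-\ell_s(\theta_{s-1})\}\le K_3\mathrm{x}$ for all $t>t_0$; and an event $\mathscr E_3(\mathrm{x})$ with $\mathbb P_{\theta_\star}(\mathscr E_3(\mathrm{x}))\ge1-e^{-\mathrm{x}}$ on which $\sum_{s=t_0+1}^t\langle g_s,\Omega_s^{-1}g_s\rangle\le K_4p\log t+K_5(\mathrm{x}+\log t)$ for all $t\in\mathbb N$ with $t_0<t\le t_{\mathrm{exit}}$. The constants $K_3,K_4,K_5$ do not depend on $t_0$. (Warm start) $t_0\ge\lceil M(p\log(p\vee3)+\mathrm{x})\rceil$, and there is an event $\mathscr E_4(\mathrm{x})$ with $\mathbb P_{\theta_\star}(\mathscr E_4(\mathrm{x}))\ge1-e^{-\mathrm{x}}$ on which $\|\Omega_{t_0}^{1/2}(\hat\theta_{t_0}^{\mathrm{MAP}}-\theta_\star)\|_2^2\le C(p+\mathrm{x})$ and, for all $t\in\mathbb N$ with $t\ge t_0$, $\|\hat\theta_t^{\mathrm{MAP}}-\theta_\star\|_2\vee\|\hat\theta_t^{\mathrm{ML}}-\theta_\star\|_2\le C\sqrt{(p+\log t+\mathrm{x})/t}$.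
   Formalization: (Warm start) is assumed for every integer t_0 ≥ ⌈M(p log(p∨3)+x)⌉, with an event E_4 for each, not only for the t_0 used; for one fixed t_0 the claim fails (p=1, Y_t~N(θ,1), θ⋆=0, Ω_0=1, θ_0=√t_0, t of order t_0). *)

theory Defs
  imports
    "HOL-Probability.Probability"
    "Jordan_Normal_Form.Spectral_Radius"
    "Jordan_Normal_Form.Gauss_Jordan_Elimination"
begin

text \<open>
  The constants of the theorem are uniform in the dimension \<open>p\<close>, so \<open>p\<close> has to be quantified inside
  the statement. Vectors and matrices are therefore those of \<^theory>\<open>Jordan_Normal_Form.Matrix\<close>,
  whose dimension is a value: \<open>\<Theta>\<close> is \<^term>\<open>carrier_vec p :: real Matrix.vec set\<close>.
\<close>

hide_type (open) Finite_Cartesian_Product.vec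
hide_const (open) Finite_Cartesian_Product.vec Determinants.det Finite_Cartesian_Product.mat
no_notation inner (infix \<open>\<bullet>\<close> 70)
no_notation vec_nth (infixl \<open>$\<close> 90)

type_synonym rvec = "real Matrix.vec"
type_synonym rmat = "real Matrix.mat"


section \<open>Euclidean vectors and symmetric matrices\<close>

definition vnorm :: "rvec \<Rightarrow> real" where
  "vnorm v = sqrt (v \<bullet> v)"

definition op_norm :: "rmat \<Rightarrow> real" where
  "op_norm A = (SUP v \<in> {v \<in> carrier_vec (dim_col A). vnorm v \<le> 1}. vnorm (A *\<^sub>v v))"

definition outer :: "rvec \<Rightarrow> rmat" where
  "outer z = Matrix.mat (dim_vec z) (dim_vec z) (\<lambda>(i, j). z $ i * z $ j)"

definition mat_inner :: "rmat \<Rightarrow> rmat \<Rightarrow> real" where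
  "mat_inner A B = (\<Sum>i<dim_row A. \<Sum>j<dim_col A. A $$ (i, j) * B $$ (i, j))"

definition mat_sum :: "nat \<Rightarrow> (nat \<Rightarrow> rmat) \<Rightarrow> nat set \<Rightarrow> rmat" where
  "mat_sum p A I = Matrix.mat p p (\<lambda>ij. \<Sum>s\<in>I. A s $$ ij)"

definition psd :: "rmat \<Rightarrow> bool" where
  "psd A \<longleftrightarrow> A \<in> carrier_mat (dim_row A) (dim_row A) \<and> transpose_mat A = A \<and>
     (\<forall>v\<in>carrier_vec (dim_row A). 0 \<le> v \<bullet> (A *\<^sub>v v))"

definition loewner_le :: "rmat \<Rightarrow> rmat \<Rightarrow> bool" (infix \<open>\<preceq>\<close> 50) where
  "A \<preceq> B \<longleftrightarrow> psd (B - A)"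

definition lambda_min :: "rmat \<Rightarrow> real" where
  "lambda_min A = Min (spectrum A)"

definition lambda_max :: "rmat \<Rightarrow> real" where
  "lambda_max A = Max (spectrum A)"

text \<open>Only meaningful for invertible \<open>A\<close>.\<close>

definition minv :: "rmat \<Rightarrow> rmat" where
  "minv A = the (mat_inverse A)"

text \<open>The positive semi-definite square root, unique for positive semi-definite \<open>A\<close>.\<close>

definition mat_sqrt :: "rmat \<Rightarrow> rmat" where
  "mat_sqrt A = (SOME B. psd B \<and> B * B = A)"


section \<open>Differential calculus on \<open>\<real>\<^sup>p\<close>\<close>

definition has_gradient :: "nat \<Rightarrow> (rvec \<Rightarrow> real) \<Rightarrow> rvec \<Rightarrow> rvec \<Rightarrow> bool" where
  "has_gradient p f g \<theta> \<longleftrightarrow> g \<in> carrier_vec p \<and>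
     (\<forall>e>0. \<exists>d>0. \<forall>h\<in>carrier_vec p. vnorm h < d \<longrightarrow>
        \<bar>f (\<theta> + h) - f \<theta> - g \<bullet> h\<bar> \<le> e * vnorm h)"

definition gradient :: "nat \<Rightarrow> (rvec \<Rightarrow> real) \<Rightarrow> rvec \<Rightarrow> rvec" where
  "gradient p f \<theta> = (THE g. has_gradient p f g \<theta>)"

definition has_jacobian :: "nat \<Rightarrow> (rvec \<Rightarrow> rvec) \<Rightarrow> rmat \<Rightarrow> rvec \<Rightarrow> bool" where
  "has_jacobian p G H \<theta> \<longleftrightarrow> H \<in> carrier_mat p p \<and>
     (\<forall>e>0. \<exists>d>0. \<forall>h\<in>carrier_vec p. vnorm h < d \<longrightarrow>
        vnorm (G (\<theta> + h) - G \<theta> - H *\<^sub>v h) \<le> e * vnorm h)"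

definition hessian :: "nat \<Rightarrow> (rvec \<Rightarrow> real) \<Rightarrow> rvec \<Rightarrow> rmat" where
  "hessian p f \<theta> = (THE H. has_jacobian p (gradient p f) H \<theta>)"

definition twice_differentiable :: "nat \<Rightarrow> (rvec \<Rightarrow> real) \<Rightarrow> bool" where
  "twice_differentiable p f \<longleftrightarrow> (\<forall>\<theta>\<in>carrier_vec p.
     (\<exists>g. has_gradient p f g \<theta>) \<and> (\<exists>H. has_jacobian p (gradient p f) H \<theta>))"


section \<open>Measures on \<open>\<real>\<^sup>p\<close>\<close>

definition borel_vec :: "nat \<Rightarrow> rvec measure" where
  "borel_vec p = vimage_algebra (carrier_vec p) (\<lambda>v. \<lambda>i\<in>{..<p}. v $ i) (\<Pi>\<^sub>M i\<in>{..<p}. borel)"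

definition lborel_vec :: "nat \<Rightarrow> rvec measure" where
  "lborel_vec p = distr (\<Pi>\<^sub>M i\<in>{..<p}. lborel) (borel_vec p) (Matrix.vec p)"

text \<open>\<open>N(\<mu>, \<Sigma>)\<close> with mean \<open>\<mu>\<close> and invertible covariance matrix \<open>\<Sigma>\<close>.\<close>

definition gaussian :: "nat \<Rightarrow> rvec \<Rightarrow> rmat \<Rightarrow> rvec measure" where
  "gaussian p \<mu> \<Sigma> = density (lborel_vec p) (\<lambda>\<theta>. ennreal
     (exp (- ((\<theta> - \<mu>) \<bullet> (minv \<Sigma> *\<^sub>v (\<theta> - \<mu>))) / 2) / sqrt ((2 * pi) ^ p * Determinant.det \<Sigma>)))"

definition tv_dist :: "'a measure \<Rightarrow> 'a measure \<Rightarrow> real" where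
  "tv_dist P Q = (SUP A \<in> sets P. \<bar>measure P A - measure Q A\<bar>)"

text \<open>The expectation of a possibly non-integrable function.\<close>

definition ext_expectation :: "'w measure \<Rightarrow> ('w \<Rightarrow> real) \<Rightarrow> ereal" where
  "ext_expectation P f =
     enn2ereal (\<integral>\<^sup>+\<omega>. ennreal (f \<omega>) \<partial>P) - enn2ereal (\<integral>\<^sup>+\<omega>. ennreal (- f \<omega>) \<partial>P)"


section \<open>The statistical model and the estimators\<close>

text \<open>
  Time starts at \<open>1\<close>; \<open>dens S t \<theta>\<close> is the density of \<open>obs S t\<close> with respect to the dominating
  measure \<open>refm S t\<close> on the observation space.
  The estimators are arbitrary selections from the sets of minimisers, see \<open>estimators\<close> below.
\<close>

record ('w, 'y) model =
  dim :: nat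
  prob :: "'w measure"
  refm :: "nat \<Rightarrow> 'y measure"
  obs :: "nat \<Rightarrow> 'w \<Rightarrow> 'y"
  dens :: "nat \<Rightarrow> rvec \<Rightarrow> 'y \<Rightarrow> real"
  theta_star :: rvec
  theta0 :: rvec
  Omega0 :: rmat
  map_est :: "nat \<Rightarrow> 'w \<Rightarrow> rvec"
  ml_est :: "nat \<Rightarrow> 'w \<Rightarrow> rvec"

definition loss :: "('w, 'y) model \<Rightarrow> 'w \<Rightarrow> nat \<Rightarrow> rvec \<Rightarrow> real" where
  "loss S \<omega> t \<theta> = - ln (dens S t \<theta> (obs S t \<omega>))"

definition grad_loss :: "('w, 'y) model \<Rightarrow> 'w \<Rightarrow> nat \<Rightarrow> rvec \<Rightarrow> rvec" where
  "grad_loss S \<omega> t \<theta> = gradient (dim S) (loss S \<omega> t) \<theta>"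

definition hess_loss :: "('w, 'y) model \<Rightarrow> 'w \<Rightarrow> nat \<Rightarrow> rvec \<Rightarrow> rmat" where
  "hess_loss S \<omega> t \<theta> = hessian (dim S) (loss S \<omega> t) \<theta>"

definition F_mat :: "('w, 'y) model \<Rightarrow> 'w \<Rightarrow> nat \<Rightarrow> rvec \<Rightarrow> rmat" where
  "F_mat S \<omega> t \<theta> = mat_sum (dim S) (\<lambda>s. hess_loss S \<omega> s \<theta>) {1..t}"

definition Theta_ball :: "('w, 'y) model \<Rightarrow> real \<Rightarrow> rvec set" where
  "Theta_ball S r = {\<theta> \<in> carrier_vec (dim S). vnorm (\<theta> - theta_star S) \<le> r}"

definition correctly_specified :: "('w, 'y) model \<Rightarrow> bool" where
  "correctly_specified S \<longleftrightarrow>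
     dim S \<ge> 1 \<and> prob_space (prob S) \<and> theta_star S \<in> carrier_vec (dim S) \<and>
     (\<forall>t\<ge>1. sigma_finite_measure (refm S t)) \<and>
     (\<forall>t\<ge>1. \<forall>\<theta>\<in>carrier_vec (dim S).
        dens S t \<theta> \<in> borel_measurable (refm S t) \<and>
        (\<forall>y\<in>space (refm S t). 0 \<le> dens S t \<theta> y) \<and>
        (\<integral>\<^sup>+y. ennreal (dens S t \<theta> y) \<partial>refm S t) = 1 \<and>
        \<comment> \<open>the loss is finite\<close>
        (\<forall>\<omega>\<in>space (prob S). 0 < dens S t \<theta> (obs S t \<omega>))) \<and>
     (\<forall>t\<ge>1. distributed (prob S) (\<Pi>\<^sub>M s\<in>{1..t}. refm S s) (\<lambda>\<omega>. \<lambda>s\<in>{1..t}. obs S s \<omega>)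
        (\<lambda>y. \<Prod>s\<in>{1..t}. ennreal (dens S s (theta_star S) (y s))))"

definition ml_objective :: "('w, 'y) model \<Rightarrow> 'w \<Rightarrow> nat \<Rightarrow> rvec \<Rightarrow> real" where
  "ml_objective S \<omega> t \<theta> = (\<Sum>s=1..t. loss S \<omega> s \<theta>)"

definition map_objective :: "('w, 'y) model \<Rightarrow> 'w \<Rightarrow> nat \<Rightarrow> rvec \<Rightarrow> real" where
  "map_objective S \<omega> t \<theta> = (\<Sum>s=1..t. loss S \<omega> s \<theta>) +
     1 / 2 * (vnorm (mat_sqrt (Omega0 S) *\<^sub>v (\<theta> - theta0 S)))\<^sup>2"

abbreviation minimises :: "('w, 'y) model \<Rightarrow> (rvec \<Rightarrow> real) \<Rightarrow> rvec \<Rightarrow> bool" where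
  "minimises S f \<equiv> is_arg_min f (\<lambda>\<theta>. \<theta> \<in> carrier_vec (dim S))"

text \<open>
  The estimators are pinned down only where a minimiser exists (for instance, a maximum likelihood
  estimator need not exist for small \<open>t\<close>); existence is part of \<open>warm_start\<close>.
\<close>

definition estimators :: "('w, 'y) model \<Rightarrow> bool" where
  "estimators S \<longleftrightarrow> (\<forall>\<omega>\<in>space (prob S). \<forall>t\<ge>1.
     (Ex (minimises S (map_objective S \<omega> t)) \<longrightarrow>
        minimises S (map_objective S \<omega> t) (map_est S t \<omega>)) \<and>
     (Ex (minimises S (ml_objective S \<omega> t)) \<longrightarrow>
        minimises S (ml_objective S \<omega> t) (ml_est S t \<omega>)))"


section \<open>The algorithm\<close>

text \<open>The pairs \<open>(\<theta>\<^sub>t, \<Omega>\<^sub>t)\<close> for phase transition time \<open>t\<^sub>0\<close>.\<close>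

fun run :: "('w, 'y) model \<Rightarrow> nat \<Rightarrow> 'w \<Rightarrow> nat \<Rightarrow> rvec \<times> rmat" where
  "run S t\<^sub>0 \<omega> 0 = (theta0 S, Omega0 S)"
| "run S t\<^sub>0 \<omega> (Suc t) =
     (if Suc t \<le> t\<^sub>0 then
        (map_est S (Suc t) \<omega>, Omega0 S + F_mat S \<omega> (Suc t) (map_est S (Suc t) \<omega>))
      else
        let \<theta> = fst (run S t\<^sub>0 \<omega> t);
            \<Omega> = snd (run S t\<^sub>0 \<omega> t) + hess_loss S \<omega> (Suc t) \<theta>
        in (\<theta> - minv \<Omega> *\<^sub>v grad_loss S \<omega> (Suc t) \<theta>, \<Omega>))"

definition theta_run :: "('w, 'y) model \<Rightarrow> nat \<Rightarrow> 'w \<Rightarrow> nat \<Rightarrow> rvec" where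
  "theta_run S t\<^sub>0 \<omega> t = fst (run S t\<^sub>0 \<omega> t)"

definition Omega_run :: "('w, 'y) model \<Rightarrow> nat \<Rightarrow> 'w \<Rightarrow> nat \<Rightarrow> rmat" where
  "Omega_run S t\<^sub>0 \<omega> t = snd (run S t\<^sub>0 \<omega> t)"

definition g_run :: "('w, 'y) model \<Rightarrow> nat \<Rightarrow> 'w \<Rightarrow> nat \<Rightarrow> rvec" where
  "g_run S t\<^sub>0 \<omega> t = grad_loss S \<omega> t (theta_run S t\<^sub>0 \<omega> (t - 1))"

definition H_run :: "('w, 'y) model \<Rightarrow> nat \<Rightarrow> 'w \<Rightarrow> nat \<Rightarrow> rmat" where
  "H_run S t\<^sub>0 \<omega> t = hess_loss S \<omega> t (theta_run S t\<^sub>0 \<omega> (t - 1))"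

definition t_exit :: "('w, 'y) model \<Rightarrow> nat \<Rightarrow> real \<Rightarrow> 'w \<Rightarrow> enat" where
  "t_exit S t\<^sub>0 r \<omega> = Inf (enat ` {t. t > t\<^sub>0 \<and> theta_run S t\<^sub>0 \<omega> t \<notin> Theta_ball S r})"

text \<open>The antecedent says that the algorithm can be started on the path \<open>\<omega>\<close>.\<close>

definition psd_increments :: "('w, 'y) model \<Rightarrow> nat \<Rightarrow> bool" where
  "psd_increments S t\<^sub>0 \<longleftrightarrow> (\<forall>\<omega>\<in>space (prob S).
     Ex (minimises S (map_objective S \<omega> t\<^sub>0)) \<longrightarrow> (\<forall>t>t\<^sub>0. psd (H_run S t\<^sub>0 \<omega> t)))"


section \<open>Distributions\<close>

definition Pi_t :: "('w, 'y) model \<Rightarrow> nat \<Rightarrow> 'w \<Rightarrow> nat \<Rightarrow> rvec measure" where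
  "Pi_t S t\<^sub>0 \<omega> t = gaussian (dim S) (theta_run S t\<^sub>0 \<omega> t) (minv (Omega_run S t\<^sub>0 \<omega> t))"

definition Q_BvM :: "('w, 'y) model \<Rightarrow> 'w \<Rightarrow> nat \<Rightarrow> rvec measure" where
  "Q_BvM S \<omega> t = gaussian (dim S) (ml_est S t \<omega>) (minv (F_mat S \<omega> t (theta_star S)))"

definition prior :: "('w, 'y) model \<Rightarrow> rvec measure" where
  "prior S = gaussian (dim S) (theta0 S) (minv (Omega0 S))"

definition posterior :: "('w, 'y) model \<Rightarrow> 'w \<Rightarrow> nat \<Rightarrow> rvec measure" where
  "posterior S \<omega> t = density (prior S) (\<lambda>\<theta>. ennreal (exp (- (\<Sum>s=1..t. loss S \<omega> s \<theta>))) /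
     (\<integral>\<^sup>+\<theta>'. ennreal (exp (- (\<Sum>s=1..t. loss S \<omega> s \<theta>'))) \<partial>prior S))"

definition eps_app :: "nat \<Rightarrow> real \<Rightarrow> nat \<Rightarrow> nat \<Rightarrow> real" where
  "eps_app p x t\<^sub>0 t =
     sqrt ((ln (real t / real t\<^sub>0))\<^sup>2 * (real p * ln (real t) + x)\<^sup>2 / real t)"


section \<open>The assumptions\<close>

definition event_at_level :: "('w, 'y) model \<Rightarrow> real \<Rightarrow> 'w set \<Rightarrow> bool" where
  "event_at_level S x E \<longleftrightarrow> E \<in> sets (prob S) \<and> measure (prob S) E \<ge> 1 - exp (- x)"

definition basic :: "('w, 'y) model \<Rightarrow> real \<Rightarrow> real \<Rightarrow> real \<Rightarrow> bool" where
  "basic S K\<^sub>b lam\<^sub>l lam\<^sub>u \<longleftrightarrow>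
     (\<forall>\<omega>\<in>space (prob S). \<forall>t\<ge>1. twice_differentiable (dim S) (loss S \<omega> t)) \<and>
     (\<forall>t\<ge>1. \<forall>\<theta>\<in>carrier_vec (dim S).
        \<comment> \<open>the expectation is well-defined, possibly \<open>\<infinity>\<close>\<close>
        (\<integral>\<^sup>+\<omega>. ennreal (- loss S \<omega> t \<theta>) \<partial>prob S) < \<infinity> \<and>
        (\<theta> \<noteq> theta_star S \<longrightarrow>
           ext_expectation (prob S) (\<lambda>\<omega>. loss S \<omega> t (theta_star S)) <
           ext_expectation (prob S) (\<lambda>\<omega>. loss S \<omega> t \<theta>))) \<and>
     theta0 S \<in> carrier_vec (dim S) \<and> Omega0 S \<in> carrier_mat (dim S) (dim S) \<and>
     transpose_mat (Omega0 S) = Omega0 S \<and>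
     0 < lam\<^sub>l \<and> lam\<^sub>l \<le> lambda_min (Omega0 S) \<and> lambda_min (Omega0 S) \<le> lambda_max (Omega0 S) \<and>
     lambda_max (Omega0 S) \<le> lam\<^sub>u \<and> lam\<^sub>u \<le> K\<^sub>b"

definition curvature ::
  "('w, 'y) model \<Rightarrow> real \<Rightarrow> real \<Rightarrow> real \<Rightarrow> real \<Rightarrow> 'w set \<Rightarrow> bool" where
  "curvature S r x K\<^sub>1 K\<^sub>2 E\<^sub>1 \<longleftrightarrow> event_at_level S x E\<^sub>1 \<and>
     (\<forall>\<omega>\<in>E\<^sub>1. \<forall>t\<ge>1. real t \<ge> K\<^sub>1 * (real (dim S) + x) \<longrightarrow>
        (\<forall>\<theta>. (\<forall>s\<in>{1..t}. \<theta> s \<in> Theta_ball S r) \<longrightarrow>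
           lambda_min (mat_sum (dim S) (\<lambda>s. hess_loss S \<omega> s (\<theta> s)) {1..t}) \<ge> K\<^sub>2 * real t))"

definition smoothness :: "('w, 'y) model \<Rightarrow> real \<Rightarrow> real \<Rightarrow> real \<Rightarrow> bool" where
  "smoothness S r L\<^sub>1 L\<^sub>2 \<longleftrightarrow>
     (\<forall>\<omega>\<in>space (prob S). \<forall>t\<ge>1. \<forall>\<theta>\<in>Theta_ball S r. \<forall>\<theta>'\<in>Theta_ball S r.
        \<exists>\<phi>\<ge>0. \<phi> \<le> L\<^sub>1 * vnorm (\<theta> - \<theta>') \<and>
          (\<exists>u\<in>{0..1}. let \<eta> = \<theta>' + u \<cdot>\<^sub>v (\<theta> - \<theta>') in
             hess_loss S \<omega> t \<theta> \<preceq> (1 + \<phi>) \<cdot>\<^sub>m hess_loss S \<omega> t \<eta> \<and>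
             loss S \<omega> t \<theta> = loss S \<omega> t \<theta>' + grad_loss S \<omega> t \<theta>' \<bullet> (\<theta> - \<theta>') +
               1 / 2 * mat_inner (hess_loss S \<omega> t \<eta>) (outer (\<theta> - \<theta>')))) \<and>
     (\<forall>\<omega>\<in>space (prob S). \<forall>t\<ge>1. \<forall>\<theta>\<in>Theta_ball S r. op_norm (hess_loss S \<omega> t \<theta>) \<le> L\<^sub>2)"

definition hessian_regularity :: "('w, 'y) model \<Rightarrow> real \<Rightarrow> real \<Rightarrow> real \<Rightarrow> bool" where
  "hessian_regularity S r L\<^sub>3 K\<^sub>6 \<longleftrightarrow>
     (\<forall>\<omega>\<in>space (prob S). \<forall>t\<ge>1. \<forall>\<theta>\<in>Theta_ball S r. \<forall>\<theta>'\<in>Theta_ball S r.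
        op_norm (hess_loss S \<omega> t \<theta> - hess_loss S \<omega> t \<theta>') \<le> L\<^sub>3 * vnorm (\<theta> - \<theta>')) \<and>
     (\<forall>\<omega>\<in>space (prob S). \<forall>t\<ge>1. \<forall>\<theta>\<in>Theta_ball S r. \<forall>h\<in>carrier_vec (dim S).
        \<theta> + h \<in> Theta_ball S r \<longrightarrow>
          inverse (1 + exp (K\<^sub>6 * vnorm h)) \<cdot>\<^sub>m F_mat S \<omega> t \<theta> \<preceq> F_mat S \<omega> t (\<theta> + h) \<and>
          F_mat S \<omega> t (\<theta> + h) \<preceq> (1 + exp (K\<^sub>6 * vnorm h)) \<cdot>\<^sub>m F_mat S \<omega> t \<theta>)"

definition fluctuation ::
  "('w, 'y) model \<Rightarrow> nat \<Rightarrow> real \<Rightarrow> real \<Rightarrow> real \<Rightarrow> real \<Rightarrow> real \<Rightarrow> real \<Rightarrow> 'w set \<Rightarrow> 'w set \<Rightarrow> bool"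
where
  "fluctuation S t\<^sub>0 r x K\<^sub>1 K\<^sub>3 K\<^sub>4 K\<^sub>5 E\<^sub>2 E\<^sub>3 \<longleftrightarrow>
     real t\<^sub>0 \<ge> K\<^sub>1 * (real (dim S) + x) \<and>
     event_at_level S x E\<^sub>2 \<and>
     (\<forall>\<omega>\<in>E\<^sub>2. \<forall>t>t\<^sub>0.
        (\<Sum>s=t\<^sub>0+1..t. loss S \<omega> s (theta_star S) - loss S \<omega> s (theta_run S t\<^sub>0 \<omega> (s - 1))) \<le> K\<^sub>3 * x) \<and>
     event_at_level S x E\<^sub>3 \<and>
     (\<forall>\<omega>\<in>E\<^sub>3. \<forall>t. t\<^sub>0 < t \<and> enat t \<le> t_exit S t\<^sub>0 r \<omega> \<longrightarrow>
        (\<Sum>s=t\<^sub>0+1..t. g_run S t\<^sub>0 \<omega> s \<bullet> (minv (Omega_run S t\<^sub>0 \<omega> s) *\<^sub>v g_run S t\<^sub>0 \<omega> s))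
          \<le> K\<^sub>4 * real (dim S) * ln (real t) + K\<^sub>5 * (x + ln (real t)))"

definition warm_start_time :: "nat \<Rightarrow> real \<Rightarrow> real \<Rightarrow> nat \<Rightarrow> bool" where
  "warm_start_time p x M t\<^sub>0 \<longleftrightarrow> int t\<^sub>0 \<ge> \<lceil>M * (real p * ln (max (real p) 3) + x)\<rceil>"

text \<open>
  \<open>warm_start S t\<^sub>0 x C E\<^sub>4\<close> is the condition for one phase transition time; the theorem assumes it for
  every \<open>t\<^sub>0\<close> that is large enough in the sense of \<open>warm_start_time\<close>. For a single \<open>t\<^sub>0\<close> it would only
  bound the prior bias \<open>\<Omega>\<^sub>0(\<theta>\<^sub>0 - \<theta>\<^sub>\<star>)\<close> by a multiple of \<open>sqrt (t\<^sub>0 (p + log t\<^sub>0 + x))\<close>, and a bias of that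
  order is incompatible with a bound \<open>K * eps_app\<close> in which \<open>K\<close> depends neither on \<open>\<theta>\<^sub>0\<close> nor on \<open>t\<^sub>0\<close>.
\<close>

definition warm_start ::
  "('w, 'y) model \<Rightarrow> nat \<Rightarrow> real \<Rightarrow> real \<Rightarrow> 'w set \<Rightarrow> bool" where
  "warm_start S t\<^sub>0 x C E\<^sub>4 \<longleftrightarrow> event_at_level S x E\<^sub>4 \<and>
     (\<forall>\<omega>\<in>E\<^sub>4.
        (\<forall>t\<ge>t\<^sub>0. Ex (minimises S (map_objective S \<omega> t)) \<and> Ex (minimises S (ml_objective S \<omega> t))) \<and>
        (vnorm (mat_sqrt (Omega_run S t\<^sub>0 \<omega> t\<^sub>0) *\<^sub>v (map_est S t\<^sub>0 \<omega> - theta_star S)))\<^sup>2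
          \<le> C * (real (dim S) + x) \<and>
        (\<forall>t\<ge>t\<^sub>0. max (vnorm (map_est S t \<omega> - theta_star S)) (vnorm (ml_est S t \<omega> - theta_star S))
          \<le> C * sqrt ((real (dim S) + ln (real t) + x) / real t)))"

end

theory Submission
  imports Defs
begin

text \<open>
  Write \<open>q\<^sub>t = p log t + x\<close> (called \<open>rate\<close> below), \<open>F\<^sub>t\<close> for the observed information at the true parameter
  \<open>\<theta>\<^sub>\<star>\<close> and \<open>m\<^sub>t\<close> for the maximum likelihood estimator. The total variation distance of \<open>N(m\<^sub>t, F\<^sub>t\<^sup>-\<^sup>1)\<close> and
  \<open>N(\<theta>\<^sub>t, \<Omega>\<^sub>t\<^sup>-\<^sup>1)\<close> is at most the Mahalanobis distance of the means plus \<open>sqrt p\<close> times the relative size of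
  \<open>\<Omega>\<^sub>t - F\<^sub>t\<close> in operator norm (\<open>tv_dist_gaussian\<close>). Since \<open>\<Omega>\<^sub>t\<close> and \<open>F\<^sub>t\<close> both dominate \<open>K\<^sub>2 t\<close>, it suffices that
  \<open>\<Omega>\<^sub>t - F\<^sub>t\<close> is of order \<open>sqrt (q\<^sub>t t)\<close> and \<open>F\<^sub>t (m\<^sub>t - \<theta>\<^sub>t)\<close> of order \<open>q\<^sub>t log (t / t\<^sub>0)\<close>.

  Both follow from \<open>|\<theta>\<^sub>s - \<theta>\<^sub>\<star>|\<^sup>2 = O(q\<^sub>s / s)\<close> for all \<open>s \<ge> t\<^sub>0\<close> (\<open>localisation\<close>). For this the energy
  \<open>(\<theta>\<^sub>t - \<theta>\<^sub>\<star>) \<bullet> \<Omega>\<^sub>t (\<theta>\<^sub>t - \<theta>\<^sub>\<star>)\<close> is followed along the recursion. A Newton step changes it by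
  \<open>2 (l\<^sub>t(\<theta>\<^sub>\<star>) - l\<^sub>t(\<theta>\<^sub>t\<^sub>-\<^sub>1)) + g\<^sub>t \<bullet> \<Omega>\<^sub>t\<^sup>-\<^sup>1 g\<^sub>t\<close>, whose sums are the fluctuations controlled by hypothesis, and by a
  linearisation error, because the step uses the curvature at \<open>\<theta>\<^sub>t\<^sub>-\<^sub>1\<close> and the loss difference an average
  of the curvature over the segment to \<open>\<theta>\<^sub>\<star>\<close>. The smoothness condition compares the curvature at an end
  point of any subsegment with its average over that subsegment, and this already bounds the curvature at
  \<open>\<theta>\<^sub>t\<^sub>-\<^sub>1\<close> by \<open>1 + O(|\<theta>\<^sub>t\<^sub>-\<^sub>1 - \<theta>\<^sub>\<star>|)\<close> times that at every point (\<open>second_derivative_comparable\<close>). The error is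
  therefore cubic in \<open>|\<theta>\<^sub>t\<^sub>-\<^sub>1 - \<theta>\<^sub>\<star>|\<close> with a factor \<open>L\<^sub>1 L\<^sub>2\<close> only, and for a long burn-in the errors sum to
  a small multiple of the rate. This closes an induction that also keeps the iterates in the ball.

  The Lipschitz condition on the Hessians then bounds \<open>\<Omega>\<^sub>t - F\<^sub>t\<close> (\<open>covariance_gap\<close>). For the means,
  \<open>\<Omega>\<^sub>t (\<theta>\<^sub>t - \<theta>\<^sub>\<star>)\<close> obeys a linear recursion: up to quadratic errors it equals minus the score at \<open>\<theta>\<^sub>\<star>\<close> plus
  the prior bias \<open>\<Omega>\<^sub>0 (\<theta>\<^sub>0 - \<theta>\<^sub>\<star>)\<close>, and \<open>F\<^sub>t (m\<^sub>t - \<theta>\<^sub>\<star>)\<close> equals minus the same score (\<open>mean_gap\<close>). The quadratic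
  errors sum to \<open>q\<^sub>t log (t / t\<^sub>0)\<close>. The prior bias is deterministic, and comparing the first-order conditions
  of the two estimators at the smallest admissible phase transition time, on any path of the
  corresponding event, shows that it is of order \<open>q\<^sub>t\<close> (\<open>prior_bias\<close>).

  The Gaussian bound is proved through the Hellinger affinity, which for Gaussians is again a Gaussian
  integral. The normalising constant is the only integral that has to be computed; it also yields the
  monotonicity of the determinant, by which the affinity of different covariances is estimated.
\<close>

section \<open>Inner products and norms\<close>

lemma vnorm_nonneg [simp]: "0 \<le> vnorm v"
  by (simp add: vnorm_def scalar_prod_def sum_nonneg)

lemma vnorm_eq_L2_set: "vnorm v = L2_set (\<lambda>i. v $ i) {0..<dim_vec v}"
  by (simp add: vnorm_def L2_set_def scalar_prod_def power2_eq_square)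

lemma vnorm_sq: "(vnorm v)\<^sup>2 = v \<bullet> v"
  by (simp add: vnorm_def scalar_prod_def sum_nonneg)

lemma scalar_prod_le_vnorm:
  assumes "v \<in> carrier_vec p" "w \<in> carrier_vec p"
  shows "\<bar>v \<bullet> w\<bar> \<le> vnorm v * vnorm w"
proof -
  have "\<bar>v \<bullet> w\<bar> \<le> (\<Sum>i\<in>{0..<p}. \<bar>v $ i\<bar> * \<bar>w $ i\<bar>)"
    using assms by (auto simp: scalar_prod_def abs_mult[symmetric] intro!: sum_abs)
  also have "\<dots> \<le> L2_set (\<lambda>i. v $ i) {0..<p} * L2_set (\<lambda>i. w $ i) {0..<p}"
    by (rule L2_set_mult_ineq)
  also have "\<dots> = vnorm v * vnorm w"
    using assms by (simp add: vnorm_eq_L2_set)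
  finally show ?thesis .
qed

lemma vnorm_triangle:
  assumes "v \<in> carrier_vec p" "w \<in> carrier_vec p"
  shows "vnorm (v + w) \<le> vnorm v + vnorm w"
  using L2_set_triangle_ineq[of "\<lambda>i. v $ i" "\<lambda>i. w $ i" "{0..<p}"] assms
  by (simp add: vnorm_eq_L2_set L2_set_def)

lemma vnorm_smult [simp]: "vnorm (c \<cdot>\<^sub>v v) = \<bar>c\<bar> * vnorm v"
proof -
  have "(c \<cdot>\<^sub>v v) \<bullet> (c \<cdot>\<^sub>v v) = c\<^sup>2 * (v \<bullet> v)"
    by (simp add: power2_eq_square)
  then show ?thesis
    by (simp add: vnorm_def real_sqrt_mult)
qed

lemma vnorm_minus_commute:
  assumes "v \<in> carrier_vec p" "w \<in> carrier_vec p"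
  shows "vnorm (v - w) = vnorm (w - v)"
  using assms unfolding vnorm_eq_L2_set L2_set_def
  by (auto simp: power2_commute)

lemma vnorm_diff_triangle:
  assumes "u \<in> carrier_vec p" "v \<in> carrier_vec p" "w \<in> carrier_vec p"
  shows "vnorm (u - w) \<le> vnorm (u - v) + vnorm (v - w)"
proof -
  have "u - w = (u - v) + (v - w)"
    using assms by (intro eq_vecI) auto
  then show ?thesis
    using vnorm_triangle[of "u - v" p "v - w"] assms by simp
qed

lemma vnorm_zero [simp]: "vnorm (0\<^sub>v p) = 0"
  by (simp add: vnorm_def)

lemma vnorm_eq_0_iff:
  assumes "v \<in> carrier_vec p"
  shows "vnorm v = 0 \<longleftrightarrow> v = 0\<^sub>v p"
  using assms by (auto simp: vnorm_eq_L2_set L2_set_eq_0_iff intro: eq_vecI)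

lemma vnorm_pos:
  assumes "v \<in> carrier_vec p" "v \<noteq> 0\<^sub>v p"
  shows "0 < vnorm v"
  using assms vnorm_eq_0_iff[of v p] vnorm_nonneg[of v] by linarith

text \<open>
  Vectors given by sums and recursions are bounded through their inner products with a test vector,
  which replaces vector identities by identities between reals.
\<close>

lemma vnorm_le_by_testing:
  assumes "v \<in> carrier_vec p" "\<And>w. w \<in> carrier_vec p \<Longrightarrow> w \<bullet> v \<le> B * vnorm w" "0 \<le> B"
  shows "vnorm v \<le> B"
proof (cases "vnorm v = 0")
  case False
  have "vnorm v * vnorm v \<le> B * vnorm v"
    using assms(2)[OF assms(1)] by (simp add: vnorm_sq[symmetric] power2_eq_square)
  then show ?thesis
    using False vnorm_nonneg[of v] by (simp add: mult_le_cancel_right)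
qed (use assms in simp)

text \<open>A crude bound, which serves to make the supremum in \<^const>\<open>op_norm\<close> a proper one.\<close>

lemma vnorm_mult_mat_vec_bound:
  fixes A :: rmat
  assumes A: "A \<in> carrier_mat p q"
  obtains B where "\<And>v. v \<in> carrier_vec q \<Longrightarrow> vnorm (A *\<^sub>v v) \<le> B * vnorm v"
proof
  fix v :: rvec
  assume v: "v \<in> carrier_vec q"
  have "vnorm (A *\<^sub>v v) \<le> (\<Sum>i<p. \<bar>(A *\<^sub>v v) $ i\<bar>)"
    unfolding vnorm_eq_L2_set using A L2_set_le_sum_abs[of "\<lambda>i. (A *\<^sub>v v) $ i" "{0..<p}"]
    by (simp add: lessThan_atLeast0)
  also have "\<dots> \<le> (\<Sum>i<p. vnorm (Matrix.row A i) * vnorm v)"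
  proof (rule sum_mono)
    fix i assume "i \<in> {..<p}"
    then show "\<bar>(A *\<^sub>v v) $ i\<bar> \<le> vnorm (Matrix.row A i) * vnorm v"
      using A v scalar_prod_le_vnorm[of "Matrix.row A i" q v] by auto
  qed
  finally show "vnorm (A *\<^sub>v v) \<le> (\<Sum>i<p. vnorm (Matrix.row A i)) * vnorm v"
    by (simp add: sum_distrib_right)
qed

lemma vnorm_mult_mat_vec_le:
  fixes A :: rmat
  assumes A: "A \<in> carrier_mat p q" and v: "v \<in> carrier_vec q"
  shows "vnorm (A *\<^sub>v v) \<le> op_norm A * vnorm v"
proof (cases "v = 0\<^sub>v q")
  case True
  have "A *\<^sub>v 0\<^sub>v q = 0\<^sub>v p"
    using A by (intro eq_vecI) auto
  then show ?thesis
    using True by simp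
next
  case False
  then have pos: "0 < vnorm v"
    using v vnorm_pos by blast
  obtain B where B: "\<And>v. v \<in> carrier_vec q \<Longrightarrow> vnorm (A *\<^sub>v v) \<le> B * vnorm v"
    using vnorm_mult_mat_vec_bound[OF A] by blast
  have bdd: "bdd_above ((\<lambda>v. vnorm (A *\<^sub>v v)) ` {v \<in> carrier_vec (dim_col A). vnorm v \<le> 1})"
  proof (rule bdd_aboveI2)
    fix w assume "w \<in> {v \<in> carrier_vec (dim_col A). vnorm v \<le> 1}"
    then show "vnorm (A *\<^sub>v w) \<le> \<bar>B\<bar>"
      using B[of w] A mult_mono[of B "\<bar>B\<bar>" "vnorm w" 1] by force
  qed
  let ?w = "inverse (vnorm v) \<cdot>\<^sub>v v"
  have w1: "vnorm ?w = 1"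
    using pos by (simp del: vnorm_nonneg)
  have w: "?w \<in> {v \<in> carrier_vec (dim_col A). vnorm v \<le> 1}"
    using v A w1 by auto
  have "vnorm (A *\<^sub>v ?w) \<le> op_norm A"
    unfolding op_norm_def by (rule cSUP_upper[OF w bdd])
  moreover have "A *\<^sub>v ?w = inverse (vnorm v) \<cdot>\<^sub>v (A *\<^sub>v v)"
    using A v by (simp add: mult_mat_vec)
  ultimately show ?thesis
    using pos by (simp add: field_simps)
qed

lemma bilinear_le_op_norm:
  fixes A :: rmat
  assumes "A \<in> carrier_mat p q" "v \<in> carrier_vec q" "w \<in> carrier_vec p"
  shows "\<bar>w \<bullet> (A *\<^sub>v v)\<bar> \<le> op_norm A * vnorm v * vnorm w"
proof -
  have "\<bar>w \<bullet> (A *\<^sub>v v)\<bar> \<le> vnorm w * vnorm (A *\<^sub>v v)"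
    using assms by (intro scalar_prod_le_vnorm[of _ p]) auto
  also have "\<dots> \<le> vnorm w * (op_norm A * vnorm v)"
    using vnorm_mult_mat_vec_le[OF assms(1,2)] by (simp add: mult_left_mono)
  finally show ?thesis
    by (simp add: mult_ac)
qed

lemma mat_sum_carrier [simp]: "mat_sum p A I \<in> carrier_mat p p"
  by (simp add: mat_sum_def)

lemma bilinear_expand:
  fixes A :: rmat
  assumes "A \<in> carrier_mat p q" "v \<in> carrier_vec q" "w \<in> carrier_vec p"
  shows "w \<bullet> (A *\<^sub>v v) = (\<Sum>i<p. \<Sum>j<q. w $ i * A $$ (i, j) * v $ j)"
  using assms by (auto simp: scalar_prod_def lessThan_atLeast0 sum_distrib_left mult_ac
      intro!: sum.cong)

lemma bilinear_mat_sum: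
  assumes "\<And>s. s \<in> I \<Longrightarrow> A s \<in> carrier_mat p p" "v \<in> carrier_vec p" "w \<in> carrier_vec p"
  shows "w \<bullet> (mat_sum p A I *\<^sub>v v) = (\<Sum>s\<in>I. w \<bullet> (A s *\<^sub>v v))"
proof -
  have "w \<bullet> (mat_sum p A I *\<^sub>v v) = (\<Sum>i<p. \<Sum>j<p. \<Sum>s\<in>I. w $ i * A s $$ (i, j) * v $ j)"
    using assms by (subst bilinear_expand[of _ p p])
      (auto simp: mat_sum_def sum_distrib_left sum_distrib_right)
  also have "\<dots> = (\<Sum>i<p. \<Sum>s\<in>I. \<Sum>j<p. w $ i * A s $$ (i, j) * v $ j)"
    by (intro sum.cong refl sum.swap)
  also have "\<dots> = (\<Sum>s\<in>I. \<Sum>i<p. \<Sum>j<p. w $ i * A s $$ (i, j) * v $ j)"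
    by (rule sum.swap)
  also have "\<dots> = (\<Sum>s\<in>I. w \<bullet> (A s *\<^sub>v v))"
    using assms by (intro sum.cong refl bilinear_expand[symmetric]) auto
  finally show ?thesis .
qed

lemma mat_inner_outer:
  assumes "H \<in> carrier_mat p p" "d \<in> carrier_vec p"
  shows "mat_inner H (outer d) = d \<bullet> (H *\<^sub>v d)"
  using assms by (subst bilinear_expand[of _ p p])
    (auto simp: mat_inner_def outer_def mult_ac intro!: sum.cong)

lemma bilinear_symmetric:
  fixes A :: rmat
  assumes "A \<in> carrier_mat p p" "transpose_mat A = A" "v \<in> carrier_vec p" "w \<in> carrier_vec p"
  shows "w \<bullet> (A *\<^sub>v v) = v \<bullet> (A *\<^sub>v w)"
  using transpose_vec_mult_scalar[of A p p v w] assms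
  by (metis comm_scalar_prod mult_mat_vec_carrier)

section \<open>The spectral theorem for real symmetric matrices\<close>

text \<open>
  A complex eigenvector \<open>x + i y\<close> for \<open>a + i b\<close> satisfies \<open>A x = a x - b y\<close> and \<open>A y = a y + b x\<close>.
  By symmetry \<open>y \<bullet> A x = x \<bullet> A y\<close>, which forces \<open>b = 0\<close>, and \<open>x\<close> or \<open>y\<close> is a real eigenvector.
\<close>

lemma real_symmetric_eigenvector:
  fixes A :: rmat
  assumes A: "A \<in> carrier_mat n n" and sym: "transpose_mat A = A" and n: "0 < n"
  obtains u e where "u \<in> carrier_vec n" "u \<bullet> u = 1" "A *\<^sub>v u = e \<cdot>\<^sub>v u"
proof -
  define Ac where "Ac = map_mat complex_of_real A"
  have Ac: "Ac \<in> carrier_mat n n"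
    using A by (simp add: Ac_def)
  obtain l z where z: "z \<in> carrier_vec n" "z \<noteq> 0\<^sub>v n" "Ac *\<^sub>v z = l \<cdot>\<^sub>v z"
    using spectrum_non_empty[OF Ac n] Ac
    by (auto simp: spectrum_def eigenvalue_def eigenvector_def)
  define x y where "x = map_vec Re z" and "y = map_vec Im z"
  have x: "x \<in> carrier_vec n" and y: "y \<in> carrier_vec n"
    using z by (auto simp: x_def y_def)
  have row: "(Ac *\<^sub>v z) $ i = (\<Sum>j<n. complex_of_real (A $$ (i, j)) * z $ j)" if "i < n" for i
    using that A z(1) by (auto simp: Ac_def scalar_prod_def lessThan_atLeast0 intro!: sum.cong)
  have Ax: "A *\<^sub>v x = Re l \<cdot>\<^sub>v x - Im l \<cdot>\<^sub>v y"
  proof (rule eq_vecI)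
    fix i assume "i < dim_vec (Re l \<cdot>\<^sub>v x - Im l \<cdot>\<^sub>v y)"
    then have i: "i < n" using x y by auto
    have "(A *\<^sub>v x) $ i = (\<Sum>j<n. A $$ (i, j) * Re (z $ j))"
      using i A x z(1) by (auto simp: x_def scalar_prod_def lessThan_atLeast0 intro!: sum.cong)
    also have "\<dots> = Re ((l \<cdot>\<^sub>v z) $ i)"
      using row[OF i] z(3) by simp
    finally show "(A *\<^sub>v x) $ i = (Re l \<cdot>\<^sub>v x - Im l \<cdot>\<^sub>v y) $ i"
      using i z(1) by (simp add: x_def y_def)
  qed (use A x y in auto)
  have Ay: "A *\<^sub>v y = Re l \<cdot>\<^sub>v y + Im l \<cdot>\<^sub>v x"
  proof (rule eq_vecI)
    fix i assume "i < dim_vec (Re l \<cdot>\<^sub>v y + Im l \<cdot>\<^sub>v x)"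
    then have i: "i < n" using x y by auto
    have "(A *\<^sub>v y) $ i = (\<Sum>j<n. A $$ (i, j) * Im (z $ j))"
      using i A x z(1) by (auto simp: y_def scalar_prod_def lessThan_atLeast0 intro!: sum.cong)
    also have "\<dots> = Im ((l \<cdot>\<^sub>v z) $ i)"
      using row[OF i] z(3) by simp
    finally show "(A *\<^sub>v y) $ i = (Re l \<cdot>\<^sub>v y + Im l \<cdot>\<^sub>v x) $ i"
      using i z(1) by (simp add: x_def y_def)
  qed (use A x y in auto)
  have ne: "x \<noteq> 0\<^sub>v n \<or> y \<noteq> 0\<^sub>v n"
  proof (rule ccontr)
    assume "\<not> ?thesis"
    then have "\<And>i. i < n \<Longrightarrow> Re (z $ i) = 0 \<and> Im (z $ i) = 0"
      using z(1) unfolding x_def y_def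
      by (metis carrier_vecD index_map_vec(1) index_zero_vec(1))
    then have "z = 0\<^sub>v n"
      using z(1) by (intro eq_vecI) (auto simp: complex_eq_iff)
    with z(2) show False by simp
  qed
  have pos: "0 < x \<bullet> x + y \<bullet> y"
    using ne vnorm_pos[OF x] vnorm_pos[OF y]
    by (auto simp flip: vnorm_sq simp: add_pos_nonneg add_nonneg_pos)
  have "y \<bullet> (A *\<^sub>v x) = x \<bullet> (A *\<^sub>v y)"
    by (rule bilinear_symmetric[OF A sym x y])
  then have "Im l * (x \<bullet> x + y \<bullet> y) = 0"
    using x y comm_scalar_prod[OF x y] unfolding Ax Ay
    by (simp add: scalar_prod_minus_distrib[of _ n] scalar_prod_add_distrib[of _ n] algebra_simps)
  then have im: "Im l = 0" using pos by simp
  have "A *\<^sub>v x = Re l \<cdot>\<^sub>v x" "A *\<^sub>v y = Re l \<cdot>\<^sub>v y"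
    unfolding Ax Ay im using x y by auto
  then obtain v where v: "v \<in> carrier_vec n" "v \<noteq> 0\<^sub>v n" "A *\<^sub>v v = Re l \<cdot>\<^sub>v v"
    using ne x y by blast
  define u where "u = inverse (vnorm v) \<cdot>\<^sub>v v"
  have vp: "0 < vnorm v" using v vnorm_pos by blast
  show ?thesis
  proof
    show "u \<in> carrier_vec n" using v by (simp add: u_def)
    show "u \<bullet> u = 1" using vp by (simp flip: vnorm_sq add: u_def)
    have "A *\<^sub>v u = inverse (vnorm v) \<cdot>\<^sub>v (Re l \<cdot>\<^sub>v v)"
      unfolding u_def using A v by (simp add: mult_mat_vec)
    then show "A *\<^sub>v u = Re l \<cdot>\<^sub>v u"
      by (simp add: u_def smult_smult_assoc mult.commute)
  qed
qed

text \<open>The reflection in the hyperplane orthogonal to \<open>u - e\<^sub>0\<close> exchanges the unit vectors \<open>u\<close> and \<open>e\<^sub>0\<close>.\<close>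

lemma householder_reflection:
  fixes u :: rvec
  assumes u: "u \<in> carrier_vec n" "u \<bullet> u = 1" and n: "0 < n"
  obtains Q where "Q \<in> carrier_mat n n" "transpose_mat Q = Q" "Q * Q = 1\<^sub>m n"
    "Q *\<^sub>v u = unit_vec n 0"
proof (cases "u = unit_vec n 0")
  case True
  show ?thesis
    by (rule that[of "1\<^sub>m n"]) (use True in auto)
next
  case False
  define w where "w = u - unit_vec n 0"
  have w: "w \<in> carrier_vec n" using u by (simp add: w_def)
  have "w \<noteq> 0\<^sub>v n"
  proof
    assume "w = 0\<^sub>v n"
    then have "\<And>i. i < n \<Longrightarrow> u $ i = unit_vec n 0 $ i"
      using u unfolding w_def by (metis carrier_vecD eq_iff_diff_eq_0 index_minus_vec(1)
        index_unit_vec(3) index_zero_vec(1))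
    then have "u = unit_vec n 0" using u by (intro eq_vecI) auto
    with False show False by simp
  qed
  then have ww: "w \<bullet> w > 0"
    using vnorm_pos[OF w] by (simp flip: vnorm_sq)
  have ww2: "w \<bullet> w = 2 * (w \<bullet> u)"
    using u n comm_scalar_prod[of u n "unit_vec n 0"] unfolding w_def
    by (simp add: scalar_prod_minus_distrib[of _ n] minus_scalar_prod_distrib[of _ n])
  define c where "c = 2 / (w \<bullet> w)"
  define Q where "Q = Matrix.mat n n (\<lambda>(i, j). (if i = j then 1 else 0) - c * w $ i * w $ j)"
  have Q: "Q \<in> carrier_mat n n" by (simp add: Q_def)
  have S: "(\<Sum>k = 0..<n. w $ k * w $ k) = w \<bullet> w"
    using w by (simp add: scalar_prod_def)
  have "Q * Q = 1\<^sub>m n"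
  proof (rule eq_matI)
    fix i j assume "i < dim_row (1\<^sub>m n)" "j < dim_col (1\<^sub>m n)"
    then have ij: "i < n" "j < n" by auto
    have "(Q * Q) $$ (i, j) = (\<Sum>k = 0..<n. (if i = k then (if k = j then 1 else 0) else 0)
        - (if i = k then c * w $ k * w $ j else 0)
        - (if k = j then c * w $ i * w $ k else 0) + (c * c * w $ i * w $ j) * (w $ k * w $ k))"
      using ij by (auto simp: Q_def scalar_prod_def algebra_simps intro!: sum.cong)
    also have "\<dots> = (if i = j then 1 else 0) - 2 * c * w $ i * w $ j
        + c * c * w $ i * w $ j * (w \<bullet> w)"
      using ij by (simp add: sum.distrib sum_subtractf sum_distrib_left[symmetric] S)
    also have "\<dots> = (if i = j then 1 else 0)"
      using ww by (simp add: c_def field_simps)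
    finally show "(Q * Q) $$ (i, j) = 1\<^sub>m n $$ (i, j)" using ij by simp
  qed (auto simp: Q_def)
  moreover have "Q *\<^sub>v u = unit_vec n 0"
  proof (rule eq_vecI)
    fix i assume "i < dim_vec (unit_vec n 0)"
    then have i: "i < n" by simp
    have "(Q *\<^sub>v u) $ i = (\<Sum>k = 0..<n. (if i = k then u $ k else 0) - c * w $ i * (w $ k * u $ k))"
      using i u by (auto simp: Q_def scalar_prod_def algebra_simps intro!: sum.cong)
    also have "\<dots> = u $ i - c * w $ i * (w \<bullet> u)"
      using i u by (simp add: sum_subtractf sum_distrib_left[symmetric] scalar_prod_def)
    also have "\<dots> = u $ i - w $ i"
      using ww ww2 by (simp add: c_def field_simps)
    finally show "(Q *\<^sub>v u) $ i = unit_vec n 0 $ i"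
      using i u by (simp add: w_def)
  qed (use Q u in auto)
  moreover have "transpose_mat Q = Q"
    by (rule eq_matI) (auto simp: Q_def)
  ultimately show ?thesis using Q that by blast
qed

lemma orthogonal_transpose_right:
  fixes U :: rmat
  assumes "U \<in> carrier_mat n n" "transpose_mat U * U = 1\<^sub>m n"
  shows "U * transpose_mat U = 1\<^sub>m n"
  using assms by (intro mat_mult_left_right_inverse[of "transpose_mat U"]) auto

text \<open>
  Conjugation with a reflection that takes a unit eigenvector to \<open>e\<^sub>0\<close> leaves the eigenvalue in the
  corner and, by symmetry, zeros beside and below it. The remaining block is diagonalised by induction.
\<close>

lemma spectral_theorem:
  fixes A :: rmat
  assumes "A \<in> carrier_mat n n" "transpose_mat A = A"
  shows "\<exists>U D. U \<in> carrier_mat n n \<and> D \<in> carrier_mat n n \<and> diagonal_mat D \<and>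
           transpose_mat U * U = 1\<^sub>m n \<and> A = U * D * transpose_mat U"
  using assms
proof (induction n arbitrary: A)
  case 0
  then show ?case
    by (intro exI[of _ "0\<^sub>m 0 0"]) (auto simp: diagonal_mat_def intro!: eq_matI)
next
  case (Suc n A)
  note A = Suc.prems(1) and sym = Suc.prems(2)
  obtain u e where u: "u \<in> carrier_vec (Suc n)" "u \<bullet> u = 1" and eig: "A *\<^sub>v u = e \<cdot>\<^sub>v u"
    by (rule real_symmetric_eigenvector[OF A sym]) auto
  obtain Q where Q: "Q \<in> carrier_mat (Suc n) (Suc n)" and Qt: "transpose_mat Q = Q"
    and QQ: "Q * Q = 1\<^sub>m (Suc n)" and Qu: "Q *\<^sub>v u = unit_vec (Suc n) 0"
    by (rule householder_reflection[OF u]) auto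
  define B where "B = Q * A * Q"
  have B: "B \<in> carrier_mat (Suc n) (Suc n)" using A Q by (simp add: B_def)
  have Bt: "transpose_mat B = B"
    using A Q by (simp add: B_def transpose_mult[of _ "Suc n" "Suc n" _ "Suc n"] Qt sym
        assoc_mult_mat[of _ "Suc n" "Suc n" _ "Suc n" _ "Suc n"])
  have Qe: "Q *\<^sub>v unit_vec (Suc n) 0 = u"
  proof -
    have "Q *\<^sub>v (Q *\<^sub>v u) = (Q * Q) *\<^sub>v u"
      using Q u by simp
    then show ?thesis using QQ Qu u by simp
  qed
  have "B *\<^sub>v unit_vec (Suc n) 0 = Q *\<^sub>v (A *\<^sub>v u)"
    using assoc_mult_mat_vec[of "Q * A" "Suc n" "Suc n" Q "Suc n" "unit_vec (Suc n) 0"]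
      assoc_mult_mat_vec[of Q "Suc n" "Suc n" A "Suc n" u] A Q u
    by (simp add: B_def Qe del: assoc_mult_mat_vec)
  also have "\<dots> = e \<cdot>\<^sub>v unit_vec (Suc n) 0"
    using Q u eig Qu by (simp add: mult_mat_vec)
  finally have Be: "B *\<^sub>v unit_vec (Suc n) 0 = e \<cdot>\<^sub>v unit_vec (Suc n) 0" .
  have col: "B $$ (i, 0) = (if i = 0 then e else 0)" if "i < Suc n" for i
  proof -
    have "(B *\<^sub>v unit_vec (Suc n) 0) $ i = B $$ (i, 0)"
      using that B by (simp add: scalar_prod_right_unit)
    then show ?thesis using Be that by (simp split: if_splits)
  qed
  have row: "B $$ (0, i) = (if i = 0 then e else 0)" if "i < Suc n" for i
  proof -
    have "B $$ (0, i) = transpose_mat B $$ (i, 0)" using that B by simp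
    then show ?thesis using col[OF that] Bt by simp
  qed
  define B' where "B' = Matrix.mat n n (\<lambda>(i, j). B $$ (Suc i, Suc j))"
  have B': "B' \<in> carrier_mat n n" by (simp add: B'_def)
  let ?e = "Matrix.mat 1 1 (\<lambda>_. e)"
  have Bblock: "B = four_block_mat ?e (0\<^sub>m 1 n) (0\<^sub>m n 1) B'"
    by (rule eq_matI) (use B row col in \<open>auto simp: B'_def\<close>)
  have B't: "transpose_mat B' = B'"
  proof (rule eq_matI)
    fix i j assume "i < dim_row B'" "j < dim_col B'"
    then have ij: "i < n" "j < n" by (auto simp: B'_def)
    have "B $$ (Suc j, Suc i) = transpose_mat B $$ (Suc i, Suc j)" using ij B by simp
    then show "transpose_mat B' $$ (i, j) = B' $$ (i, j)" using ij Bt by (simp add: B'_def)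
  qed (auto simp: B'_def)
  obtain U' D' where U': "U' \<in> carrier_mat n n" and D': "D' \<in> carrier_mat n n" "diagonal_mat D'"
    and U'U': "transpose_mat U' * U' = 1\<^sub>m n" and B'eq: "B' = U' * D' * transpose_mat U'"
    using Suc.IH[OF B' B't] by blast
  define V where "V = four_block_mat (1\<^sub>m 1) (0\<^sub>m 1 n) (0\<^sub>m n 1) U'"
  define D where "D = four_block_mat ?e (0\<^sub>m 1 n) (0\<^sub>m n 1) D'"
  have V: "V \<in> carrier_mat (Suc n) (Suc n)" and D: "D \<in> carrier_mat (Suc n) (Suc n)"
    using U' D' by (auto simp: V_def D_def)
  have Vt: "transpose_mat V = four_block_mat (1\<^sub>m 1) (0\<^sub>m 1 n) (0\<^sub>m n 1) (transpose_mat U')"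
    unfolding V_def using U' by (subst transpose_four_block_mat) auto
  have VV: "transpose_mat V * V = 1\<^sub>m (Suc n)"
    unfolding Vt unfolding V_def using U' U'U'
    by (subst mult_four_block_mat[of _ 1 1 _ n _ n]) auto
  have "V * D = four_block_mat ?e (0\<^sub>m 1 n) (0\<^sub>m n 1) (U' * D')"
    unfolding V_def D_def using U' D'
    by (subst mult_four_block_mat[of _ 1 1 _ n _ n]) auto
  then have VDV: "V * D * transpose_mat V = B"
    unfolding Vt Bblock B'eq using U' D'
    by (simp, subst mult_four_block_mat[of _ 1 1 _ n _ n]) auto
  have diag: "diagonal_mat D"
    using D' by (auto simp: diagonal_mat_def D_def)
  define U where "U = Q * V"
  have U: "U \<in> carrier_mat (Suc n) (Suc n)" using Q V by (simp add: U_def)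
  have Ut: "transpose_mat U = transpose_mat V * Q"
    using Q V by (simp add: U_def transpose_mult[of _ "Suc n" "Suc n" _ "Suc n"] Qt)
  note assoc = assoc_mult_mat[of _ "Suc n" "Suc n" _ "Suc n" _ "Suc n"]
  have "transpose_mat U * U = transpose_mat V * ((Q * Q) * V)"
    unfolding Ut using Q V by (simp add: U_def assoc)
  then have UU: "transpose_mat U * U = 1\<^sub>m (Suc n)"
    using QQ V VV by simp
  have "U * D * transpose_mat U = Q * (V * D * transpose_mat V) * Q"
    unfolding Ut using Q V D by (simp add: U_def assoc)
  also have "\<dots> = (Q * Q) * A * (Q * Q)"
    unfolding VDV B_def using Q A by (simp add: assoc)
  also have "\<dots> = A"
    using A by (simp add: QQ)
  finally show ?case
    using U D diag UU by metis
qed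

lemma spectral_decomposition:
  fixes A :: rmat
  assumes A: "A \<in> carrier_mat n n" "transpose_mat A = A"
  obtains U d where "U \<in> carrier_mat n n" "transpose_mat U * U = 1\<^sub>m n" "U * transpose_mat U = 1\<^sub>m n"
    "A = U * mat_diag n d * transpose_mat U" "\<And>i. i < n \<Longrightarrow> d i \<in> spectrum A"
proof -
  obtain U D where U: "U \<in> carrier_mat n n" and D: "D \<in> carrier_mat n n" "diagonal_mat D"
    and UU: "transpose_mat U * U = 1\<^sub>m n" and eq: "A = U * D * transpose_mat U"
    using spectral_theorem[OF A] by blast
  have Deq: "D = mat_diag n (\<lambda>i. D $$ (i, i))"
    using D by (intro eq_matI) (auto simp: diagonal_mat_def mat_diag_def)
  show ?thesis
  proof (rule that)
    show "U * transpose_mat U = 1\<^sub>m n"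
      by (rule orthogonal_transpose_right[OF U UU])
    show "A = U * mat_diag n (\<lambda>i. D $$ (i, i)) * transpose_mat U"
      using eq Deq by simp
    fix i assume i: "i < n"
    let ?c = "Matrix.col U i"
    have AU: "A * U = U * D"
      unfolding eq using U D UU by (simp add: assoc_mult_mat[of _ n n _ n _ n])
    have c: "?c \<in> carrier_vec n" using U by auto
    have "A *\<^sub>v ?c = Matrix.col (U * D) i"
      unfolding AU[symmetric] by (rule col_mult2[OF A(1) U i, symmetric])
    also have "\<dots> = U *\<^sub>v Matrix.col D i"
      by (rule col_mult2[OF U D(1) i])
    also have "Matrix.col D i = D $$ (i, i) \<cdot>\<^sub>v unit_vec n i"
      using D i by (intro eq_vecI) (auto simp: diagonal_mat_def)
    also have "U *\<^sub>v \<dots> = D $$ (i, i) \<cdot>\<^sub>v ?c"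
      using U i by (intro eq_vecI) (auto simp: mult_mat_vec[of U n n])
    finally have ev: "A *\<^sub>v ?c = D $$ (i, i) \<cdot>\<^sub>v ?c" .
    have "?c \<bullet> ?c = (transpose_mat U * U) $$ (i, i)"
      using U i by simp
    then have "?c \<bullet> ?c = 1" using UU i by simp
    then have "?c \<noteq> 0\<^sub>v n" by auto
    with ev c A show "D $$ (i, i) \<in> spectrum A"
      unfolding spectrum_def eigenvalue_def eigenvector_def by auto
  qed (use U UU in auto)
qed

lemma orthogonal_preserves_scalar_prod:
  fixes U :: rmat
  assumes U: "U \<in> carrier_mat n n" "U * transpose_mat U = 1\<^sub>m n" and v: "v \<in> carrier_vec n"
  shows "(transpose_mat U *\<^sub>v v) \<bullet> (transpose_mat U *\<^sub>v v) = v \<bullet> v"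
proof -
  have "(transpose_mat U *\<^sub>v v) \<bullet> (transpose_mat U *\<^sub>v v) = v \<bullet> (U *\<^sub>v (transpose_mat U *\<^sub>v v))"
    using U v by (intro transpose_vec_mult_scalar) auto
  also have "U *\<^sub>v (transpose_mat U *\<^sub>v v) = (U * transpose_mat U) *\<^sub>v v"
    using U v by (intro assoc_mult_mat_vec[symmetric, of _ n n _ n]) auto
  finally show ?thesis using U v by simp
qed

lemma mat_diag_mult_vec:
  fixes v :: rvec
  assumes "v \<in> carrier_vec n"
  shows "mat_diag n d *\<^sub>v v = Matrix.vec n (\<lambda>i. d i * v $ i)"
proof (rule eq_vecI)
  fix i assume "i < dim_vec (Matrix.vec n (\<lambda>i. d i * v $ i))"
  then have i: "i < n" by simp
  have "(mat_diag n d *\<^sub>v v) $ i = (\<Sum>j = 0..<n. if i = j then d j * v $ j else 0)"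
    using i assms
    by (auto simp: mat_diag_def scalar_prod_def if_distribR if_distrib cong: if_cong intro!: sum.cong)
  then show "(mat_diag n d *\<^sub>v v) $ i = Matrix.vec n (\<lambda>i. d i * v $ i) $ i"
    using i by simp
qed (simp add: mat_diag_def)

lemma quadratic_form_diagonalised:
  fixes U :: rmat
  assumes U: "U \<in> carrier_mat n n" and v: "v \<in> carrier_vec n"
  shows "v \<bullet> ((U * mat_diag n d * transpose_mat U) *\<^sub>v v)
    = (\<Sum>i<n. d i * ((transpose_mat U *\<^sub>v v) $ i)\<^sup>2)"
proof -
  let ?w = "transpose_mat U *\<^sub>v v"
  have w: "?w \<in> carrier_vec n" using U v by auto
  have D: "mat_diag n d \<in> carrier_mat n n" by simp
  have "v \<bullet> ((U * mat_diag n d * transpose_mat U) *\<^sub>v v) = v \<bullet> (U *\<^sub>v (mat_diag n d *\<^sub>v ?w))"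
    using U v D w by (simp add: assoc_mult_mat_vec[of _ n n _ n])
  also have "\<dots> = ?w \<bullet> (mat_diag n d *\<^sub>v ?w)"
    using U v mult_mat_vec_carrier[OF D w] by (intro transpose_vec_mult_scalar[symmetric]) auto
  also have "\<dots> = (\<Sum>i<n. d i * (?w $ i)\<^sup>2)"
    using w by (simp add: mat_diag_mult_vec scalar_prod_def lessThan_atLeast0 power2_eq_square mult_ac)
  finally show ?thesis .
qed

lemma rayleigh_bounds:
  fixes A :: rmat
  assumes A: "A \<in> carrier_mat n n" "transpose_mat A = A" and v: "v \<in> carrier_vec n"
  shows "lambda_min A * (v \<bullet> v) \<le> v \<bullet> (A *\<^sub>v v)" "v \<bullet> (A *\<^sub>v v) \<le> lambda_max A * (v \<bullet> v)"
proof -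
  obtain U d where U: "U \<in> carrier_mat n n" "U * transpose_mat U = 1\<^sub>m n"
    and eq: "A = U * mat_diag n d * transpose_mat U" and d: "\<And>i. i < n \<Longrightarrow> d i \<in> spectrum A"
    using spectral_decomposition[OF A] by metis
  let ?w = "transpose_mat U *\<^sub>v v"
  have fin: "finite (spectrum A)"
    using card_finite_spectrum[OF A(1)] by simp
  have q: "v \<bullet> (A *\<^sub>v v) = (\<Sum>i<n. d i * (?w $ i)\<^sup>2)"
    unfolding eq by (rule quadratic_form_diagonalised[OF U(1) v])
  have vv: "v \<bullet> v = (\<Sum>i<n. (?w $ i)\<^sup>2)"
    using orthogonal_preserves_scalar_prod[OF U v] U
    by (simp add: scalar_prod_def lessThan_atLeast0 power2_eq_square)
  show "lambda_min A * (v \<bullet> v) \<le> v \<bullet> (A *\<^sub>v v)"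
    unfolding q vv sum_distrib_left
    by (intro sum_mono mult_right_mono) (auto simp: lambda_min_def fin d)
  show "v \<bullet> (A *\<^sub>v v) \<le> lambda_max A * (v \<bullet> v)"
    unfolding q vv sum_distrib_left
    by (intro sum_mono mult_right_mono) (auto simp: lambda_max_def fin d)
qed

lemma psd_sqrt_exists:
  fixes A :: rmat
  assumes A: "psd A"
  shows "\<exists>B. psd B \<and> B * B = A"
proof -
  define n where "n = dim_row A"
  have A': "A \<in> carrier_mat n n" "transpose_mat A = A"
    and nonneg: "\<And>v. v \<in> carrier_vec n \<Longrightarrow> 0 \<le> v \<bullet> (A *\<^sub>v v)"
    using A by (auto simp: psd_def n_def)
  obtain U d where U: "U \<in> carrier_mat n n" and UtU: "transpose_mat U * U = 1\<^sub>m n"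
    and eq: "A = U * mat_diag n d * transpose_mat U" and d: "\<And>i. i < n \<Longrightarrow> d i \<in> spectrum A"
    using spectral_decomposition[OF A'] by metis
  have d0: "0 \<le> d i" if i: "i < n" for i
  proof -
    obtain v where v: "v \<in> carrier_vec n" "v \<noteq> 0\<^sub>v n" "A *\<^sub>v v = d i \<cdot>\<^sub>v v"
      using d[OF i] A' by (auto simp: spectrum_def eigenvalue_def eigenvector_def)
    have "0 \<le> d i * (v \<bullet> v)" using nonneg[OF v(1)] v by simp
    moreover have "0 < v \<bullet> v" using vnorm_pos[OF v(1,2)] by (simp flip: vnorm_sq)
    ultimately show ?thesis by (simp add: zero_le_mult_iff)
  qed
  define B where "B = U * mat_diag n (\<lambda>i. sqrt (d i)) * transpose_mat U"
  have B: "B \<in> carrier_mat n n" using U by (auto simp: B_def intro!: mult_carrier_mat[of _ n n])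
  have Dt: "transpose_mat (mat_diag n f) = mat_diag n f" for f :: "nat \<Rightarrow> real"
    by (rule eq_matI) (auto simp: mat_diag_def)
  note assoc = assoc_mult_mat[of _ n n _ n _ n]
  have D: "mat_diag n f \<in> carrier_mat n n" for f :: "nat \<Rightarrow> real" by simp
  have "transpose_mat B = B"
    unfolding B_def
    using transpose_mult[of "U * mat_diag n (\<lambda>i. sqrt (d i))" n n "transpose_mat U" n]
      transpose_mult[OF U D, of "\<lambda>i. sqrt (d i)"] U
      assoc[OF U D, of "transpose_mat U" "\<lambda>i. sqrt (d i)"] by (simp add: Dt)
  moreover have "0 \<le> v \<bullet> (B *\<^sub>v v)" if v: "v \<in> carrier_vec n" for v
    unfolding B_def quadratic_form_diagonalised[OF U v]
    by (intro sum_nonneg) (auto simp: d0)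
  ultimately have "psd B"
    using B by (auto simp: psd_def)
  moreover have "B * B = A"
  proof -
    let ?S = "mat_diag n (\<lambda>i. sqrt (d i))" and ?V = "transpose_mat U"
    have car: "U * ?S \<in> carrier_mat n n" "?S * ?V \<in> carrier_mat n n" "?V \<in> carrier_mat n n"
      using U by (auto intro: mult_carrier_mat[of _ n n])
    have SS: "?S * ?S = mat_diag n d"
      using d0 unfolding mat_diag_diag by (intro eq_matI) (auto simp: mat_diag_def)
    have "B * B = (U * ?S) * (?V * (U * ?S * ?V))"
      unfolding B_def by (rule assoc[OF car(1,3)]) (use car in auto)
    also have "U * ?S * ?V = U * (?S * ?V)"
      by (rule assoc[OF U D car(3)])
    also have "?V * (U * (?S * ?V)) = (?V * U) * (?S * ?V)"
      by (rule assoc[OF car(3) U car(2), symmetric])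
    also have "\<dots> = ?S * ?V"
      unfolding UtU by (rule left_mult_one_mat[OF car(2)])
    also have "(U * ?S) * (?S * ?V) = ((U * ?S) * ?S) * ?V"
      by (rule assoc[OF car(1) D car(3), symmetric])
    also have "(U * ?S) * ?S = U * (?S * ?S)"
      by (rule assoc[OF U D D])
    finally show ?thesis unfolding SS eq .
  qed
  ultimately show ?thesis by blast
qed

text \<open>The prior penalty and the warm start condition are converted into quadratic forms by this identity.\<close>

lemma vnorm_mat_sqrt_sq:
  assumes A: "psd A" "A \<in> carrier_mat n n" and v: "v \<in> carrier_vec n"
  shows "(vnorm (mat_sqrt A *\<^sub>v v))\<^sup>2 = v \<bullet> (A *\<^sub>v v)"
proof -
  have B: "psd (mat_sqrt A)" "mat_sqrt A * mat_sqrt A = A"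
    using someI_ex[OF psd_sqrt_exists[OF A(1)]] unfolding mat_sqrt_def by auto
  let ?B = "mat_sqrt A"
  have car: "?B \<in> carrier_mat n n"
    using B A unfolding psd_def by (metis carrier_matD(1) index_mult_mat(2))
  have "(vnorm (?B *\<^sub>v v))\<^sup>2 = (transpose_mat ?B *\<^sub>v v) \<bullet> (?B *\<^sub>v v)"
    using B by (simp add: vnorm_sq psd_def)
  also have "\<dots> = v \<bullet> (?B *\<^sub>v (?B *\<^sub>v v))"
    using car v by (intro transpose_vec_mult_scalar) auto
  also have "?B *\<^sub>v (?B *\<^sub>v v) = A *\<^sub>v v"
    using car v B by (metis assoc_mult_mat_vec)
  finally show ?thesis .
qed

lemma minv_inverts:
  assumes A: "A \<in> carrier_mat n n" and det: "Determinant.det A \<noteq> 0"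
  shows "minv A \<in> carrier_mat n n" "A * minv A = 1\<^sub>m n" "minv A * A = 1\<^sub>m n"
proof -
  have "mat_inverse A \<noteq> None"
    using mat_inverse(1)[OF A, of n] det_non_zero_imp_unit[OF A det, of n] by blast
  then obtain B where "mat_inverse A = Some B" by blast
  from mat_inverse(2)[OF A this] this show "minv A \<in> carrier_mat n n" "A * minv A = 1\<^sub>m n" "minv A * A = 1\<^sub>m n"
    by (auto simp: minv_def)
qed

lemma det_nonzero_if_coercive:
  fixes A :: rmat
  assumes A: "A \<in> carrier_mat n n"
    and coercive: "\<And>v. v \<in> carrier_vec n \<Longrightarrow> c * (v \<bullet> v) \<le> v \<bullet> (A *\<^sub>v v)" and c: "0 < c"
  shows "Determinant.det A \<noteq> 0"
proof
  assume "Determinant.det A = 0"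
  then obtain v where v: "v \<in> carrier_vec n" "v \<noteq> 0\<^sub>v n" "A *\<^sub>v v = 0\<^sub>v n"
    using det_0_iff_vec_prod_zero[OF A] by blast
  have "0 < v \<bullet> v" using vnorm_pos[OF v(1,2)] by (simp flip: vnorm_sq)
  with coercive[OF v(1)] v c show False
    by (simp add: mult_le_0_iff)
qed

lemma minv_minv:
  assumes A: "A \<in> carrier_mat n n" and det: "Determinant.det A \<noteq> 0"
  shows "minv (minv A) = A" "Determinant.det (minv A) = 1 / Determinant.det A"
proof -
  note B = minv_inverts[OF A det]
  have "Determinant.det A * Determinant.det (minv A) = 1"
    using det_mult[OF A B(1)] B(2) by simp
  then show d: "Determinant.det (minv A) = 1 / Determinant.det A"
    using det by (simp add: field_simps)
  then have "Determinant.det (minv A) \<noteq> 0" using det by simp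
  note C = minv_inverts[OF B(1) this]
  have "minv (minv A) = (A * minv A) * minv (minv A)"
    using left_mult_one_mat[OF C(1)] B(2) by simp
  also have "\<dots> = A * (minv A * minv (minv A))"
    by (rule assoc_mult_mat[OF A B(1) C(1)])
  also have "\<dots> = A" using A C by simp
  finally show "minv (minv A) = A" .
qed

lemma transpose_minv:
  assumes A: "A \<in> carrier_mat n n" "transpose_mat A = A" and det: "Determinant.det A \<noteq> 0"
  shows "transpose_mat (minv A) = minv A"
proof -
  note B = minv_inverts[OF A(1) det]
  have t: "transpose_mat (minv A) * A = 1\<^sub>m n"
    using transpose_mult[OF A(1) B(1)] B A by simp
  have "transpose_mat (minv A) = transpose_mat (minv A) * (A * minv A)"
    using B by simp
  also have "\<dots> = (transpose_mat (minv A) * A) * minv A"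
    using A B by (simp add: assoc_mult_mat[of _ n n _ n _ n])
  finally show ?thesis using t B by simp
qed

lemma coercive_minv_bound:
  fixes A :: rmat
  assumes A: "A \<in> carrier_mat n n"
    and coercive: "\<And>v. v \<in> carrier_vec n \<Longrightarrow> c * (v \<bullet> v) \<le> v \<bullet> (A *\<^sub>v v)" and c: "0 < c"
    and w: "w \<in> carrier_vec n"
  shows "w \<bullet> (minv A *\<^sub>v w) \<le> w \<bullet> w / c"
proof -
  have det: "Determinant.det A \<noteq> 0" by (rule det_nonzero_if_coercive[OF A coercive c])
  note B = minv_inverts[OF A det]
  let ?v = "minv A *\<^sub>v w"
  have v: "?v \<in> carrier_vec n" using B w by auto
  have Av: "A *\<^sub>v ?v = w"
  proof -
    have "A *\<^sub>v ?v = (A * minv A) *\<^sub>v w"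
      by (rule assoc_mult_mat_vec[symmetric, OF A B(1) w])
    then show ?thesis using B w by simp
  qed
  have "c * (vnorm ?v * vnorm ?v) \<le> ?v \<bullet> w"
    using coercive[OF v] Av by (simp add: vnorm_sq[symmetric] power2_eq_square)
  moreover have "?v \<bullet> w \<le> vnorm ?v * vnorm w"
    using scalar_prod_le_vnorm[OF v w] by simp
  ultimately have le: "vnorm ?v * (c * vnorm ?v) \<le> vnorm ?v * vnorm w" by (simp add: mult_ac)
  have "c * vnorm ?v \<le> vnorm w"
  proof (cases "vnorm ?v = 0")
    case False
    then show ?thesis using le vnorm_nonneg[of ?v] by (simp add: mult_le_cancel_left)
  qed simp
  then have "vnorm ?v \<le> vnorm w / c" using c by (simp add: field_simps)
  then have "vnorm w * vnorm ?v \<le> vnorm w * (vnorm w / c)"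
    by (intro mult_left_mono) auto
  moreover have "w \<bullet> ?v \<le> vnorm w * vnorm ?v"
    using scalar_prod_le_vnorm[OF w v] by simp
  ultimately show ?thesis by (simp add: vnorm_sq[symmetric] power2_eq_square)
qed

section \<open>The Gaussian integral\<close>

text \<open>
  Coefficients and arguments are functions on all indices, so that dropping the last coordinate only
  lowers \<open>n\<close>.
\<close>

definition quad_form :: "nat \<Rightarrow> (nat \<Rightarrow> nat \<Rightarrow> real) \<Rightarrow> (nat \<Rightarrow> real) \<Rightarrow> real" where
  "quad_form n a z = (\<Sum>i<n. \<Sum>j<n. z i * a i j * z j)"

definition schur_complement :: "nat \<Rightarrow> (nat \<Rightarrow> nat \<Rightarrow> real) \<Rightarrow> nat \<Rightarrow> nat \<Rightarrow> real" where
  "schur_complement n a i j = a i j - a i n * a n j / a n n"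

text \<open>Completing the square in the last coordinate.\<close>

lemma quad_form_Suc:
  assumes sym: "\<And>i. i < n \<Longrightarrow> a n i = a i n" and nz: "a n n \<noteq> 0"
  shows "quad_form (Suc n) a z = a n n * (z n + (\<Sum>i<n. a i n * z i) / a n n)\<^sup>2 + quad_form n (schur_complement n a) z"
proof -
  define b where "b = (\<Sum>i<n. a i n * z i)"
  have 1: "(\<Sum>i<n. z i * a i n * z n) = b * z n"
    unfolding b_def sum_distrib_right by (intro sum.cong) (auto simp: mult_ac)
  have 2: "(\<Sum>j<n. z n * a n j * z j) = b * z n"
    unfolding b_def sum_distrib_right using sym by (intro sum.cong) (auto simp: mult_ac)
  have 3: "(\<Sum>i<n. \<Sum>j<n. z i * (a i n * a n j / a n n) * z j) = b * b / a n n"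
    unfolding b_def sum_product sum_divide_distrib
    using sym by (auto intro!: sum.cong)
  have "quad_form (Suc n) a z = quad_form n a z + 2 * b * z n + a n n * (z n)\<^sup>2"
    by (simp add: quad_form_def sum.distrib 1 2 power2_eq_square)
  moreover have "quad_form n (schur_complement n a) z = quad_form n a z - b * b / a n n"
    unfolding quad_form_def schur_complement_def 3[symmetric]
    by (simp add: algebra_simps sum_subtractf)
  moreover have "a n n * (z n + b / a n n)\<^sup>2 = a n n * (z n)\<^sup>2 + 2 * b * z n + b * b / a n n"
    using nz by (simp add: power2_eq_square field_simps)
  ultimately show ?thesis
    unfolding b_def[symmetric] by simp
qed

lemma quad_form_cong: "(\<And>i. i < n \<Longrightarrow> z i = z' i) \<Longrightarrow> quad_form n a z = quad_form n a z'"
  by (simp add: quad_form_def)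

lemma nn_integral_gaussian_line:
  assumes c: "0 < c"
  shows "(\<integral>\<^sup>+y. ennreal (exp (- (c * (y - m)\<^sup>2) / 2)) \<partial>lborel) = ennreal (sqrt (2 * pi / c))"
proof -
  define s where "s = 1 / sqrt c"
  have s: "s\<^sup>2 = 1 / c" "0 < s" using c by (auto simp: s_def power_divide)
  have eq: "exp (- (c * (y - m)\<^sup>2) / 2) = sqrt (2 * pi / c) * normal_density m s y" for y
    using c by (simp add: normal_density_def s)
  have "(\<integral>\<^sup>+y. ennreal (normal_density m s y) \<partial>lborel) = 1"
    by (subst nn_integral_eq_integral) (auto simp: s(2))
  then show ?thesis
    unfolding eq using c
    by (simp add: ennreal_mult' nn_integral_cmult)
qed

abbreviation lborel_Pi :: "nat \<Rightarrow> (nat \<Rightarrow> real) measure" where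
  "lborel_Pi n \<equiv> \<Pi>\<^sub>M i\<in>{..<n}. lborel"

lemma quad_form_measurable [measurable]:
  "(\<lambda>x. quad_form n a (\<lambda>i. x i - m i)) \<in> borel_measurable (lborel_Pi n)"
  unfolding quad_form_def by measurable

text \<open>
  Block elimination of the last column: the matrix is a unit upper triangular block matrix times a
  lower triangular one with diagonal blocks the Schur complement and \<open>a n n\<close>.
\<close>

lemma det_schur:
  fixes a :: "nat \<Rightarrow> nat \<Rightarrow> real"
  assumes nz: "a n n \<noteq> 0"
  shows "Determinant.det (Matrix.mat (Suc n) (Suc n) (\<lambda>(i, j). a i j)) =
    a n n * Determinant.det (Matrix.mat n n (\<lambda>(i, j). schur_complement n a i j))"
proof -
  let ?A = "Matrix.mat (Suc n) (Suc n) (\<lambda>(i, j). a i j)"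
  let ?S = "Matrix.mat n n (\<lambda>(i, j). schur_complement n a i j)"
  let ?b = "Matrix.mat n 1 (\<lambda>(i, j). a i n / a n n)"
  let ?r = "Matrix.mat 1 n (\<lambda>(i, j). a n j)"
  let ?c = "Matrix.mat 1 1 (\<lambda>_. a n n)"
  let ?L = "four_block_mat (1\<^sub>m n) ?b (0\<^sub>m 1 n) (1\<^sub>m 1)"
  let ?R = "four_block_mat ?S (0\<^sub>m n 1) ?r ?c"
  have "?L * ?R = four_block_mat (1\<^sub>m n * ?S + ?b * ?r) (1\<^sub>m n * 0\<^sub>m n 1 + ?b * ?c)
      (0\<^sub>m 1 n * ?S + 1\<^sub>m 1 * ?r) (0\<^sub>m 1 n * 0\<^sub>m n 1 + 1\<^sub>m 1 * ?c)"
    by (rule mult_four_block_mat[of _ n n _ 1 _ 1 _ _ n _ 1]) auto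
  also have "\<dots> = ?A"
    by (rule eq_matI) (use nz in \<open>auto simp: schur_complement_def scalar_prod_def less_Suc_eq\<close>)
  finally have "?A = ?L * ?R" ..
  moreover have "Determinant.det (?L * ?R) = Determinant.det ?L * Determinant.det ?R"
    by (rule det_mult[of _ "Suc n"]) auto
  moreover have "Determinant.det ?L = 1"
    by (subst det_four_block_mat_lower_left_zero[of _ n _ 1]) auto
  moreover have "Determinant.det ?R = Determinant.det ?S * Determinant.det ?c"
    by (rule det_four_block_mat_upper_right_zero[of _ n _ 1]) auto
  moreover have "Determinant.det ?c = a n n"
    by (subst det_single) auto
  ultimately show ?thesis by simp
qed

text \<open>
  Integrating out the last coordinate leaves the form of the Schur complement. Induction on the
  dimension thus gives the classical formula, and the positivity of the determinant, without a linear
  change of variables.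
\<close>

lemma gaussian_integral_coordinates:
  assumes "\<And>i j. i < n \<Longrightarrow> j < n \<Longrightarrow> a i j = a j i"
    and "\<And>z. \<exists>i<n. z i \<noteq> 0 \<Longrightarrow> 0 < quad_form n a z"
  shows "0 < Determinant.det (Matrix.mat n n (\<lambda>(i, j). a i j)) \<and>
    (\<integral>\<^sup>+x. ennreal (exp (- quad_form n a (\<lambda>i. x i - m i) / 2)) \<partial>lborel_Pi n)
      = ennreal (sqrt ((2 * pi) ^ n / Determinant.det (Matrix.mat n n (\<lambda>(i, j). a i j))))"
  using assms
proof (induction n arbitrary: a)
  case 0
  interpret product_sigma_finite "\<lambda>_. lborel :: real measure"
    by unfold_locales
  show ?case
    using nn_integral_empty[of "\<lambda>_. 1"] by (simp add: quad_form_def)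
next
  case (Suc n a)
  interpret product_sigma_finite "\<lambda>_. lborel :: real measure"
    by unfold_locales
  note sym = Suc.prems(1) and pd = Suc.prems(2)
  define c where "c = a n n"
  define S where "S = schur_complement n a"
  have c: "0 < c"
  proof -
    define z :: "nat \<Rightarrow> real" where "z i = (if i < n then 0 else 1)" for i
    have "z n = 1" "\<And>i. i < n \<Longrightarrow> z i = 0"
      by (auto simp: z_def)
    then have "quad_form (Suc n) a z = c"
      by (simp add: quad_form_def c_def cong: sum.cong_simp)
    moreover have "\<exists>i<Suc n. z i \<noteq> 0"
      by (intro exI[of _ n]) (simp add: z_def)
    ultimately show ?thesis
      using pd by metis
  qed
  have expand: "quad_form (Suc n) a z = c * (z n + (\<Sum>i<n. a i n * z i) / c)\<^sup>2 + quad_form n S z" for z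
    using c sym unfolding c_def S_def by (intro quad_form_Suc) auto
  have Ssym: "S i j = S j i" if "i < n" "j < n" for i j
    using sym[of i j] sym[of i n] sym[of j n] that by (simp add: S_def schur_complement_def)
  have Spd: "0 < quad_form n S z" if "\<exists>i<n. z i \<noteq> 0" for z
  proof -
    define z' where "z' = z(n := - (\<Sum>i<n. a i n * z i) / c)"
    have "\<exists>i<Suc n. z' i \<noteq> 0"
      using that by (auto simp: z'_def intro: less_SucI)
    moreover have "quad_form (Suc n) a z' = quad_form n S z"
      unfolding expand by (simp add: z'_def quad_form_def)
    ultimately show ?thesis using pd by metis
  qed
  let ?detS = "Determinant.det (Matrix.mat n n (\<lambda>(i, j). S i j))"
  note IH = Suc.IH[OF Ssym Spd]
  have det: "Determinant.det (Matrix.mat (Suc n) (Suc n) (\<lambda>(i, j). a i j)) = c * ?detS"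
    using det_schur[of a n] c by (simp add: c_def S_def)
  have meas: "(\<lambda>x. ennreal (exp (- quad_form (Suc n) a (\<lambda>i. x i - m i) / 2)))
      \<in> borel_measurable (\<Pi>\<^sub>M i\<in>insert n {..<n}. lborel)"
    using quad_form_measurable[of "Suc n" a m] unfolding lessThan_Suc by measurable
  have line: "(\<integral>\<^sup>+y. ennreal (exp (- quad_form (Suc n) a (\<lambda>i. (x(n := y)) i - m i) / 2)) \<partial>lborel)
      = ennreal (sqrt (2 * pi / c)) * ennreal (exp (- quad_form n S (\<lambda>i. x i - m i) / 2))" for x
  proof -
    let ?m = "m n - (\<Sum>i<n. a i n * (x i - m i)) / c"
    have "quad_form (Suc n) a (\<lambda>i. (x(n := y)) i - m i)
        = c * (y - ?m)\<^sup>2 + quad_form n S (\<lambda>i. x i - m i)" for y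
      unfolding expand by (simp add: quad_form_def algebra_simps)
    then have "(\<integral>\<^sup>+y. ennreal (exp (- quad_form (Suc n) a (\<lambda>i. (x(n := y)) i - m i) / 2)) \<partial>lborel)
        = (\<integral>\<^sup>+y. ennreal (exp (- (c * (y - ?m)\<^sup>2) / 2)) *
            ennreal (exp (- quad_form n S (\<lambda>i. x i - m i) / 2)) \<partial>lborel)"
      by (simp add: ennreal_mult'[symmetric] exp_add[symmetric] add_divide_distrib diff_divide_distrib)
    also have "\<dots> = (\<integral>\<^sup>+y. ennreal (exp (- (c * (y - ?m)\<^sup>2) / 2)) \<partial>lborel) *
        ennreal (exp (- quad_form n S (\<lambda>i. x i - m i) / 2))"
      by (rule nn_integral_multc) measurable
    finally show ?thesis
      using nn_integral_gaussian_line[OF c, of ?m] by simp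
  qed
  have "(\<integral>\<^sup>+x. ennreal (exp (- quad_form (Suc n) a (\<lambda>i. x i - m i) / 2)) \<partial>lborel_Pi (Suc n))
      = (\<integral>\<^sup>+x. ennreal (sqrt (2 * pi / c)) * ennreal (exp (- quad_form n S (\<lambda>i. x i - m i) / 2))
          \<partial>lborel_Pi n)"
    unfolding lessThan_Suc by (subst product_nn_integral_insert[OF _ _ meas]) (simp_all only: line finite_lessThan lessThan_iff less_irrefl not_False_eq_True)
  also have "\<dots> = ennreal (sqrt (2 * pi / c)) *
      (\<integral>\<^sup>+x. ennreal (exp (- quad_form n S (\<lambda>i. x i - m i) / 2)) \<partial>lborel_Pi n)"
    by (rule nn_integral_cmult) measurable
  also have "\<dots> = ennreal (sqrt (2 * pi / c) * sqrt ((2 * pi) ^ n / ?detS))"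
    using IH c by (simp add: ennreal_mult')
  also have "sqrt (2 * pi / c) * sqrt ((2 * pi) ^ n / ?detS) = sqrt ((2 * pi) ^ Suc n / (c * ?detS))"
    by (simp add: real_sqrt_mult[symmetric] real_sqrt_divide[symmetric])
  finally show ?case
    using IH c by (simp add: det)
qed

lemma component_measurable:
  assumes i: "i < p"
  shows "(\<lambda>v. v $ i) \<in> borel_measurable (borel_vec p)"
proof -
  let ?g = "\<lambda>v :: rvec. \<lambda>i\<in>{..<p}. v $ i"
  have "?g \<in> borel_vec p \<rightarrow>\<^sub>M (\<Pi>\<^sub>M i\<in>{..<p}. borel)"
    unfolding borel_vec_def by (rule measurable_vimage_algebra1) (auto simp: space_PiM)
  then have "(\<lambda>v. ?g v i) \<in> borel_measurable (borel_vec p)"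
    by (rule measurable_compose[OF _ measurable_component_singleton]) (simp add: i)
  then show ?thesis using i by simp
qed

lemma vec_measurable: "Matrix.vec p \<in> lborel_Pi p \<rightarrow>\<^sub>M borel_vec p"
  unfolding borel_vec_def
proof (rule measurable_vimage_algebra2)
  show "(\<lambda>x. \<lambda>i\<in>{..<p}. Matrix.vec p x $ i) \<in> lborel_Pi p \<rightarrow>\<^sub>M (\<Pi>\<^sub>M i\<in>{..<p}. borel)"
  proof (rule measurable_restrict)
    fix i assume "i \<in> {..<p}"
    then show "(\<lambda>x. Matrix.vec p x $ i) \<in> borel_measurable (lborel_Pi p)"
      using measurable_component_singleton[of i "{..<p}" "\<lambda>_. lborel :: real measure"] by simp
  qed
qed auto

lemma space_borel_vec [simp]: "space (borel_vec p) = carrier_vec p"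
  by (simp add: borel_vec_def)

lemma space_lborel_vec [simp]: "space (lborel_vec p) = carrier_vec p"
  by (simp add: lborel_vec_def)

lemma sets_lborel_vec [measurable_cong, simp]: "sets (lborel_vec p) = sets (borel_vec p)"
  by (simp add: lborel_vec_def)

lemma nn_integral_lborel_vec:
  assumes "f \<in> borel_measurable (borel_vec p)"
  shows "(\<integral>\<^sup>+v. f v \<partial>lborel_vec p) = (\<integral>\<^sup>+x. f (Matrix.vec p x) \<partial>lborel_Pi p)"
  unfolding lborel_vec_def by (rule nn_integral_distr[OF vec_measurable]) (simp add: assms)

lemma quad_form_of_mat:
  assumes "A \<in> carrier_mat p p" "z \<in> carrier_vec p"
  shows "z \<bullet> (A *\<^sub>v z) = quad_form p (\<lambda>i j. A $$ (i, j)) (\<lambda>i. z $ i)"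
  using assms by (simp add: quad_form_def bilinear_expand[of _ p p])

definition posdef :: "nat \<Rightarrow> rmat \<Rightarrow> bool" where
  "posdef p A \<longleftrightarrow> A \<in> carrier_mat p p \<and> transpose_mat A = A \<and>
     (\<forall>v\<in>carrier_vec p. v \<noteq> 0\<^sub>v p \<longrightarrow> 0 < v \<bullet> (A *\<^sub>v v))"

lemma quadratic_measurable:
  assumes A: "A \<in> carrier_mat p p" and m: "m \<in> carrier_vec p"
  shows "(\<lambda>v. (v - m) \<bullet> (A *\<^sub>v (v - m))) \<in> borel_measurable (borel_vec p)"
proof -
  have "(\<lambda>v. \<Sum>i<p. \<Sum>j<p. (v $ i - m $ i) * A $$ (i, j) * (v $ j - m $ j))
      \<in> borel_measurable (borel_vec p)"
    by (intro borel_measurable_sum borel_measurable_times borel_measurable_diff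
        component_measurable borel_measurable_const) auto
  also have "?this \<longleftrightarrow> ?thesis"
    by (intro measurable_cong) (use A m in \<open>simp add: bilinear_expand[of _ p p]\<close>)
  finally show ?thesis .
qed

lemma exp_quadratic_measurable:
  assumes A: "A \<in> carrier_mat p p" and m: "m \<in> carrier_vec p"
  shows "(\<lambda>v. exp (- ((v - m) \<bullet> (A *\<^sub>v (v - m))) / 2)) \<in> borel_measurable (borel_vec p)"
  by (rule measurable_compose[OF quadratic_measurable[OF assms], where g = "\<lambda>q. exp (- q / 2)"])
     measurable

lemma gaussian_integral:
  assumes A: "posdef p A" and m: "m \<in> carrier_vec p"
  shows "0 < Determinant.det A"
    and "(\<integral>\<^sup>+v. ennreal (exp (- ((v - m) \<bullet> (A *\<^sub>v (v - m))) / 2)) \<partial>lborel_vec p)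
      = ennreal (sqrt ((2 * pi) ^ p / Determinant.det A))"
proof -
  have car: "A \<in> carrier_mat p p" and t: "transpose_mat A = A"
    using A by (auto simp: posdef_def)
  have sym: "A $$ (i, j) = A $$ (j, i)" if "i < p" "j < p" for i j
    using that car t by (metis carrier_matD index_transpose_mat(1))
  have pd: "0 < quad_form p (\<lambda>i j. A $$ (i, j)) z" if "\<exists>i<p. z i \<noteq> 0" for z
  proof -
    have "Matrix.vec p z \<noteq> 0\<^sub>v p"
      using that by (metis index_vec index_zero_vec(1))
    then have "0 < Matrix.vec p z \<bullet> (A *\<^sub>v Matrix.vec p z)"
      using A by (simp add: posdef_def)
    also have "\<dots> = quad_form p (\<lambda>i j. A $$ (i, j)) z"
      using quad_form_of_mat[OF car, of "Matrix.vec p z"] by (simp add: quad_form_def)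
    finally show ?thesis .
  qed
  have mat: "Matrix.mat p p (\<lambda>(i, j). A $$ (i, j)) = A"
    using car by (intro eq_matI) auto
  note I = gaussian_integral_coordinates[OF sym pd, where m = "\<lambda>i. m $ i", unfolded mat]
  show "0 < Determinant.det A"
    using I by blast
  have "(\<integral>\<^sup>+v. ennreal (exp (- ((v - m) \<bullet> (A *\<^sub>v (v - m))) / 2)) \<partial>lborel_vec p)
    = (\<integral>\<^sup>+x. ennreal (exp (- ((Matrix.vec p x - m) \<bullet> (A *\<^sub>v (Matrix.vec p x - m))) / 2)) \<partial>lborel_Pi p)"
    by (intro nn_integral_lborel_vec measurable_compose[OF exp_quadratic_measurable[OF car m]]) simp
  also have "\<dots> = (\<integral>\<^sup>+x. ennreal (exp (- quad_form p (\<lambda>i j. A $$ (i, j)) (\<lambda>i. x i - m $ i) / 2)) \<partial>lborel_Pi p)"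
  proof (rule nn_integral_cong)
    fix x
    have "quad_form p (\<lambda>i j. A $$ (i, j)) (\<lambda>i. (Matrix.vec p x - m) $ i)
        = quad_form p (\<lambda>i j. A $$ (i, j)) (\<lambda>i. x i - m $ i)"
      using m by (intro quad_form_cong) auto
    then show "ennreal (exp (- ((Matrix.vec p x - m) \<bullet> (A *\<^sub>v (Matrix.vec p x - m))) / 2))
      = ennreal (exp (- quad_form p (\<lambda>i j. A $$ (i, j)) (\<lambda>i. x i - m $ i) / 2))"
      using m by (subst quad_form_of_mat[OF car]) auto
  qed
  finally show "(\<integral>\<^sup>+v. ennreal (exp (- ((v - m) \<bullet> (A *\<^sub>v (v - m))) / 2)) \<partial>lborel_vec p)
      = ennreal (sqrt ((2 * pi) ^ p / Determinant.det A))"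
    using I by simp
qed

text \<open>The determinant is read off from the Gaussian integral, and a larger form has a smaller integral.\<close>

lemma det_mono:
  assumes A: "posdef p A" and B: "posdef p B"
    and le: "\<And>v. v \<in> carrier_vec p \<Longrightarrow> v \<bullet> (A *\<^sub>v v) \<le> v \<bullet> (B *\<^sub>v v)"
  shows "Determinant.det A \<le> Determinant.det B"
proof -
  note IA = gaussian_integral[OF A zero_carrier_vec] and IB = gaussian_integral[OF B zero_carrier_vec]
  have "(\<integral>\<^sup>+v. ennreal (exp (- ((v - 0\<^sub>v p) \<bullet> (B *\<^sub>v (v - 0\<^sub>v p))) / 2)) \<partial>lborel_vec p)
      \<le> (\<integral>\<^sup>+v. ennreal (exp (- ((v - 0\<^sub>v p) \<bullet> (A *\<^sub>v (v - 0\<^sub>v p))) / 2)) \<partial>lborel_vec p)"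
    using le by (intro nn_integral_mono) auto
  then have "sqrt ((2 * pi) ^ p / Determinant.det B) \<le> sqrt ((2 * pi) ^ p / Determinant.det A)"
    unfolding IA IB using IA(1) by simp
  then have "(2 * pi) ^ p / Determinant.det B \<le> (2 * pi) ^ p / Determinant.det A"
    by simp
  then show ?thesis
    using IA(1) IB(1) by (simp add: field_simps)
qed

definition gauss_density :: "nat \<Rightarrow> rvec \<Rightarrow> rmat \<Rightarrow> rvec \<Rightarrow> real" where
  "gauss_density p m A v =
     sqrt (Determinant.det A / (2 * pi) ^ p) * exp (- ((v - m) \<bullet> (A *\<^sub>v (v - m))) / 2)"

lemma gauss_density_nonneg: "posdef p A \<Longrightarrow> 0 \<le> gauss_density p m A v"
  using gaussian_integral(1)[of p A "0\<^sub>v p"] by (simp add: gauss_density_def)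

lemma gauss_density_measurable:
  assumes "posdef p A" "m \<in> carrier_vec p"
  shows "gauss_density p m A \<in> borel_measurable (borel_vec p)"
  unfolding gauss_density_def[abs_def]
  using assms by (intro borel_measurable_times exp_quadratic_measurable) (auto simp: posdef_def)

lemma gauss_density_integral:
  assumes A: "posdef p A" and m: "m \<in> carrier_vec p"
  shows "integrable (lborel_vec p) (gauss_density p m A)"
    and "(\<integral>v. gauss_density p m A v \<partial>lborel_vec p) = 1"
proof -
  note I = gaussian_integral[OF A m]
  have meas: "gauss_density p m A \<in> borel_measurable (lborel_vec p)"
    using gauss_density_measurable[OF A m] by simp
  have q: "(\<lambda>v. ennreal (exp (- ((v - m) \<bullet> (A *\<^sub>v (v - m))) / 2))) \<in> borel_measurable (lborel_vec p)"
    using measurable_compose[OF exp_quadratic_measurable[of A p m] measurable_ennreal] A m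
    by (simp add: posdef_def)
  have "(\<integral>\<^sup>+v. ennreal (gauss_density p m A v) \<partial>lborel_vec p) =
      (\<integral>\<^sup>+v. ennreal (sqrt (Determinant.det A / (2 * pi) ^ p)) *
        ennreal (exp (- ((v - m) \<bullet> (A *\<^sub>v (v - m))) / 2)) \<partial>lborel_vec p)"
    using I(1) by (simp add: gauss_density_def ennreal_mult')
  also have "\<dots> = ennreal (sqrt (Determinant.det A / (2 * pi) ^ p)) * ennreal (sqrt ((2 * pi) ^ p / Determinant.det A))"
    by (subst nn_integral_cmult[OF q]) (simp only: I(2))
  also have "\<dots> = 1"
    using I(1) by (simp add: ennreal_mult'[symmetric] real_sqrt_mult[symmetric])
  finally have one: "(\<integral>\<^sup>+v. ennreal (gauss_density p m A v) \<partial>lborel_vec p) = ennreal 1" by simp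
  have nn: "AE v in lborel_vec p. 0 \<le> gauss_density p m A v"
    using gauss_density_nonneg[OF A] by simp
  show "integrable (lborel_vec p) (gauss_density p m A)"
    using one nn meas by (intro integrableI_nonneg) auto
  show "(\<integral>v. gauss_density p m A v \<partial>lborel_vec p) = 1"
    using integral_eq_nn_integral[OF meas nn] one by simp
qed

lemma gaussian_eq_density:
  assumes A: "posdef p A"
  shows "gaussian p m (minv A) = density (lborel_vec p) (\<lambda>v. ennreal (gauss_density p m A v))"
proof -
  have det: "0 < Determinant.det A"
    by (rule gaussian_integral(1)[OF A zero_carrier_vec])
  have car: "A \<in> carrier_mat p p"
    using A by (simp add: posdef_def)
  have "exp (- ((v - m) \<bullet> (minv (minv A) *\<^sub>v (v - m))) / 2) /
        sqrt ((2 * pi) ^ p * Determinant.det (minv A)) = gauss_density p m A v" for v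
    using det minv_minv[OF car] by (simp add: gauss_density_def real_sqrt_divide real_sqrt_mult)
  then show ?thesis
    unfolding gaussian_def by simp
qed

lemma sets_gaussian [simp]: "sets (gaussian p m A) = sets (borel_vec p)"
  by (simp add: gaussian_def)

section \<open>Total variation distance of Gaussians\<close>

text \<open>
  \<open>|f - g| = |\<surd>f - \<surd>g| (\<surd>f + \<surd>g)\<close>, and the squares of the two factors integrate to \<open>2 - 2 \<integral>\<surd>(f g)\<close> and
  \<open>2 + 2 \<integral>\<surd>(f g)\<close>. A weighted arithmetic-geometric mean inequality splits the product.
\<close>

lemma tv_dist_le_hellinger:
  fixes f g :: "'a \<Rightarrow> real"
  assumes f: "integrable M f" "(\<integral>x. f x \<partial>M) = 1" "\<And>x. 0 \<le> f x"
    and g: "integrable M g" "(\<integral>x. g x \<partial>M) = 1" "\<And>x. 0 \<le> g x"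
    and h: "integrable M h" "1 - \<eta> \<le> (\<integral>x. h x \<partial>M)" "\<And>x. x \<in> space M \<Longrightarrow> h x = sqrt (f x * g x)"
    and eta: "0 < \<eta>" and A: "A \<in> sets M"
  shows "\<bar>measure (density M (\<lambda>x. ennreal (f x))) A - measure (density M (\<lambda>x. ennreal (g x))) A\<bar>
    \<le> 2 * sqrt (2 * \<eta>)"
proof -
  have meas: "measure (density M (\<lambda>x. ennreal (f x))) A = (\<integral>x. indicator A x * f x \<partial>M)"
    if f: "integrable M f" "\<And>x. 0 \<le> f x" for f :: "'a \<Rightarrow> real"
  proof -
    have "emeasure (density M (\<lambda>x. ennreal (f x))) A = (\<integral>\<^sup>+x. ennreal (f x) * indicator A x \<partial>M)"
      using f A by (intro emeasure_density) auto
    also have "\<dots> = (\<integral>\<^sup>+x. ennreal (indicator A x * f x) \<partial>M)"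
      by (intro nn_integral_cong) (auto simp: indicator_def)
    also have "\<dots> = ennreal (\<integral>x. indicator A x * f x \<partial>M)"
      using f A by (intro nn_integral_eq_integral)
        (auto intro!: integrable_real_mult_indicator simp: mult.commute)
    finally show ?thesis
      using f by (simp add: measure_def)
  qed
  have fA: "integrable M (\<lambda>x. indicator A x * f x)" and gA: "integrable M (\<lambda>x. indicator A x * g x)"
    using integrable_real_mult_indicator[OF A f(1)] integrable_real_mult_indicator[OF A g(1)]
    by (simp_all add: mult.commute)
  \<comment> \<open>the weight that balances the two integrals\<close>
  define l where "l = sqrt (2 / \<eta>)"
  have l: "0 < l" using eta by (simp add: l_def)
  have pt: "\<bar>indicator A x * f x - indicator A x * g x\<bar>
      \<le> l / 2 * (f x + g x - 2 * h x) + 1 / (2 * l) * (f x + g x + 2 * h x)"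
    if x: "x \<in> space M" for x
  proof -
    define a b where "a = sqrt (f x)" and "b = sqrt (g x)"
    have ab: "a * a = f x" "b * b = g x" "h x = a * b" "0 \<le> a" "0 \<le> b"
      using f(3) g(3) h(3)[OF x] by (auto simp: a_def b_def real_sqrt_mult)
    have "\<bar>indicator A x * f x - indicator A x * g x\<bar> \<le> \<bar>a - b\<bar> * (a + b)"
      using ab by (auto simp: indicator_def ab(1,2)[symmetric] abs_mult
          square_diff_square_factored)
    also have "\<dots> \<le> (l * \<bar>a - b\<bar>\<^sup>2 + (a + b)\<^sup>2 / l) / 2"
    proof -
      have "0 \<le> (l * \<bar>a - b\<bar> - (a + b))\<^sup>2 / (2 * l)" using l by simp
      also have "\<dots> = (l * \<bar>a - b\<bar>\<^sup>2 + (a + b)\<^sup>2 / l) / 2 - \<bar>a - b\<bar> * (a + b)"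
        using l by (simp add: field_simps power2_eq_square)
      finally show ?thesis by simp
    qed
    also have "\<dots> = l / 2 * (f x + g x - 2 * h x) + 1 / (2 * l) * (f x + g x + 2 * h x)"
      unfolding ab(3) unfolding ab(1,2)[symmetric] using l ab(4,5)
      by (simp add: field_simps power2_eq_square)
    finally show ?thesis .
  qed
  have hle: "(\<integral>x. h x \<partial>M) \<le> 1"
  proof -
    have "(\<integral>x. h x \<partial>M) \<le> (\<integral>x. (f x + g x) / 2 \<partial>M)"
      using f g h arith_geo_mean_sqrt by (intro integral_mono) auto
    then show ?thesis using f g by simp
  qed
  have "\<bar>measure (density M (\<lambda>x. ennreal (f x))) A - measure (density M (\<lambda>x. ennreal (g x))) A\<bar>
      = \<bar>\<integral>x. indicator A x * f x - indicator A x * g x \<partial>M\<bar>"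
    using meas[OF f(1,3)] meas[OF g(1,3)] fA gA by simp
  also have "\<dots> \<le> (\<integral>x. \<bar>indicator A x * f x - indicator A x * g x\<bar> \<partial>M)"
    by (rule integral_abs_bound)
  also have "\<dots> \<le> (\<integral>x. l / 2 * (f x + g x - 2 * h x) + 1 / (2 * l) * (f x + g x + 2 * h x) \<partial>M)"
    using fA gA f g h pt by (intro integral_mono) auto
  also have "\<dots> = l / 2 * (2 - 2 * (\<integral>x. h x \<partial>M)) + 1 / (2 * l) * (2 + 2 * (\<integral>x. h x \<partial>M))"
    using f g h by simp
  also have "\<dots> \<le> l / 2 * (2 * \<eta>) + 1 / (2 * l) * 4"
    using h(2) hle l by (intro add_mono mult_left_mono) auto
  also have "\<dots> = l * \<eta> + 2 / l" by simp
  also have "\<dots> = 2 * sqrt (2 * \<eta>)"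
  proof -
    define s where "s = sqrt (2 * \<eta>)"
    have s: "0 < s" "s * s = 2 * \<eta>" using eta by (auto simp: s_def)
    have l_eq: "l = 2 / s"
      using eta unfolding l_def s_def
      by (simp add: real_sqrt_divide real_sqrt_mult field_simps)
    have "2 / l = s" "l * \<eta> = s"
      using s unfolding l_eq by (simp_all add: field_simps)
    then show ?thesis
      unfolding s_def[symmetric] by simp
  qed
  finally show ?thesis .
qed

lemma tv_dist_le:
  assumes "\<And>A. A \<in> sets P \<Longrightarrow> \<bar>measure P A - measure Q A\<bar> \<le> c"
  shows "tv_dist P Q \<le> c"
  unfolding tv_dist_def by (rule cSUP_least) (use assms in auto)

lemma abs_measure_diff_le_tv_dist:
  assumes "A \<in> sets P" "\<And>A. A \<in> sets P \<Longrightarrow> measure P A \<le> 1"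
    "\<And>A. A \<in> sets P \<Longrightarrow> measure Q A \<le> 1"
  shows "\<bar>measure P A - measure Q A\<bar> \<le> tv_dist P Q"
  unfolding tv_dist_def
proof (rule cSUP_upper[OF assms(1)])
  show "bdd_above ((\<lambda>A. \<bar>measure P A - measure Q A\<bar>) ` sets P)"
  proof (rule bdd_aboveI2)
    fix A assume "A \<in> sets P"
    then show "\<bar>measure P A - measure Q A\<bar> \<le> 1"
      using assms(2,3)[of A] measure_nonneg[of P A] measure_nonneg[of Q A] by linarith
  qed
qed

text \<open>The bounds on the measures keep the suprema in \<^const>\<open>tv_dist\<close> finite.\<close>

lemma tv_dist_triangle:
  assumes sets: "sets P = sets Q" "sets Q = sets R"
    and le1: "\<And>A. A \<in> sets P \<Longrightarrow> measure P A \<le> 1" "\<And>A. A \<in> sets P \<Longrightarrow> measure Q A \<le> 1"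
      "\<And>A. A \<in> sets P \<Longrightarrow> measure R A \<le> 1"
  shows "tv_dist P R \<le> tv_dist Q P + tv_dist Q R"
proof (rule tv_dist_le)
  fix A assume A: "A \<in> sets P"
  have "\<bar>measure Q A - measure P A\<bar> \<le> tv_dist Q P" "\<bar>measure Q A - measure R A\<bar> \<le> tv_dist Q R"
    using A sets le1 by (intro abs_measure_diff_le_tv_dist; simp)+
  then show "\<bar>measure P A - measure R A\<bar> \<le> tv_dist Q P + tv_dist Q R"
    by linarith
qed

lemma prob_space_gaussian:
  assumes "posdef p A" "m \<in> carrier_vec p"
  shows "prob_space (gaussian p m (minv A))"
proof
  have meas: "gauss_density p m A \<in> borel_measurable (lborel_vec p)"
    using gauss_density_measurable[OF assms] by simp
  have "emeasure (gaussian p m (minv A)) (space (gaussian p m (minv A)))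
      = (\<integral>\<^sup>+v. ennreal (gauss_density p m A v) \<partial>lborel_vec p)"
    unfolding gaussian_eq_density[OF assms(1)] using meas
    using sets.top[of "lborel_vec p"]
    by (subst emeasure_density) (auto intro!: nn_integral_cong)
  also have "\<dots> = ennreal (\<integral>v. gauss_density p m A v \<partial>lborel_vec p)"
    using gauss_density_nonneg[OF assms(1)] gauss_density_integral(1)[OF assms]
    by (intro nn_integral_eq_integral) auto
  finally show "emeasure (gaussian p m (minv A)) (space (gaussian p m (minv A))) = 1"
    using gauss_density_integral(2)[OF assms] by simp
qed

lemma transpose_mat_smult: "transpose_mat (c \<cdot>\<^sub>m A) = c \<cdot>\<^sub>m transpose_mat A"
  by (rule eq_matI) auto

lemma smult_mat_mult_vec:
  fixes A :: rmat
  assumes "A \<in> carrier_mat p q" "v \<in> carrier_vec q"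
  shows "(c \<cdot>\<^sub>m A) *\<^sub>v v = c \<cdot>\<^sub>v (A *\<^sub>v v)"
  using assms by (intro eq_vecI) auto

lemma posdef_carrier: "posdef p A \<Longrightarrow> A \<in> carrier_mat p p"
  by (simp add: posdef_def)

lemma quadratic_diff_expand:
  fixes F :: rmat
  assumes "F \<in> carrier_mat p p" "transpose_mat F = F" "v \<in> carrier_vec p" "w \<in> carrier_vec p"
  shows "(v - w) \<bullet> (F *\<^sub>v (v - w)) = v \<bullet> (F *\<^sub>v v) - 2 * (v \<bullet> (F *\<^sub>v w)) + w \<bullet> (F *\<^sub>v w)"
proof -
  have "F *\<^sub>v (v - w) = F *\<^sub>v v - F *\<^sub>v w"
    using assms by (simp add: mult_minus_distrib_mat_vec)
  moreover have "F *\<^sub>v v \<in> carrier_vec p" "F *\<^sub>v w \<in> carrier_vec p"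
    using assms by auto
  ultimately show ?thesis
    using bilinear_symmetric[OF assms(1,2,3,4)] assms
    by (simp add: minus_scalar_prod_distrib[of _ p] scalar_prod_minus_distrib[of _ p])
qed

text \<open>
  For equal covariances the parallelogram law, centred at the midpoint, gives the affinity
  \<open>exp (- (a - b) \<bullet> F (a - b) / 8)\<close>.
\<close>

lemma tv_dist_gaussian_mean:
  assumes F: "posdef p F" and a: "a \<in> carrier_vec p" and b: "b \<in> carrier_vec p"
    and q: "(a - b) \<bullet> (F *\<^sub>v (a - b)) \<le> q" "0 < q"
    and A: "A \<in> sets (borel_vec p)"
  shows "\<bar>measure (gaussian p a (minv F)) A - measure (gaussian p b (minv F)) A\<bar> \<le> sqrt q"
proof -
  define m where "m = (1 / 2 :: real) \<cdot>\<^sub>v (a + b)"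
  have m: "m \<in> carrier_vec p" using a b by (simp add: m_def)
  have car: "F \<in> carrier_mat p p" "transpose_mat F = F" using F by (auto simp: posdef_def)
  define Q where "Q = (a - b) \<bullet> (F *\<^sub>v (a - b))"
  define h where "h v = exp (- Q / 8) * gauss_density p m F v" for v
  have parallelogram: "(v - a) \<bullet> (F *\<^sub>v (v - a)) + (v - b) \<bullet> (F *\<^sub>v (v - b))
      = 2 * ((v - m) \<bullet> (F *\<^sub>v (v - m))) + Q / 2" if v: "v \<in> carrier_vec p" for v
  proof -
    define d where "d = (1 / 2 :: real) \<cdot>\<^sub>v (a - b)"
    have d: "d \<in> carrier_vec p" using a b by (simp add: d_def)
    define w where "w = v - m"
    have w: "w \<in> carrier_vec p" using v m by (simp add: w_def)
    have 1: "v - a = w - d" and 2: "v - b = w - (- 1 :: real) \<cdot>\<^sub>v d" and 3: "a - b = (2::real) \<cdot>\<^sub>v d"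
      using v a b by (auto simp: w_def m_def d_def field_simps intro!: eq_vecI)
    have d': "(- 1 :: real) \<cdot>\<^sub>v d \<in> carrier_vec p" using d by simp
    have Fd: "F *\<^sub>v d \<in> carrier_vec p" using car d by auto
    show ?thesis
      unfolding Q_def 1 2 3 w_def[symmetric] quadratic_diff_expand[OF car w d]
        quadratic_diff_expand[OF car w d']
      using car d w Fd by (simp add: mult_mat_vec[of _ p p])
  qed
  have h_eq: "h v = sqrt (gauss_density p a F v * gauss_density p b F v)" if v: "v \<in> carrier_vec p" for v
  proof -
    have det: "0 \<le> Determinant.det F / (2 * pi) ^ p"
      using gaussian_integral(1)[OF F m] by simp
    have "gauss_density p a F v * gauss_density p b F v
      = Determinant.det F / (2 * pi) ^ p *
        exp (- ((v - a) \<bullet> (F *\<^sub>v (v - a)) + (v - b) \<bullet> (F *\<^sub>v (v - b))) / 2)"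
      using det by (simp add: gauss_density_def exp_add[symmetric] field_simps flip: real_sqrt_mult)
    also have "\<dots> = (h v)\<^sup>2"
      unfolding parallelogram[OF v] h_def gauss_density_def using det
      by (simp add: power_mult_distrib exp_double[symmetric] exp_add[symmetric] field_simps)
    finally show ?thesis
      using gauss_density_nonneg[OF F] by (simp add: h_def)
  qed
  note I = gauss_density_integral[OF F]
  have "1 - q / 8 \<le> 1 + - Q / 8" using q by (simp add: Q_def)
  also have "\<dots> \<le> exp (- Q / 8)" by (rule exp_ge_add_one_self)
  finally have BC: "1 - q / 8 \<le> (\<integral>v. h v \<partial>lborel_vec p)"
    using I[OF m] by (simp add: h_def[abs_def])
  have hi: "integrable (lborel_vec p) h"
    using I[OF m] by (simp add: h_def[abs_def])
  have "\<bar>measure (gaussian p a (minv F)) A - measure (gaussian p b (minv F)) A\<bar> \<le> 2 * sqrt (2 * (q / 8))"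
    unfolding gaussian_eq_density[OF F]
    by (rule tv_dist_le_hellinger[OF I[OF a] gauss_density_nonneg[OF F] I[OF b]
          gauss_density_nonneg[OF F] hi BC]) (use h_eq q A in auto)
  also have "2 * sqrt (2 * (q / 8)) = sqrt q"
    by (simp add: real_sqrt_divide)
  finally show ?thesis .
qed

text \<open>\<open>(1 + c)\<close> to the power \<open>- p / 4\<close> is at least \<open>exp (- p c / 4)\<close>, and this exceeds \<open>1 - p c / 4\<close>.\<close>

lemma det_power_bound:
  assumes "0 < x" "0 < y" "0 < z" "0 \<le> c" "z * z \<le> (1 + c) ^ p * (x * y)"
  shows "1 - real p * c / 4 \<le> sqrt (sqrt x * sqrt y / z)"
proof -
  have "exp (- (real p * c)) * (1 + c) ^ p \<le> 1"
  proof -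
    have "(1 + c) ^ p \<le> exp c ^ p"
      using assms by (intro power_mono) auto
    also have "\<dots> = exp (real p * c)" by (simp add: exp_of_nat_mult)
    finally have "exp (- (real p * c)) * (1 + c) ^ p \<le> exp (- (real p * c)) * exp (real p * c)"
      by (intro mult_left_mono) auto
    then show ?thesis by (simp flip: exp_add)
  qed
  then have "exp (- (real p * c)) * (1 + c) ^ p * (x * y) \<le> 1 * (x * y)"
    using assms(1,2) by (intro mult_right_mono) auto
  moreover have "exp (- (real p * c)) * (z * z) \<le> exp (- (real p * c)) * ((1 + c) ^ p * (x * y))"
    using assms(5) by (intro mult_left_mono) auto
  ultimately have le: "exp (- (real p * c)) * (z * z) \<le> x * y"
    by (simp only: mult.assoc mult_1)
  have "exp (- (real p * c) / 4) = sqrt (sqrt (exp (- (real p * c))))"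
    by (simp add: powr_half_sqrt[symmetric] exp_powr_real)
  also have "sqrt (exp (- (real p * c))) \<le> sqrt x * sqrt y / z"
  proof -
    have "sqrt (exp (- (real p * c)) * (z * z)) \<le> sqrt (x * y)" using le by simp
    moreover have "sqrt (exp (- (real p * c)) * (z * z)) = sqrt (exp (- (real p * c))) * z"
      using assms(3) by (simp only: real_sqrt_mult[of _ "z * z"]) simp
    ultimately have "sqrt (exp (- (real p * c))) * z \<le> sqrt x * sqrt y"
      by (simp only: real_sqrt_mult)
    then show ?thesis using assms(3) by (simp add: pos_le_divide_eq)
  qed
  finally have "exp (- (real p * c) / 4) \<le> sqrt (sqrt x * sqrt y / z)" by simp
  moreover have "1 + - (real p * c) / 4 \<le> exp (- (real p * c) / 4)" by (rule exp_ge_add_one_self)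
  ultimately show ?thesis by simp
qed

text \<open>
  For equal means the affinity is \<open>(det F det W / (det G)\<^sup>2)\<close> to the power \<open>1/4\<close> with
  \<open>G = (F + W) / 2\<close>. The first-order terms in \<open>D = W - F\<close> cancel because
  \<open>G F\<^sup>-\<^sup>1 G = W + D F\<^sup>-\<^sup>1 D / 4\<close>, and monotonicity of the determinant bounds the rest. The absence of
  first-order terms is what gives \<open>sqrt p\<close>, rather than \<open>p\<close>, in the bound.
\<close>

lemma tv_dist_gaussian_covariance:
  assumes F: "posdef p F" and W: "posdef p W" and m: "m \<in> carrier_vec p"
    and k: "0 < k" "\<And>v. v \<in> carrier_vec p \<Longrightarrow> k * (v \<bullet> v) \<le> v \<bullet> (F *\<^sub>v v)"
      "\<And>v. v \<in> carrier_vec p \<Longrightarrow> k * (v \<bullet> v) \<le> v \<bullet> (W *\<^sub>v v)"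
    and d: "0 < d" "\<And>v. v \<in> carrier_vec p \<Longrightarrow> vnorm ((W - F) *\<^sub>v v) \<le> d * vnorm v"
    and p: "0 < p" and A: "A \<in> sets (borel_vec p)"
  shows "\<bar>measure (gaussian p m (minv F)) A - measure (gaussian p m (minv W)) A\<bar> \<le> sqrt p * d / k"
proof -
  have cF: "F \<in> carrier_mat p p" "transpose_mat F = F" and cW: "W \<in> carrier_mat p p" "transpose_mat W = W"
    using F W by (auto simp: posdef_def)
  define D where "D = W - F"
  have cD: "D \<in> carrier_mat p p" "transpose_mat D = D"
    using cF cW by (auto simp: D_def transpose_minus intro!: minus_carrier_mat)
  define G where "G = F + (1/2 :: real) \<cdot>\<^sub>m D"
  have cG: "G \<in> carrier_mat p p" "transpose_mat G = G"
    using cF cD transpose_add[of F p p "(1/2) \<cdot>\<^sub>m D"]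
    by (auto simp: G_def transpose_mat_smult)
  have Gq: "w \<bullet> (G *\<^sub>v v) = (w \<bullet> (F *\<^sub>v v) + w \<bullet> (W *\<^sub>v v)) / 2"
    if v: "v \<in> carrier_vec p" "w \<in> carrier_vec p" for v w
  proof -
    have "w \<bullet> (G *\<^sub>v v) = (\<Sum>i<p. \<Sum>j<p. (w $ i * F $$ (i, j) * v $ j + w $ i * W $$ (i, j) * v $ j) / 2)"
      unfolding bilinear_expand[OF cG(1) that] using cF cW
      by (intro sum.cong refl) (auto simp: G_def D_def algebra_simps)
    then show ?thesis
      unfolding bilinear_expand[OF cF(1) that] bilinear_expand[OF cW(1) that]
      by (simp add: sum_divide_distrib sum.distrib add_divide_distrib)
  qed
  have G: "posdef p G"
    unfolding posdef_def
  proof (intro conjI ballI impI cG)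
    fix v :: rvec
    assume v: "v \<in> carrier_vec p" "v \<noteq> 0\<^sub>v p"
    then have "0 < v \<bullet> (F *\<^sub>v v)" "0 < v \<bullet> (W *\<^sub>v v)"
      using F W by (auto simp: posdef_def)
    then show "0 < v \<bullet> (G *\<^sub>v v)"
      unfolding Gq[OF v(1) v(1)] by (intro half_gt_zero add_pos_pos)
  qed
  have detF: "0 < Determinant.det F" and detW: "0 < Determinant.det W" and detG: "0 < Determinant.det G"
    using gaussian_integral(1)[OF _ m] F W G by auto
  let ?I = "minv F"
  have I: "?I \<in> carrier_mat p p" "F * ?I = 1\<^sub>m p" "?I * F = 1\<^sub>m p" "transpose_mat ?I = ?I"
    using minv_inverts[OF cF(1)] transpose_minv[OF cF] detF by auto
  define N where "N = G * ?I * G"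
  have cN: "N \<in> carrier_mat p p" using cG I by (auto simp: N_def intro!: mult_carrier_mat[of _ p p])
  \<comment> \<open>the size of \<open>D F\<^sup>-\<^sup>1 D / 4\<close> relative to \<open>W\<close>\<close>
  define c where "c = (d / k)\<^sup>2 / 4"
  have c: "0 < c" using d k by (simp add: c_def)
  have cIG: "?I * G \<in> carrier_mat p p" using I cG by auto
  have Nvec: "N *\<^sub>v v = G *\<^sub>v (?I *\<^sub>v (G *\<^sub>v v))" if v: "v \<in> carrier_vec p" for v
  proof -
    have "N *\<^sub>v v = (G * (?I * G)) *\<^sub>v v"
      unfolding N_def using assoc_mult_mat[OF cG(1) I(1) cG(1)] by simp
    also have "\<dots> = G *\<^sub>v ((?I * G) *\<^sub>v v)"
      by (rule assoc_mult_mat_vec[OF cG(1) cIG v])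
    also have "(?I * G) *\<^sub>v v = ?I *\<^sub>v (G *\<^sub>v v)"
      by (rule assoc_mult_mat_vec[OF I(1) cG(1) v])
    finally show ?thesis .
  qed
  have Nq: "v \<bullet> (N *\<^sub>v v) = v \<bullet> (W *\<^sub>v v) + (D *\<^sub>v v) \<bullet> (?I *\<^sub>v (D *\<^sub>v v)) / 4"
    if v: "v \<in> carrier_vec p" for v
  proof -
    let ?f = "F *\<^sub>v v" and ?e = "D *\<^sub>v v"
    have f: "?f \<in> carrier_vec p" and e: "?e \<in> carrier_vec p" using cF cD v by auto
    have Gv: "G *\<^sub>v v = ?f - (- 1/2 :: real) \<cdot>\<^sub>v ?e"
      unfolding G_def using cF cD v
      by (subst add_mult_distrib_mat_vec[of _ p p]) (auto intro!: eq_vecI simp: smult_mat_mult_vec[of _ p p])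
    have If: "?I *\<^sub>v ?f = v"
    proof -
      have "?I *\<^sub>v ?f = (?I * F) *\<^sub>v v"
        by (rule assoc_mult_mat_vec[symmetric, OF I(1) cF(1) v])
      then show ?thesis using I v by simp
    qed
    have gv: "G *\<^sub>v v \<in> carrier_vec p" using cG v by auto
    have "v \<bullet> (N *\<^sub>v v) = (?I *\<^sub>v (G *\<^sub>v v)) \<bullet> (G *\<^sub>v v)"
      unfolding Nvec[OF v]
      using bilinear_symmetric[OF cG v, of "?I *\<^sub>v (G *\<^sub>v v)"] I gv v by (metis mult_mat_vec_carrier)
    also have "\<dots> = (G *\<^sub>v v) \<bullet> (?I *\<^sub>v (G *\<^sub>v v))"
      using I gv by (intro comm_scalar_prod[of _ p]) auto
    also have "\<dots> = ?f \<bullet> (?I *\<^sub>v ?f) - 2 * (?f \<bullet> (?I *\<^sub>v ((- 1/2 :: real) \<cdot>\<^sub>v ?e)))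
        + ((- 1/2 :: real) \<cdot>\<^sub>v ?e) \<bullet> (?I *\<^sub>v ((- 1/2 :: real) \<cdot>\<^sub>v ?e))"
      unfolding Gv by (rule quadratic_diff_expand[OF I(1,4) f]) (use e in simp)
    also have "\<dots> = ?f \<bullet> (?I *\<^sub>v ?f) + ?f \<bullet> (?I *\<^sub>v ?e) + ?e \<bullet> (?I *\<^sub>v ?e) / 4"
    proof -
      have "?I *\<^sub>v ?e \<in> carrier_vec p" using I e by auto
      then show ?thesis using I e f by (simp add: mult_mat_vec[of _ p p])
    qed
    also have "?f \<bullet> (?I *\<^sub>v ?e) = ?e \<bullet> (?I *\<^sub>v ?f)"
      by (rule bilinear_symmetric[OF I(1,4) e f])
    also have "?f \<bullet> (?I *\<^sub>v ?f) + ?e \<bullet> (?I *\<^sub>v ?f) = v \<bullet> (W *\<^sub>v v)"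
    proof -
      have "W *\<^sub>v v = ?f + ?e"
        unfolding D_def using cF cW v by (intro eq_vecI) (auto simp: minus_mult_distrib_mat_vec[of _ p p])
      then show ?thesis
        unfolding If using f e v by (simp add: scalar_prod_add_distrib[of _ p] comm_scalar_prod[of v p])
    qed
    finally show ?thesis by simp
  qed
  have Nsym: "transpose_mat N = N"
    unfolding N_def using cG I transpose_mult[of "G * ?I" p p G p] transpose_mult[OF cG(1) I(1)]
      assoc_mult_mat[OF cG(1) I(1) cG(1)] by simp
  have Ige: "0 \<le> e \<bullet> (?I *\<^sub>v e)" if e: "e \<in> carrier_vec p" for e
  proof -
    let ?v = "?I *\<^sub>v e"
    have v: "?v \<in> carrier_vec p" using I e by auto
    have "F *\<^sub>v ?v = e"
      using assoc_mult_mat_vec[OF cF(1) I(1) e] I(2) e by simp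
    then have "e \<bullet> ?v = ?v \<bullet> (F *\<^sub>v ?v)"
      using comm_scalar_prod[OF e v] by simp
    moreover have "0 \<le> k * (?v \<bullet> ?v)" using k(1) by (simp flip: vnorm_sq)
    ultimately show ?thesis using k(2)[OF v] by simp
  qed
  have Npd: "posdef p N"
    unfolding posdef_def
  proof (intro conjI ballI impI cN Nsym)
    fix v :: rvec
    assume v: "v \<in> carrier_vec p" "v \<noteq> 0\<^sub>v p"
    have "D *\<^sub>v v \<in> carrier_vec p" using cD v by auto
    from Ige[OF this] show "0 < v \<bullet> (N *\<^sub>v v)"
      unfolding Nq[OF v(1)] using W v by (simp add: posdef_def add_pos_nonneg)
  qed
  define B where "B = (1 + c) \<cdot>\<^sub>m W"
  have B: "posdef p B"
    using W c by (auto simp: posdef_def B_def transpose_mat_smult smult_mat_mult_vec[of _ p p])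
  have NB: "v \<bullet> (N *\<^sub>v v) \<le> v \<bullet> (B *\<^sub>v v)" if v: "v \<in> carrier_vec p" for v
  proof -
    have e: "D *\<^sub>v v \<in> carrier_vec p" using cD v by auto
    have "(D *\<^sub>v v) \<bullet> (?I *\<^sub>v (D *\<^sub>v v)) \<le> (vnorm (D *\<^sub>v v))\<^sup>2 / k"
      using coercive_minv_bound[OF cF(1) k(2,1) e] by (simp add: vnorm_sq)
    also have "\<dots> \<le> (d * vnorm v)\<^sup>2 / k"
      using d(2)[OF v] k(1) by (intro divide_right_mono power_mono) (auto simp: D_def)
    also have "\<dots> = (d / k)\<^sup>2 * (k * (v \<bullet> v))"
      using k(1) by (simp add: power_mult_distrib power_divide vnorm_sq[symmetric] power2_eq_square)
    also have "\<dots> \<le> (d / k)\<^sup>2 * (v \<bullet> (W *\<^sub>v v))"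
      by (intro mult_left_mono k(3) v) simp
    finally have "(D *\<^sub>v v) \<bullet> (?I *\<^sub>v (D *\<^sub>v v)) / 4 \<le> c * (v \<bullet> (W *\<^sub>v v))"
      by (simp add: c_def)
    moreover have "v \<bullet> (B *\<^sub>v v) = (1 + c) * (v \<bullet> (W *\<^sub>v v))"
      using cW v by (simp add: B_def smult_mat_mult_vec[of _ p p])
    ultimately show ?thesis
      unfolding Nq[OF v] by (simp add: algebra_simps)
  qed
  have "Determinant.det N \<le> (1 + c) ^ p * Determinant.det W"
    using det_mono[OF Npd B NB] cW by (simp add: B_def)
  moreover have "Determinant.det N * Determinant.det F = Determinant.det G * Determinant.det G"
  proof -
    have "Determinant.det N = Determinant.det G * Determinant.det ?I * Determinant.det G"
      unfolding N_def using det_mult[of "G * ?I" p G] det_mult[OF cG(1) I(1)] cG I by simp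
    moreover have "Determinant.det ?I = 1 / Determinant.det F"
      using minv_minv[OF cF(1)] detF by simp
    ultimately show ?thesis using detF by simp
  qed
  ultimately have detle: "Determinant.det G * Determinant.det G \<le> (1 + c) ^ p * (Determinant.det F * Determinant.det W)"
    using mult_right_mono[of "Determinant.det N" "(1 + c) ^ p * Determinant.det W" "Determinant.det F"] detF
    by (simp add: mult_ac)
  define kap where "kap = sqrt (sqrt (Determinant.det F) * sqrt (Determinant.det W) / Determinant.det G)"
  have kap: "1 - real p * c / 4 \<le> kap"
    unfolding kap_def by (rule det_power_bound[OF detF detW detG _ detle]) (use c in simp)
  define h where "h v = kap * gauss_density p m G v" for v
  have h_eq: "h v = sqrt (gauss_density p m F v * gauss_density p m W v)" if v: "v \<in> carrier_vec p" for v
  proof -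
    define u where "u = v - m"
    have u: "u \<in> carrier_vec p" using v m by (simp add: u_def)
    define P where "P = (2 * pi) ^ p"
    have P: "0 < P" by (simp add: P_def)
    have "(h v)\<^sup>2 = (sqrt (Determinant.det F) * sqrt (Determinant.det W) / Determinant.det G) *
        (Determinant.det G / P) * exp (- (u \<bullet> (G *\<^sub>v u)))"
      using detF detG detW P
      unfolding h_def kap_def gauss_density_def u_def[symmetric] P_def[symmetric]
      by (simp add: power_mult_distrib exp_double[symmetric])
    also have "\<dots> = sqrt (Determinant.det F / P) * sqrt (Determinant.det W / P) *
        exp (- (u \<bullet> (G *\<^sub>v u)))"
      using detG P by (simp add: real_sqrt_divide del: real_sqrt_mult_self) (simp add: field_simps)
    also have "\<dots> = gauss_density p m F v * gauss_density p m W v"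
      unfolding Gq[OF u u] gauss_density_def u_def[symmetric] P_def[symmetric]
      by (simp add: exp_add[symmetric] add_divide_distrib minus_divide_left diff_divide_distrib
          del: minus_divide_left[symmetric])
    finally have "(h v)\<^sup>2 = gauss_density p m F v * gauss_density p m W v" .
    moreover have "0 \<le> h v"
      using gauss_density_nonneg[OF G] detF detW detG by (simp add: h_def kap_def)
    ultimately show ?thesis by (metis real_sqrt_unique)
  qed
  have hi: "integrable (lborel_vec p) h" and BC: "1 - real p * c / 4 \<le> (\<integral>v. h v \<partial>lborel_vec p)"
    using gauss_density_integral[OF G m] kap by (simp_all add: h_def[abs_def])
  have "\<bar>measure (gaussian p m (minv F)) A - measure (gaussian p m (minv W)) A\<bar>
      \<le> 2 * sqrt (2 * (real p * c / 4))"
    unfolding gaussian_eq_density[OF F] gaussian_eq_density[OF W]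
    by (rule tv_dist_le_hellinger[OF gauss_density_integral[OF F m] gauss_density_nonneg[OF F]
          gauss_density_integral[OF W m] gauss_density_nonneg[OF W] hi BC]) (use h_eq c p A in auto)
  also have "\<dots> = sqrt (real p * (d / k)\<^sup>2 / 2)"
  proof -
    have "2 * sqrt (2 * (real p * c / 4)) = sqrt (4 * (2 * (real p * c / 4)))"
      by (simp only: real_sqrt_mult real_sqrt_four)
    then show ?thesis by (simp add: c_def)
  qed
  also have "\<dots> \<le> sqrt (real p * (d / k)\<^sup>2)"
    by (intro real_sqrt_le_mono) simp
  also have "\<dots> = sqrt p * d / k"
    using d k by (simp add: real_sqrt_mult)
  finally show ?thesis .
qed

text \<open>
  The means are moved first, at precision \<open>F\<close>, and the covariances afterwards. Coercivity
  turns the bound on \<open>F (a - b)\<close> into one on \<open>(a - b) \<bullet> F (a - b)\<close>.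
\<close>

lemma tv_dist_gaussian:
  assumes F: "posdef p F" and W: "posdef p W" and a: "a \<in> carrier_vec p" and b: "b \<in> carrier_vec p"
    and k: "0 < k" "\<And>v. v \<in> carrier_vec p \<Longrightarrow> k * (v \<bullet> v) \<le> v \<bullet> (F *\<^sub>v v)"
      "\<And>v. v \<in> carrier_vec p \<Longrightarrow> k * (v \<bullet> v) \<le> v \<bullet> (W *\<^sub>v v)"
    and d: "0 < d" "\<And>v. v \<in> carrier_vec p \<Longrightarrow> vnorm ((W - F) *\<^sub>v v) \<le> d * vnorm v"
    and e: "0 < e" "vnorm (F *\<^sub>v (a - b)) \<le> e"
    and p: "0 < p"
  shows "tv_dist (gaussian p a (minv F)) (gaussian p b (minv W)) \<le> e / sqrt k + sqrt p * d / k"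
proof (rule tv_dist_le)
  fix A assume "A \<in> sets (gaussian p a (minv F))"
  then have A: "A \<in> sets (borel_vec p)" by simp
  let ?u = "a - b"
  have u: "?u \<in> carrier_vec p" using a b by simp
  have Fu: "F *\<^sub>v ?u \<in> carrier_vec p" using posdef_carrier[OF F] u by auto
  have q0: "?u \<bullet> (F *\<^sub>v ?u) \<le> vnorm ?u * e"
    using scalar_prod_le_vnorm[OF u Fu] mult_left_mono[OF e(2) vnorm_nonneg[of ?u]] by simp
  have "k * vnorm ?u \<le> e"
  proof (cases "vnorm ?u = 0")
    case False
    have "vnorm ?u * (k * vnorm ?u) \<le> vnorm ?u * e"
      using k(2)[OF u] q0 by (simp add: vnorm_sq[symmetric] power2_eq_square mult_ac)
    then show ?thesis using False vnorm_nonneg[of ?u] by (simp add: mult_le_cancel_left)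
  qed (use e in simp)
  then have "vnorm ?u * e \<le> e / k * e"
    using e k(1) by (intro mult_right_mono) (auto simp: field_simps)
  then have "?u \<bullet> (F *\<^sub>v ?u) \<le> e\<^sup>2 / k"
    using q0 by (simp add: power2_eq_square)
  from tv_dist_gaussian_mean[OF F a b this _ A]
  have "\<bar>measure (gaussian p a (minv F)) A - measure (gaussian p b (minv F)) A\<bar> \<le> e / sqrt k"
    using e k(1) by (simp add: real_sqrt_divide)
  moreover have "\<bar>measure (gaussian p b (minv F)) A - measure (gaussian p b (minv W)) A\<bar> \<le> sqrt p * d / k"
    by (rule tv_dist_gaussian_covariance[OF F W b k d p A])
  ultimately show "\<bar>measure (gaussian p a (minv F)) A - measure (gaussian p b (minv W)) A\<bar>
      \<le> e / sqrt k + sqrt p * d / k"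
    by linarith
qed

section \<open>Gradients and Hessians along lines\<close>

lemma has_derivative_at_0I:
  fixes f :: "real \<Rightarrow> real"
  assumes "\<And>e. 0 < e \<Longrightarrow> \<exists>d>0. \<forall>h. \<bar>h\<bar> < d \<longrightarrow> \<bar>f h - f 0 - D * h\<bar> \<le> e * \<bar>h\<bar>"
  shows "(f has_real_derivative D) (at 0)"
  unfolding DERIV_def LIM_eq
proof (intro allI impI)
  fix e :: real assume "0 < e"
  then obtain d where d: "0 < d" "\<And>h. \<bar>h\<bar> < d \<Longrightarrow> \<bar>f h - f 0 - D * h\<bar> \<le> e / 2 * \<bar>h\<bar>"
    using assms[of "e / 2"] by auto
  have "norm ((f (0 + h) - f 0) / h - D) < e" if h: "h \<noteq> 0" "norm (h - 0) < d" for h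
  proof -
    have "norm ((f (0 + h) - f 0) / h - D) = \<bar>f h - f 0 - D * h\<bar> / \<bar>h\<bar>"
      using h by (simp add: field_simps flip: abs_divide)
    also have "\<dots> \<le> e / 2"
      using d(2)[of h] h by (simp add: field_simps)
    finally show ?thesis using \<open>0 < e\<close> by simp
  qed
  then show "\<exists>s>0. \<forall>x. x \<noteq> 0 \<and> norm (x - 0) < s \<longrightarrow> norm ((f (0 + x) - f 0) / x - D) < e"
    using d(1) by blast
qed

lemma small_multiple:
  fixes d n h :: real
  assumes "0 < d" "0 \<le> n"
  shows "\<bar>h\<bar> < d / (n + 1) \<Longrightarrow> \<bar>h\<bar> * n < d"
proof -
  assume "\<bar>h\<bar> < d / (n + 1)"
  then have "\<bar>h\<bar> * (n + 1) < d" using assms by (simp add: field_simps)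
  moreover have "\<bar>h\<bar> * n \<le> \<bar>h\<bar> * (n + 1)" by (intro mult_left_mono) auto
  ultimately show ?thesis by linarith
qed

text \<open>
  Derivatives along lines determine gradient and Jacobian, which justifies their definitions by definite
  descriptions.
\<close>

lemma has_gradient_directional:
  assumes g: "has_gradient p f g \<theta>" and th: "\<theta> \<in> carrier_vec p" and w: "w \<in> carrier_vec p"
  shows "((\<lambda>u. f (\<theta> + u \<cdot>\<^sub>v w)) has_real_derivative g \<bullet> w) (at 0)"
proof (rule has_derivative_at_0I)
  fix e :: real assume e: "0 < e"
  have "0 < e / (vnorm w + 1)" using e by (simp add: add_nonneg_pos)
  with g obtain d where d: "0 < d" "\<And>h. h \<in> carrier_vec p \<Longrightarrow> vnorm h < d \<Longrightarrow>
      \<bar>f (\<theta> + h) - f \<theta> - g \<bullet> h\<bar> \<le> e / (vnorm w + 1) * vnorm h"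
    unfolding has_gradient_def by blast
  have gc: "g \<in> carrier_vec p" using g by (simp add: has_gradient_def)
  have zero: "\<theta> + 0 \<cdot>\<^sub>v w = \<theta>" using th w by (intro eq_vecI) auto
  have "\<bar>f (\<theta> + h \<cdot>\<^sub>v w) - f (\<theta> + 0 \<cdot>\<^sub>v w) - g \<bullet> w * h\<bar> \<le> e * \<bar>h\<bar>" if h: "\<bar>h\<bar> < d / (vnorm w + 1)" for h
  proof -
    have "\<bar>f (\<theta> + h \<cdot>\<^sub>v w) - f \<theta> - g \<bullet> (h \<cdot>\<^sub>v w)\<bar> \<le> e / (vnorm w + 1) * vnorm (h \<cdot>\<^sub>v w)"
      using small_multiple[OF d(1) vnorm_nonneg h] w by (intro d(2)) auto
    also have "\<dots> = e * \<bar>h\<bar> * (vnorm w / (vnorm w + 1))" by simp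
    also have "\<dots> \<le> e * \<bar>h\<bar> * 1"
      using e by (intro mult_left_mono) (auto simp: divide_le_eq_1 add_nonneg_pos)
    finally show ?thesis using gc w by (simp add: zero mult.commute)
  qed
  then show "\<exists>d>0. \<forall>h. \<bar>h\<bar> < d \<longrightarrow>
      \<bar>f (\<theta> + h \<cdot>\<^sub>v w) - f (\<theta> + 0 \<cdot>\<^sub>v w) - g \<bullet> w * h\<bar> \<le> e * \<bar>h\<bar>"
    using d(1) by (intro exI[of _ "d / (vnorm w + 1)"]) (auto simp: add_nonneg_pos)
qed

lemma has_jacobian_directional:
  assumes H: "has_jacobian p G H \<theta>" and th: "\<theta> \<in> carrier_vec p" and w: "w \<in> carrier_vec p"
    and z: "z \<in> carrier_vec p" and G: "\<And>\<theta>. \<theta> \<in> carrier_vec p \<Longrightarrow> G \<theta> \<in> carrier_vec p"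
  shows "((\<lambda>u. z \<bullet> G (\<theta> + u \<cdot>\<^sub>v w)) has_real_derivative z \<bullet> (H *\<^sub>v w)) (at 0)"
proof (rule has_derivative_at_0I)
  fix e :: real assume e: "0 < e"
  let ?n = "vnorm z * vnorm w"
  have n: "0 \<le> ?n" by simp
  have "0 < e / (?n + 1)" using e by (simp add: add_nonneg_pos)
  with H obtain d where d: "0 < d" "\<And>h. h \<in> carrier_vec p \<Longrightarrow> vnorm h < d \<Longrightarrow>
      vnorm (G (\<theta> + h) - G \<theta> - H *\<^sub>v h) \<le> e / (?n + 1) * vnorm h"
    unfolding has_jacobian_def by blast
  have Hc: "H \<in> carrier_mat p p" using H by (simp add: has_jacobian_def)
  have zero: "\<theta> + 0 \<cdot>\<^sub>v w = \<theta>" using th w by (intro eq_vecI) auto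
  have "\<bar>z \<bullet> G (\<theta> + h \<cdot>\<^sub>v w) - z \<bullet> G (\<theta> + 0 \<cdot>\<^sub>v w) - z \<bullet> (H *\<^sub>v w) * h\<bar> \<le> e * \<bar>h\<bar>"
    if h: "\<bar>h\<bar> < d / (vnorm w + 1)" for h
  proof -
    let ?v = "G (\<theta> + h \<cdot>\<^sub>v w) - G \<theta> - H *\<^sub>v (h \<cdot>\<^sub>v w)"
    have c: "G (\<theta> + h \<cdot>\<^sub>v w) \<in> carrier_vec p" "G \<theta> \<in> carrier_vec p" "H *\<^sub>v w \<in> carrier_vec p"
      using G th w Hc by auto
    have v: "?v \<in> carrier_vec p" using c Hc w by (auto simp: mult_mat_vec[OF Hc w])
    have "\<bar>z \<bullet> ?v\<bar> \<le> vnorm z * vnorm ?v" by (rule scalar_prod_le_vnorm[OF z v])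
    also have "\<dots> \<le> vnorm z * (e / (?n + 1) * vnorm (h \<cdot>\<^sub>v w))"
      using small_multiple[OF d(1) vnorm_nonneg h] w by (intro mult_left_mono d(2)) auto
    also have "\<dots> = e * \<bar>h\<bar> * (?n / (?n + 1))" by simp
    also have "\<dots> \<le> e * \<bar>h\<bar> * 1"
      using e n by (intro mult_left_mono) (auto simp: divide_le_eq_1 add_nonneg_pos)
    finally have "\<bar>z \<bullet> ?v\<bar> \<le> e * \<bar>h\<bar>" by simp
    moreover have "z \<bullet> ?v = z \<bullet> G (\<theta> + h \<cdot>\<^sub>v w) - z \<bullet> G \<theta> - z \<bullet> (H *\<^sub>v w) * h"
      unfolding mult_mat_vec[OF Hc w] using c z
      by (simp add: scalar_prod_minus_distrib[of _ p] mult.commute)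
    ultimately show ?thesis by (simp add: zero)
  qed
  then show "\<exists>d>0. \<forall>h. \<bar>h\<bar> < d \<longrightarrow>
      \<bar>z \<bullet> G (\<theta> + h \<cdot>\<^sub>v w) - z \<bullet> G (\<theta> + 0 \<cdot>\<^sub>v w) - z \<bullet> (H *\<^sub>v w) * h\<bar> \<le> e * \<bar>h\<bar>"
    using d(1) by (intro exI[of _ "d / (vnorm w + 1)"]) (auto simp: add_nonneg_pos)
qed

lemma vec_eq_by_testing:
  fixes v w :: rvec
  assumes "v \<in> carrier_vec p" "w \<in> carrier_vec p" "\<And>z. z \<in> carrier_vec p \<Longrightarrow> z \<bullet> v = z \<bullet> w"
  shows "v = w"
proof (rule eq_vecI)
  fix i assume "i < dim_vec w"
  then show "v $ i = w $ i"
    using assms(3)[of "unit_vec p i"] assms(1,2) by simp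
qed (use assms in simp)

lemma has_gradient_unique:
  assumes "has_gradient p f g \<theta>" "has_gradient p f g' \<theta>" "\<theta> \<in> carrier_vec p"
  shows "g = g'"
proof (rule vec_eq_by_testing)
  show c: "g \<in> carrier_vec p" "g' \<in> carrier_vec p" using assms by (auto simp: has_gradient_def)
  fix z :: rvec assume z: "z \<in> carrier_vec p"
  have "g \<bullet> z = g' \<bullet> z"
    using has_gradient_directional[OF assms(1,3) z] has_gradient_directional[OF assms(2,3) z]
    by (rule DERIV_unique)
  then show "z \<bullet> g = z \<bullet> g'" using c z by (simp add: comm_scalar_prod[of z p])
qed

lemma has_jacobian_unique:
  assumes "has_jacobian p G H \<theta>" "has_jacobian p G H' \<theta>" "\<theta> \<in> carrier_vec p"
    and G: "\<And>\<theta>. \<theta> \<in> carrier_vec p \<Longrightarrow> G \<theta> \<in> carrier_vec p"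
  shows "H = H'"
proof (rule eq_matI)
  have c: "H \<in> carrier_mat p p" "H' \<in> carrier_mat p p" using assms by (auto simp: has_jacobian_def)
  fix i j assume "i < dim_row H'" "j < dim_col H'"
  then have ij: "i < p" "j < p" using c by auto
  have "unit_vec p i \<bullet> (H *\<^sub>v unit_vec p j) = unit_vec p i \<bullet> (H' *\<^sub>v unit_vec p j)"
    by (rule DERIV_unique[OF has_jacobian_directional[OF assms(1,3) _ _ G]
          has_jacobian_directional[OF assms(2,3) _ _ G]]) auto
  then show "H $$ (i, j) = H' $$ (i, j)" using ij c by simp
qed (use assms in \<open>auto simp: has_jacobian_def\<close>)

context
  fixes p :: nat and f :: "rvec \<Rightarrow> real"
  assumes f: "twice_differentiable p f"
begin

lemma has_gradient_gradient:
  assumes "\<theta> \<in> carrier_vec p"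
  shows "has_gradient p f (gradient p f \<theta>) \<theta>"
proof -
  obtain g where "has_gradient p f g \<theta>"
    using f assms by (auto simp: twice_differentiable_def)
  then show ?thesis
    unfolding gradient_def using has_gradient_unique assms by (metis theI)
qed

lemma gradient_carrier: "\<theta> \<in> carrier_vec p \<Longrightarrow> gradient p f \<theta> \<in> carrier_vec p"
  using has_gradient_gradient by (auto simp: has_gradient_def)

lemma has_jacobian_hessian:
  assumes "\<theta> \<in> carrier_vec p"
  shows "has_jacobian p (gradient p f) (hessian p f \<theta>) \<theta>"
proof -
  obtain g where "has_jacobian p (gradient p f) g \<theta>"
    using f assms by (auto simp: twice_differentiable_def)
  then show ?thesis
    unfolding hessian_def using has_jacobian_unique assms gradient_carrier by (metis theI)
qed

lemma hessian_carrier: "\<theta> \<in> carrier_vec p \<Longrightarrow> hessian p f \<theta> \<in> carrier_mat p p"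
  using has_jacobian_hessian by (auto simp: has_jacobian_def)

lemma shift_line:
  assumes "\<theta> \<in> carrier_vec p" "w \<in> carrier_vec p"
  shows "\<theta> + u \<cdot>\<^sub>v w + s \<cdot>\<^sub>v w = \<theta> + (s + u :: real) \<cdot>\<^sub>v w"
  using assms by (intro eq_vecI) (auto simp: algebra_simps)

lemma loss_line_derivative:
  assumes th: "\<theta> \<in> carrier_vec p" and w: "w \<in> carrier_vec p"
  shows "((\<lambda>u. f (\<theta> + u \<cdot>\<^sub>v w)) has_real_derivative gradient p f (\<theta> + u \<cdot>\<^sub>v w) \<bullet> w) (at u)"
proof -
  have c: "\<theta> + u \<cdot>\<^sub>v w \<in> carrier_vec p" using th w by simp
  have "((\<lambda>s. f (\<theta> + (s + u) \<cdot>\<^sub>v w)) has_real_derivative gradient p f (\<theta> + u \<cdot>\<^sub>v w) \<bullet> w) (at 0)"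
    using has_gradient_directional[OF has_gradient_gradient[OF c] c w]
    by (simp add: shift_line[OF th w])
  then show ?thesis
    using DERIV_shift[of "\<lambda>u. f (\<theta> + u \<cdot>\<^sub>v w)" _ 0 u] by simp
qed

lemma gradient_line_derivative:
  assumes th: "\<theta> \<in> carrier_vec p" and w: "w \<in> carrier_vec p" and z: "z \<in> carrier_vec p"
  shows "((\<lambda>u. z \<bullet> gradient p f (\<theta> + u \<cdot>\<^sub>v w)) has_real_derivative
    z \<bullet> (hessian p f (\<theta> + u \<cdot>\<^sub>v w) *\<^sub>v w)) (at u)"
proof -
  have c: "\<theta> + u \<cdot>\<^sub>v w \<in> carrier_vec p" using th w by simp
  have "((\<lambda>s. z \<bullet> gradient p f (\<theta> + (s + u) \<cdot>\<^sub>v w)) has_real_derivative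
      z \<bullet> (hessian p f (\<theta> + u \<cdot>\<^sub>v w) *\<^sub>v w)) (at 0)"
    using has_jacobian_directional[OF has_jacobian_hessian[OF c] c w z gradient_carrier]
    by (simp add: shift_line[OF th w])
  then show ?thesis
    using DERIV_shift[of "\<lambda>u. z \<bullet> gradient p f (\<theta> + u \<cdot>\<^sub>v w)" _ 0 u] by simp
qed

lemma gradient_mean_value:
  assumes th: "\<theta> \<in> carrier_vec p" and w: "w \<in> carrier_vec p" and z: "z \<in> carrier_vec p"
  obtains u where "0 < u" "u < 1"
    "z \<bullet> gradient p f (\<theta> + w) - z \<bullet> gradient p f \<theta> = z \<bullet> (hessian p f (\<theta> + u \<cdot>\<^sub>v w) *\<^sub>v w)"
proof -
  have "\<exists>u::real>0. u < 1 \<and> z \<bullet> gradient p f (\<theta> + 1 \<cdot>\<^sub>v w) - z \<bullet> gradient p f (\<theta> + 0 \<cdot>\<^sub>v w)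
      = (1 - 0) * (z \<bullet> (hessian p f (\<theta> + u \<cdot>\<^sub>v w) *\<^sub>v w))"
    by (rule MVT2) (use gradient_line_derivative[OF assms] in auto)
  moreover have "\<theta> + 0 \<cdot>\<^sub>v w = \<theta>" "\<theta> + 1 \<cdot>\<^sub>v w = \<theta> + w"
    using th w by (auto intro!: eq_vecI)
  ultimately show ?thesis using that by auto
qed

end

section \<open>Comparison of second derivatives along a segment\<close>

text \<open>
  Functions are compared to second order through the sign of the second derivative of their difference;
  this takes the place of the integral remainder in Taylor's formula.
\<close>

lemma taylor_lower_bound:
  fixes D D' D'' :: "real \<Rightarrow> real"
  assumes ab: "a < b" and D: "\<And>u. (D has_real_derivative D' u) (at u)"
    and D': "\<And>u. (D' has_real_derivative D'' u) (at u)"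
    and nonneg: "\<And>u. a \<le> u \<Longrightarrow> u \<le> b \<Longrightarrow> 0 \<le> D'' u"
  shows "D a + D' a * (b - a) \<le> D b" "D b - D' b * (b - a) \<le> D a"
proof -
  obtain z where z: "a < z" "z < b" "D b - D a = (b - a) * D' z"
    using MVT2[OF ab, of D D'] D by auto
  have "D' a \<le> D' z" "D' z \<le> D' b"
    by (rule DERIV_nonneg_imp_nondecreasing; use z D' nonneg in \<open>fastforce\<close>)+
  then have "(b - a) * D' a \<le> (b - a) * D' z" "(b - a) * D' z \<le> (b - a) * D' b"
    using ab by (auto intro: mult_left_mono)
  with z(3) show "D a + D' a * (b - a) \<le> D b" "D b - D' b * (b - a) \<le> D a"
    using mult.commute[of "D' a" "b - a"] mult.commute[of "D' b" "b - a"] by linarith+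
qed

text \<open>
  To third order, the factor \<open>1 + y / 2\<close> raises \<open>y\<^sup>2\<close> by \<open>y\<^sup>3 / 2\<close>, while the exponential lowers it by
  \<open>2 y\<^sup>3 / 3\<close>.
\<close>

lemma exp_remainder_small:
  fixes y :: real
  assumes "0 < y" "y < 1"
  shows "(1 + y / 2) * (2 * (1 - exp (- y) * (1 + y))) < y\<^sup>2"
proof -
  have "1 - y + y\<^sup>2 / 2 - y ^ 3 / 6 \<le> exp (- y)"
  proof -
    obtain t where "exp (- y) = (\<Sum>m<4. (- y) ^ m / fact m) + exp t / fact 4 * (- y) ^ 4"
      using Maclaurin_exp_le[of "- y" 4] by blast
    moreover have "0 \<le> exp t / fact 4 * (- y) ^ 4" by simp
    ultimately show ?thesis
      by (simp add: eval_nat_numeral)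
  qed
  then have "(1 - y + y\<^sup>2 / 2 - y ^ 3 / 6) * (1 + y) \<le> exp (- y) * (1 + y)"
    using assms by (intro mult_right_mono) auto
  moreover have "(1 - y + y\<^sup>2 / 2 - y ^ 3 / 6) * (1 + y) = 1 - y\<^sup>2 / 2 + y ^ 3 / 3 - y ^ 4 / 6"
    by (simp add: field_simps eval_nat_numeral)
  ultimately have "1 - y\<^sup>2 / 2 + y ^ 3 / 3 - y ^ 4 / 6 \<le> exp (- y) * (1 + y)"
    by (simp only:)
  moreover have "2 * (1 - E) \<le> y\<^sup>2 - 2 * y ^ 3 / 3 + y ^ 4 / 3"
    if "1 - y\<^sup>2 / 2 + y ^ 3 / 3 - y ^ 4 / 6 \<le> E" for E
    using that by simp
  ultimately have "2 * (1 - exp (- y) * (1 + y)) \<le> y\<^sup>2 - 2 * y ^ 3 / 3 + y ^ 4 / 3"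
    by blast
  then have "(1 + y / 2) * (2 * (1 - exp (- y) * (1 + y)))
      \<le> (1 + y / 2) * (y\<^sup>2 - 2 * y ^ 3 / 3 + y ^ 4 / 3)"
    using assms by (intro mult_left_mono) auto
  also have "\<dots> = y\<^sup>2 - y ^ 3 / 6 * (1 - y\<^sup>2)"
    by (simp add: field_simps eval_nat_numeral)
  also have "\<dots> < y\<^sup>2"
    using assms by (simp add: power_less_one_iff)
  finally show ?thesis .
qed

text \<open>
  The smoothness hypothesis bounds \<open>v b\<close> by \<open>1 + e (b - a)\<close> times an average of \<open>v\<close> over \<open>[a, b]\<close>. If the claim
  failed at \<open>u\<close>, then \<open>v s * exp (- 2 e s)\<close> would have its maximum over \<open>[u, 1]\<close> at some \<open>b > u\<close>, and to the
  left of \<open>b\<close> the function \<open>v\<close> would lie below an exponential of rate \<open>2 e\<close>. On a short interval the average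
  is then too small.
\<close>

lemma second_derivative_comparable_pos:
  fixes f f' v :: "real \<Rightarrow> real"
  assumes f: "\<And>u. (f has_real_derivative f' u) (at u)"
    and f': "\<And>u. (f' has_real_derivative v u) (at u)"
    and cont: "continuous_on {0..1} v" and e: "0 < e"
    and smooth: "\<And>a b. 0 \<le> a \<Longrightarrow> a < b \<Longrightarrow> b \<le> 1 \<Longrightarrow>
        \<exists>\<phi>\<ge>0. \<phi> \<le> e * (b - a) \<and>
          v b * (b - a)\<^sup>2 \<le> (1 + \<phi>) * (2 * (f b - f a - f' a * (b - a)))"
    and v1: "0 < v 1" and u: "0 \<le> u" "u \<le> 1"
  shows "v 1 * exp (- (2 * e * (1 - u))) \<le> v u"
proof (rule ccontr)
  assume neg: "\<not> ?thesis"
  define c where "c = 2 * e"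
  have c: "0 < c" using e by (simp add: c_def)
  define w where "w s = v s * exp (- c * s)" for s
  have exp_eq: "exp (- (c * (1 - u))) = exp (- c) / exp (- c * u)"
    by (simp add: exp_diff[symmetric] algebra_simps)
  have lt: "w u < w 1"
    using neg unfolding w_def c_def[symmetric] exp_eq by (simp add: field_simps)
  have "continuous_on {u..1} w"
    unfolding w_def using u by (intro continuous_intros continuous_on_subset[OF cont]) auto
  then obtain b where b: "b \<in> {u..1}" and max: "\<And>s. s \<in> {u..1} \<Longrightarrow> w s \<le> w b"
    using continuous_attains_sup[of "{u..1}" w] u by auto
  have "w u < w b" using lt max[of 1] u by force
  then have ub: "u < b" using b by (cases "u = b") auto
  have vb: "0 < v b"
  proof -
    have "0 < w 1" using v1 by (simp add: w_def)
    then have "0 < w b" using max[of 1] u by force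
    then show ?thesis by (simp add: w_def zero_less_mult_iff)
  qed
  have bound: "v s \<le> v b * exp (- (c * (b - s)))" if s: "s \<in> {u..1}" for s
  proof -
    have "v s * exp (- c * s) \<le> v b * exp (- c * b)" using max[OF s] by (simp add: w_def)
    then have "v s \<le> v b * (exp (- c * b) / exp (- c * s))" by (simp add: field_simps)
    then show ?thesis by (simp add: exp_diff[symmetric] algebra_simps)
  qed
  \<comment> \<open>inside \<open>[u, b]\<close>, and with \<open>c h < 1\<close> for the expansion of the exponential\<close>
  define h where "h = min (b - u) (1 / (2 * c))"
  have h: "0 < h" "h \<le> b - u" "c * h < 1"
    using ub c by (auto simp: h_def min_def field_simps)
  define a where "a = b - h"
  have a: "0 \<le> a" "a < b" "u \<le> a" using h u by (auto simp: a_def)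
  \<comment> \<open>compare \<open>f\<close> with the function whose second derivative is the exponential bound\<close>
  define G where "G s = v b / c\<^sup>2 * exp (- (c * (b - s)))" for s
  define G' where "G' s = v b / c * exp (- (c * (b - s)))" for s
  have G: "(G has_real_derivative G' s) (at s)" for s
    unfolding G_def G'_def using c
    by (auto intro!: derivative_eq_intros simp: power2_eq_square)
  have G': "(G' has_real_derivative v b * exp (- (c * (b - s)))) (at s)" for s
    unfolding G'_def using c by (auto intro!: derivative_eq_intros)
  have "(G a - f a) + (G' a - f' a) * (b - a) \<le> G b - f b"
    by (rule taylor_lower_bound(1)[where D = "\<lambda>s. G s - f s" and D' = "\<lambda>s. G' s - f' s"
          and D'' = "\<lambda>s. v b * exp (- (c * (b - s))) - v s"])
      (use a b bound in \<open>auto intro!: DERIV_diff G G' f f'\<close>)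
  then have "f b - f a - f' a * (b - a) \<le> G b - G a - G' a * h"
    by (simp add: a_def algebra_simps)
  also have "\<dots> = v b / c\<^sup>2 * (1 - exp (- (c * h)) * (1 + c * h))"
    using c by (simp add: G_def G'_def a_def field_simps power2_eq_square)
  finally have le: "(1 + e * h) * (2 * (f b - f a - f' a * (b - a)))
      \<le> (1 + e * h) * (2 * (v b / c\<^sup>2 * (1 - exp (- (c * h)) * (1 + c * h))))"
    using e h by (intro mult_left_mono) auto
  have "v b * h\<^sup>2 \<le> (1 + e * h) * (2 * (f b - f a - f' a * (b - a)))"
  proof -
    define T where "T = 2 * (f b - f a - f' a * (b - a))"
    obtain \<phi> where \<phi>: "0 \<le> \<phi>" "\<phi> \<le> e * h" "v b * h\<^sup>2 \<le> (1 + \<phi>) * T"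
      using smooth[of a b] a b by (auto simp: a_def T_def)
    have "0 < v b * h\<^sup>2" using vb h by simp
    then have "0 < (1 + \<phi>) * T" using \<phi>(3) by linarith
    then have "0 < T" using \<phi>(1) by (simp add: zero_less_mult_iff)
    then have "(1 + \<phi>) * T \<le> (1 + e * h) * T" using \<phi>(2) by (intro mult_right_mono) auto
    then show ?thesis using \<phi>(3) unfolding T_def by linarith
  qed
  also note le
  finally have "v b * h\<^sup>2
      \<le> (1 + e * h) * (2 * (v b / c\<^sup>2 * (1 - exp (- (c * h)) * (1 + c * h))))"
    .
  also have "\<dots> = v b / c\<^sup>2 * ((1 + c * h / 2) * (2 * (1 - exp (- (c * h)) * (1 + c * h))))"
  proof -
    have "1 + e * h = 1 + c * h / 2" by (simp add: c_def)
    moreover have "x * (2 * (y * z)) = y * (x * (2 * z))" for x y z :: real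
      by (simp add: mult_ac)
    ultimately show ?thesis by (simp only:)
  qed
  also have "\<dots> < v b / c\<^sup>2 * (c * h)\<^sup>2"
    using vb c h by (intro mult_strict_left_mono exp_remainder_small) auto
  also have "\<dots> = v b * h\<^sup>2"
    using c by (simp add: power_mult_distrib)
  finally show False by simp
qed

text \<open>
  Adding \<open>\<epsilon> u\<^sup>2 / 2\<close> to \<open>f\<close> preserves the hypotheses and makes \<open>v 1\<close> positive.
\<close>

lemma second_derivative_comparable:
  fixes f f' v :: "real \<Rightarrow> real"
  assumes f: "\<And>u. (f has_real_derivative f' u) (at u)"
    and f': "\<And>u. (f' has_real_derivative v u) (at u)"
    and cont: "continuous_on {0..1} v" and e: "0 < e"
    and smooth: "\<And>a b. 0 \<le> a \<Longrightarrow> a < b \<Longrightarrow> b \<le> 1 \<Longrightarrow>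
        \<exists>\<phi>\<ge>0. \<phi> \<le> e * (b - a) \<and>
          v b * (b - a)\<^sup>2 \<le> (1 + \<phi>) * (2 * (f b - f a - f' a * (b - a)))"
    and v1: "0 \<le> v 1" and u: "0 \<le> u" "u \<le> 1"
  shows "v 1 * exp (- (2 * e * (1 - u))) \<le> v u"
proof (rule field_le_epsilon)
  fix \<epsilon> :: real assume eps: "0 < \<epsilon>"
  have "(v 1 + \<epsilon>) * exp (- (2 * e * (1 - u))) \<le> v u + \<epsilon>"
  proof (rule second_derivative_comparable_pos[where f = "\<lambda>s. f s + \<epsilon> * s\<^sup>2 / 2"
        and f' = "\<lambda>s. f' s + \<epsilon> * s" and v = "\<lambda>s. v s + \<epsilon>"])
    show "((\<lambda>s. f s + \<epsilon> * s\<^sup>2 / 2) has_real_derivative f' s + \<epsilon> * s) (at s)" for s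
      by (auto intro!: derivative_eq_intros f)
    show "((\<lambda>s. f' s + \<epsilon> * s) has_real_derivative v s + \<epsilon>) (at s)" for s
      by (auto intro!: derivative_eq_intros f')
    show "continuous_on {0..1} (\<lambda>s. v s + \<epsilon>)"
      by (intro continuous_intros cont)
    fix a b :: real assume ab: "0 \<le> a" "a < b" "b \<le> 1"
    obtain \<phi> where \<phi>: "0 \<le> \<phi>" "\<phi> \<le> e * (b - a)"
      "v b * (b - a)\<^sup>2 \<le> (1 + \<phi>) * (2 * (f b - f a - f' a * (b - a)))"
      using smooth[OF ab] by blast
    have "\<epsilon> * (b - a)\<^sup>2 \<le> (1 + \<phi>) * (\<epsilon> * (b - a)\<^sup>2)"
      using mult_right_mono[of 1 "1 + \<phi>" "\<epsilon> * (b - a)\<^sup>2"] eps \<phi>(1) by simp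
    moreover have "2 * ((f b + \<epsilon> * b\<^sup>2 / 2) - (f a + \<epsilon> * a\<^sup>2 / 2) - (f' a + \<epsilon> * a) * (b - a))
        = 2 * (f b - f a - f' a * (b - a)) + \<epsilon> * (b - a)\<^sup>2"
      by (simp add: algebra_simps power2_eq_square)
    ultimately have "(v b + \<epsilon>) * (b - a)\<^sup>2 \<le> (1 + \<phi>) *
        (2 * ((f b + \<epsilon> * b\<^sup>2 / 2) - (f a + \<epsilon> * a\<^sup>2 / 2) - (f' a + \<epsilon> * a) * (b - a)))"
      using \<phi>(3) by (simp only: distrib_left distrib_right[of "v b"])
    with \<phi>(1,2) show "\<exists>\<phi>\<ge>0. \<phi> \<le> e * (b - a) \<and> (v b + \<epsilon>) * (b - a)\<^sup>2 \<le> (1 + \<phi>) *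
        (2 * ((f b + \<epsilon> * b\<^sup>2 / 2) - (f a + \<epsilon> * a\<^sup>2 / 2) - (f' a + \<epsilon> * a) * (b - a)))"
      by blast
  qed (use e eps v1 u in auto)
  moreover have "v 1 * exp (- (2 * e * (1 - u))) \<le> (v 1 + \<epsilon>) * exp (- (2 * e * (1 - u)))"
    using eps by (intro mult_right_mono) auto
  ultimately show "v 1 * exp (- (2 * e * (1 - u))) \<le> v u + \<epsilon>" by linarith
qed

text \<open>
  A Newton step at \<open>1\<close> sees the curvature \<open>v 1\<close>, whereas the difference of the values sees \<open>v\<close> on the whole
  segment, which is at least \<open>(1 - 2 e) v 1\<close> by the comparison above.
\<close>

lemma newton_step_gain:
  fixes f f' v :: "real \<Rightarrow> real"
  assumes f: "\<And>u. (f has_real_derivative f' u) (at u)"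
    and f': "\<And>u. (f' has_real_derivative v u) (at u)"
    and cont: "continuous_on {0..1} v" and e: "0 < e"
    and smooth: "\<And>a b. 0 \<le> a \<Longrightarrow> a < b \<Longrightarrow> b \<le> 1 \<Longrightarrow>
        \<exists>\<phi>\<ge>0. \<phi> \<le> e * (b - a) \<and>
          v b * (b - a)\<^sup>2 \<le> (1 + \<phi>) * (2 * (f b - f a - f' a * (b - a)))"
    and v1: "0 \<le> v 1"
  shows "v 1 - 2 * f' 1 \<le> 2 * (f 0 - f 1) + 2 * e * v 1"
proof -
  define m where "m = v 1 * (1 - 2 * e)"
  have vm: "m \<le> v u" if u: "0 \<le> u" "u \<le> 1" for u
  proof -
    have "1 - 2 * e \<le> 1 - 2 * e * (1 - u)"
      using e u by (simp add: algebra_simps)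
    also have "\<dots> \<le> exp (- (2 * e * (1 - u)))"
      using exp_ge_add_one_self[of "- (2 * e * (1 - u))"] by simp
    finally have "m \<le> v 1 * exp (- (2 * e * (1 - u)))"
      unfolding m_def using v1 by (intro mult_left_mono)
    then show ?thesis
      using second_derivative_comparable[OF f f' cont e smooth v1 u] by simp
  qed
  have "(f 1 - m * 1\<^sup>2 / 2) - (f' 1 - m * 1) * (1 - 0) \<le> f 0 - m * 0\<^sup>2 / 2"
    by (rule taylor_lower_bound(2)[where D = "\<lambda>s. f s - m * s\<^sup>2 / 2" and D' = "\<lambda>s. f' s - m * s"
          and D'' = "\<lambda>s. v s - m"])
      (use vm in \<open>auto intro!: derivative_eq_intros f f'\<close>)
  then show ?thesis by (simp add: m_def field_simps)
qed

section \<open>Smooth losses near the true parameter\<close>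

text \<open>
  The assumptions on one realisation of the data. The analysis of the algorithm is deterministic and
  takes place in this locale and its extensions.
\<close>

locale smooth_losses =
  fixes p :: nat and l :: "nat \<Rightarrow> rvec \<Rightarrow> real" and \<theta>s :: rvec and r L1 L2 L3 :: real
    and B :: "rvec set"
  defines "B \<equiv> {\<theta> \<in> carrier_vec p. vnorm (\<theta> - \<theta>s) \<le> r}"
  assumes p: "0 < p" and thetas: "\<theta>s \<in> carrier_vec p" and r: "0 < r"
    and L1: "0 < L1" and L2: "0 < L2" and L3: "0 < L3"
    and twice: "\<And>t. 1 \<le> t \<Longrightarrow> twice_differentiable p (l t)"
    and smooth: "\<And>t \<theta> \<theta>'. 1 \<le> t \<Longrightarrow> \<theta> \<in> B \<Longrightarrow> \<theta>' \<in> B \<Longrightarrow>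
      \<exists>\<phi>\<ge>0. \<phi> \<le> L1 * vnorm (\<theta> - \<theta>') \<and>
        (\<exists>u\<in>{0..1}. let \<eta> = \<theta>' + u \<cdot>\<^sub>v (\<theta> - \<theta>') in
           hessian p (l t) \<theta> \<preceq> (1 + \<phi>) \<cdot>\<^sub>m hessian p (l t) \<eta> \<and>
           l t \<theta> = l t \<theta>' + gradient p (l t) \<theta>' \<bullet> (\<theta> - \<theta>') +
             1 / 2 * mat_inner (hessian p (l t) \<eta>) (outer (\<theta> - \<theta>')))"
    and hess_bound: "\<And>t \<theta>. 1 \<le> t \<Longrightarrow> \<theta> \<in> B \<Longrightarrow> op_norm (hessian p (l t) \<theta>) \<le> L2"
    and hess_lipschitz: "\<And>t \<theta> \<theta>'. 1 \<le> t \<Longrightarrow> \<theta> \<in> B \<Longrightarrow> \<theta>' \<in> B \<Longrightarrow>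
      op_norm (hessian p (l t) \<theta> - hessian p (l t) \<theta>') \<le> L3 * vnorm (\<theta> - \<theta>')"
    and F_psd: "\<And>t \<theta>. 1 \<le> t \<Longrightarrow> \<theta> \<in> B \<Longrightarrow> psd (mat_sum p (\<lambda>s. hessian p (l s) \<theta>) {1..t})"
begin

abbreviation grad where "grad t \<equiv> gradient p (l t)"
abbreviation hess where "hess t \<equiv> hessian p (l t)"

lemma B_carrier: "\<theta> \<in> B \<Longrightarrow> \<theta> \<in> carrier_vec p"
  by (simp add: B_def)

lemma thetas_in_B: "\<theta>s \<in> B"
proof -
  have "\<theta>s - \<theta>s = 0\<^sub>v p" using thetas by (intro eq_vecI) auto
  then show ?thesis using thetas r by (simp add: B_def)
qed

lemma grad_carrier: "1 \<le> t \<Longrightarrow> \<theta> \<in> carrier_vec p \<Longrightarrow> grad t \<theta> \<in> carrier_vec p"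
  by (rule gradient_carrier[OF twice])

lemma hess_carrier: "1 \<le> t \<Longrightarrow> \<theta> \<in> carrier_vec p \<Longrightarrow> hess t \<theta> \<in> carrier_mat p p"
  by (rule hessian_carrier[OF twice])

lemma segment_in_B:
  assumes "\<theta> \<in> B" "\<theta>' \<in> B" "0 \<le> u" "u \<le> 1"
  shows "\<theta> + u \<cdot>\<^sub>v (\<theta>' - \<theta>) \<in> B"
proof -
  have c: "\<theta> \<in> carrier_vec p" "\<theta>' \<in> carrier_vec p" using assms by (auto simp: B_def)
  have "\<theta> + u \<cdot>\<^sub>v (\<theta>' - \<theta>) - \<theta>s = (1 - u) \<cdot>\<^sub>v (\<theta> - \<theta>s) + u \<cdot>\<^sub>v (\<theta>' - \<theta>s)"
    using c thetas by (intro eq_vecI) (auto simp: algebra_simps)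
  then have "vnorm (\<theta> + u \<cdot>\<^sub>v (\<theta>' - \<theta>) - \<theta>s) \<le> (1 - u) * vnorm (\<theta> - \<theta>s) + u * vnorm (\<theta>' - \<theta>s)"
    using vnorm_triangle[of "(1 - u) \<cdot>\<^sub>v (\<theta> - \<theta>s)" p "u \<cdot>\<^sub>v (\<theta>' - \<theta>s)"] c thetas assms by simp
  also have "\<dots> \<le> (1 - u) * r + u * r"
    using assms by (intro add_mono mult_left_mono) (auto simp: B_def)
  finally show ?thesis using c by (simp add: B_def algebra_simps)
qed

text \<open>A Hessian is the difference of two consecutive cumulative ones, and those are symmetric.\<close>

lemma hess_symmetric:
  assumes t: "1 \<le> t" and th: "\<theta> \<in> B"
  shows "transpose_mat (hess t \<theta>) = hess t \<theta>"
proof (rule eq_matI)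
  have H: "hess t \<theta> \<in> carrier_mat p p" using hess_carrier[OF t] B_carrier[OF th] by simp
  have sym: "(\<Sum>s=1..n. hess s \<theta> $$ (i, j)) = (\<Sum>s=1..n. hess s \<theta> $$ (j, i))"
    if ij: "i < p" "j < p" for i j n
  proof (cases "n = 0")
    case False
    then have "transpose_mat (mat_sum p (\<lambda>s. hess s \<theta>) {1..n}) $$ (i, j)
        = mat_sum p (\<lambda>s. hess s \<theta>) {1..n} $$ (i, j)"
      using F_psd[OF _ th, of n] by (simp add: psd_def)
    then show ?thesis using ij by (simp add: mat_sum_def)
  qed simp
  fix i j assume "i < dim_row (hess t \<theta>)" "j < dim_col (hess t \<theta>)"
  then have ij: "i < p" "j < p" using H by auto
  have "hess t \<theta> $$ (j, i) = hess t \<theta> $$ (i, j)"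
    using sym[OF ij, of t] sym[OF ij, of "t - 1"] t by (cases t) auto
  then show "transpose_mat (hess t \<theta>) $$ (i, j) = hess t \<theta> $$ (i, j)" using ij H by simp
qed (use hess_carrier[OF t B_carrier[OF th]] in auto)

lemma hess_le:
  assumes "1 \<le> t" "\<theta> \<in> B" "v \<in> carrier_vec p" "w \<in> carrier_vec p"
  shows "\<bar>w \<bullet> (hess t \<theta> *\<^sub>v v)\<bar> \<le> L2 * vnorm v * vnorm w"
proof -
  have "\<bar>w \<bullet> (hess t \<theta> *\<^sub>v v)\<bar> \<le> op_norm (hess t \<theta>) * vnorm v * vnorm w"
    using assms B_carrier hess_carrier by (intro bilinear_le_op_norm) auto
  also have "\<dots> \<le> L2 * vnorm v * vnorm w"
    using hess_bound[OF assms(1,2)] by (intro mult_right_mono) auto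
  finally show ?thesis .
qed

lemma hess_diff_le:
  assumes "1 \<le> t" "\<theta> \<in> B" "\<theta>' \<in> B" "v \<in> carrier_vec p" "w \<in> carrier_vec p"
  shows "\<bar>w \<bullet> (hess t \<theta> *\<^sub>v v) - w \<bullet> (hess t \<theta>' *\<^sub>v v)\<bar> \<le> L3 * vnorm (\<theta> - \<theta>') * vnorm v * vnorm w"
proof -
  have c: "hess t \<theta> \<in> carrier_mat p p" "hess t \<theta>' \<in> carrier_mat p p"
    using assms B_carrier hess_carrier by auto
  have "w \<bullet> (hess t \<theta> *\<^sub>v v) - w \<bullet> (hess t \<theta>' *\<^sub>v v) = w \<bullet> ((hess t \<theta> - hess t \<theta>') *\<^sub>v v)"
    using c assms by (simp add: minus_mult_distrib_mat_vec[of _ p p] scalar_prod_minus_distrib[of _ p])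
  also have "\<bar>\<dots>\<bar> \<le> op_norm (hess t \<theta> - hess t \<theta>') * vnorm v * vnorm w"
    using c assms by (intro bilinear_le_op_norm) (auto intro: minus_carrier_mat)
  also have "\<dots> \<le> L3 * vnorm (\<theta> - \<theta>') * vnorm v * vnorm w"
    using hess_lipschitz[OF assms(1,2,3)] by (intro mult_right_mono) auto
  finally show ?thesis by simp
qed

lemma grad_lipschitz:
  assumes t: "1 \<le> t" and th: "\<theta> \<in> B" "\<theta>' \<in> B" and w: "w \<in> carrier_vec p"
  shows "\<bar>w \<bullet> grad t \<theta>' - w \<bullet> grad t \<theta>\<bar> \<le> L2 * vnorm (\<theta>' - \<theta>) * vnorm w"
proof -
  have c: "\<theta> \<in> carrier_vec p" "\<theta>' - \<theta> \<in> carrier_vec p" and eq: "\<theta> + (\<theta>' - \<theta>) = \<theta>'"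
    using B_carrier[OF th(1)] B_carrier[OF th(2)] by (auto intro!: eq_vecI)
  obtain u where u: "0 < u" "u < 1"
    "w \<bullet> grad t (\<theta> + (\<theta>' - \<theta>)) - w \<bullet> grad t \<theta> = w \<bullet> (hess t (\<theta> + u \<cdot>\<^sub>v (\<theta>' - \<theta>)) *\<^sub>v (\<theta>' - \<theta>))"
    using gradient_mean_value[OF twice[OF t] c w] by blast
  then show ?thesis
    using hess_le[OF t segment_in_B[OF th, of u] c(2) w] by (simp add: eq)
qed

lemma grad_taylor:
  assumes t: "1 \<le> t" and th: "\<theta> \<in> B" "\<theta>' \<in> B" and w: "w \<in> carrier_vec p"
  shows "\<bar>w \<bullet> grad t \<theta>' - w \<bullet> grad t \<theta> - w \<bullet> (hess t \<theta> *\<^sub>v (\<theta>' - \<theta>))\<bar>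
    \<le> L3 * (vnorm (\<theta>' - \<theta>))\<^sup>2 * vnorm w"
proof -
  have c: "\<theta> \<in> carrier_vec p" "\<theta>' - \<theta> \<in> carrier_vec p" and eq: "\<theta> + (\<theta>' - \<theta>) = \<theta>'"
    using B_carrier[OF th(1)] B_carrier[OF th(2)] by (auto intro!: eq_vecI)
  obtain u where u: "0 < u" "u < 1"
    "w \<bullet> grad t (\<theta> + (\<theta>' - \<theta>)) - w \<bullet> grad t \<theta> = w \<bullet> (hess t (\<theta> + u \<cdot>\<^sub>v (\<theta>' - \<theta>)) *\<^sub>v (\<theta>' - \<theta>))"
    using gradient_mean_value[OF twice[OF t] c w] by blast
  have diff: "\<theta> + u \<cdot>\<^sub>v (\<theta>' - \<theta>) - \<theta> = u \<cdot>\<^sub>v (\<theta>' - \<theta>)"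
    using c by (intro eq_vecI) auto
  have "\<bar>w \<bullet> grad t \<theta>' - w \<bullet> grad t \<theta> - w \<bullet> (hess t \<theta> *\<^sub>v (\<theta>' - \<theta>))\<bar>
      \<le> L3 * vnorm (u \<cdot>\<^sub>v (\<theta>' - \<theta>)) * vnorm (\<theta>' - \<theta>) * vnorm w"
    using hess_diff_le[OF t segment_in_B[OF th, of u] th(1) c(2) w] u by (simp add: eq diff)
  also have "\<dots> \<le> L3 * vnorm (\<theta>' - \<theta>) * vnorm (\<theta>' - \<theta>) * vnorm w"
    using u L3 by (intro mult_right_mono mult_left_mono) (auto intro: mult_left_le_one_le)
  finally show ?thesis by (simp add: power2_eq_square mult_ac)
qed

text \<open>
  The smoothness condition compares Hessians only through a second-order average, which
  \<open>newton_step_gain\<close> turns into a bound on the linearisation error of a Newton step.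
\<close>

lemma step_gain:
  assumes t: "1 \<le> t" and th: "\<theta> \<in> B" and pos: "0 \<le> (\<theta> - \<theta>s) \<bullet> (hess t \<theta> *\<^sub>v (\<theta> - \<theta>s))"
  shows "(\<theta> - \<theta>s) \<bullet> (hess t \<theta> *\<^sub>v (\<theta> - \<theta>s)) - 2 * ((\<theta> - \<theta>s) \<bullet> grad t \<theta>)
    \<le> 2 * (l t \<theta>s - l t \<theta>) + 2 * L1 * L2 * vnorm (\<theta> - \<theta>s) ^ 3"
proof -
  define d where "d = \<theta> - \<theta>s"
  have cth: "\<theta> \<in> carrier_vec p" and d: "d \<in> carrier_vec p"
    using th B_carrier thetas by (auto simp: d_def)
  have one: "\<theta>s + 1 \<cdot>\<^sub>v d = \<theta>" and zero: "\<theta>s + 0 \<cdot>\<^sub>v d = \<theta>s"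
    using cth thetas by (auto simp: d_def intro!: eq_vecI)
  show ?thesis
  proof (cases "vnorm d = 0")
    case True
    then have d0: "d = 0\<^sub>v p" using vnorm_eq_0_iff[OF d] by simp
    have "\<theta>s + 1 \<cdot>\<^sub>v 0\<^sub>v p = \<theta>s" using thetas by (intro eq_vecI) auto
    then have "\<theta> = \<theta>s" using one d0 by simp
    moreover have "hess t \<theta> *\<^sub>v 0\<^sub>v p \<in> carrier_vec p" "grad t \<theta> \<in> carrier_vec p"
      using hess_carrier[OF t cth] grad_carrier[OF t cth] by auto
    ultimately show ?thesis unfolding d_def[symmetric] d0 by simp
  next
    case False
    let ?pt = "\<lambda>u. \<theta>s + u \<cdot>\<^sub>v d"
    define f where "f u = l t (?pt u)" for u
    define f' where "f' u = d \<bullet> grad t (?pt u)" for u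
    define v where "v u = d \<bullet> (hess t (?pt u) *\<^sub>v d)" for u
    define e where "e = L1 * vnorm d"
    have e: "0 < e" using False L1 vnorm_nonneg[of d] by (simp add: e_def del: vnorm_nonneg)
    have ptB: "?pt u \<in> B" if "0 \<le> u" "u \<le> 1" for u
      using segment_in_B[OF thetas_in_B th that] by (simp add: d_def)
    have ptc: "?pt u \<in> carrier_vec p" for u using thetas d by simp
    have f: "(f has_real_derivative f' u) (at u)" for u
      unfolding f_def[abs_def] f'_def
      using loss_line_derivative[OF twice[OF t] thetas d, of u] grad_carrier[OF t ptc[of u]] d
      by (simp add: comm_scalar_prod[of d p])
    have f': "(f' has_real_derivative v u) (at u)" for u
      unfolding f'_def[abs_def] v_def by (rule gradient_line_derivative[OF twice[OF t] thetas d d])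
    have ptdiff: "?pt b - ?pt a = (b - a) \<cdot>\<^sub>v d" for a b
      using thetas d by (intro eq_vecI) (auto simp: algebra_simps)
    have cont: "continuous_on {0..1} v"
    proof (rule lipschitz_on_continuous_on[OF lipschitz_onI])
      fix a b :: real assume ab: "a \<in> {0..1}" "b \<in> {0..1}"
      have "\<bar>v a - v b\<bar> \<le> L3 * vnorm (?pt a - ?pt b) * vnorm d * vnorm d"
        unfolding v_def using ab by (intro hess_diff_le t ptB d) auto
      then show "dist (v a) (v b) \<le> (L3 * vnorm d ^ 3) * dist a b"
        by (simp add: dist_real_def ptdiff power3_eq_cube mult_ac)
    next
      show "0 \<le> L3 * vnorm d ^ 3" using L3 by simp
    qed
    have sm: "\<exists>\<phi>\<ge>0. \<phi> \<le> e * (b - a) \<and>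
        v b * (b - a)\<^sup>2 \<le> (1 + \<phi>) * (2 * (f b - f a - f' a * (b - a)))"
      if ab: "0 \<le> a" "a < b" "b \<le> 1" for a b
    proof -
      obtain \<phi> u where phi: "0 \<le> \<phi>" "\<phi> \<le> L1 * vnorm (?pt b - ?pt a)" and u: "0 \<le> u" "u \<le> 1"
        and le: "hess t (?pt b) \<preceq> (1 + \<phi>) \<cdot>\<^sub>m hess t (?pt a + u \<cdot>\<^sub>v (?pt b - ?pt a))"
        and eq: "l t (?pt b) = l t (?pt a) + grad t (?pt a) \<bullet> (?pt b - ?pt a) +
           1 / 2 * mat_inner (hess t (?pt a + u \<cdot>\<^sub>v (?pt b - ?pt a))) (outer (?pt b - ?pt a))"
        using smooth[OF t ptB ptB, of b a] ab unfolding Let_def by auto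
      define \<eta> where "\<eta> = ?pt a + u \<cdot>\<^sub>v (?pt b - ?pt a)"
      have \<eta>: "\<eta> \<in> B" unfolding \<eta>_def using ab u by (intro segment_in_B ptB) auto
      have H: "hess t \<eta> \<in> carrier_mat p p" "hess t (?pt b) \<in> carrier_mat p p"
        using hess_carrier[OF t] B_carrier[OF \<eta>] ptc by auto
      define Q where "Q = d \<bullet> (hess t \<eta> *\<^sub>v d)"
      have c': "(b - a) \<cdot>\<^sub>v d \<in> carrier_vec p" using d by simp
      have Hd: "hess t \<eta> *\<^sub>v d \<in> carrier_vec p" "hess t (?pt b) *\<^sub>v d \<in> carrier_vec p" using H d by auto
      have "mat_inner (hess t \<eta>) (outer (?pt b - ?pt a)) = (b - a)\<^sup>2 * Q"
        unfolding ptdiff mat_inner_outer[OF H(1) c'] Q_def using H d Hd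
        by (simp add: mult_mat_vec[of _ p p] power2_eq_square)
      moreover have "grad t (?pt a) \<bullet> (?pt b - ?pt a) = f' a * (b - a)"
        unfolding ptdiff f'_def using grad_carrier[OF t ptc[of a]] d
        by (simp add: comm_scalar_prod[of d p] mult.commute)
      ultimately have Q: "2 * (f b - f a - f' a * (b - a)) = (b - a)\<^sup>2 * Q"
        using eq unfolding \<eta>_def[symmetric] f_def by simp
      have "0 \<le> d \<bullet> (((1 + \<phi>) \<cdot>\<^sub>m hess t \<eta> - hess t (?pt b)) *\<^sub>v d)"
        using le d H unfolding \<eta>_def[symmetric] loewner_le_def psd_def by auto
      also have "\<dots> = (1 + \<phi>) * Q - v b"
        using H d Hd unfolding Q_def v_def
        by (subst minus_mult_distrib_mat_vec[of _ p p])
          (auto simp: smult_mat_mult_vec[of _ p p] scalar_prod_minus_distrib[of _ p])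
      finally have vQ: "v b \<le> (1 + \<phi>) * Q" by simp
      have phi': "\<phi> \<le> e * (b - a)"
        using phi ab by (simp add: ptdiff e_def mult_ac)
      have "v b * (b - a)\<^sup>2 \<le> ((1 + \<phi>) * Q) * (b - a)\<^sup>2"
        using vQ by (intro mult_right_mono) auto
      also have "\<dots> = (1 + \<phi>) * ((b - a)\<^sup>2 * Q)" by simp
      finally show ?thesis
        unfolding Q using phi(1) phi' by blast
    qed
    have v1: "0 \<le> v 1" using pos unfolding v_def one by (simp add: d_def)
    have "v 1 - 2 * f' 1 \<le> 2 * (f 0 - f 1) + 2 * e * v 1"
      by (rule newton_step_gain[OF f f' cont e sm v1])
    moreover have "v 1 \<le> L2 * vnorm d * vnorm d"
      using hess_le[OF t th d d] unfolding v_def one by simp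
    then have "2 * e * v 1 \<le> 2 * e * (L2 * vnorm d * vnorm d)"
      using e by (intro mult_left_mono) auto
    ultimately have "v 1 - 2 * f' 1 \<le> 2 * (f 0 - f 1) + 2 * e * (L2 * vnorm d * vnorm d)"
      by linarith
    then show ?thesis
      unfolding v_def f'_def f_def one zero d_def[symmetric] e_def
      by (simp add: power3_eq_cube mult_ac)
  qed
qed

end

section \<open>The online Newton recursion and its energy\<close>

text \<open>The factorisation \<open>A = R R\<close> reduces this to the Cauchy-Schwarz inequality for vectors.\<close>

lemma psd_bilinear_le:
  assumes A: "psd A" "A \<in> carrier_mat p p" and le: "\<And>v. v \<in> carrier_vec p \<Longrightarrow> v \<bullet> (A *\<^sub>v v) \<le> c * (v \<bullet> v)"
    and c: "0 \<le> c" and v: "v \<in> carrier_vec p" and w: "w \<in> carrier_vec p"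
  shows "\<bar>w \<bullet> (A *\<^sub>v v)\<bar> \<le> c * vnorm v * vnorm w"
proof -
  obtain R where R: "psd R" "R * R = A" using psd_sqrt_exists[OF A(1)] by blast
  have car: "R \<in> carrier_mat p p"
    using R A unfolding psd_def by (metis carrier_matD(1) index_mult_mat(2))
  have norm: "vnorm (R *\<^sub>v x) \<le> sqrt c * vnorm x" if x: "x \<in> carrier_vec p" for x
  proof -
    have Rx: "R *\<^sub>v x \<in> carrier_vec p" using car x by auto
    have "(vnorm (R *\<^sub>v x))\<^sup>2 = x \<bullet> (R *\<^sub>v (R *\<^sub>v x))"
      unfolding vnorm_sq by (rule bilinear_symmetric[OF car _ x Rx]) (use R in \<open>simp add: psd_def\<close>)
    also have "R *\<^sub>v (R *\<^sub>v x) = A *\<^sub>v x"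
      using assoc_mult_mat_vec[OF car car x] R by simp
    also have "x \<bullet> (A *\<^sub>v x) \<le> c * (x \<bullet> x)" by (rule le[OF x])
    also have "\<dots> = (sqrt c * vnorm x)\<^sup>2"
      using c by (simp add: power_mult_distrib vnorm_sq)
    finally show ?thesis by (rule power2_le_imp_le) (use c in simp)
  qed
  have Rv: "R *\<^sub>v v \<in> carrier_vec p" using car v by auto
  have "w \<bullet> (A *\<^sub>v v) = w \<bullet> (R *\<^sub>v (R *\<^sub>v v))"
    using assoc_mult_mat_vec[OF car car v] R by simp
  also have "\<bar>\<dots>\<bar> \<le> vnorm w * vnorm (R *\<^sub>v (R *\<^sub>v v))"
    using car Rv w by (intro scalar_prod_le_vnorm) auto
  also have "\<dots> \<le> vnorm w * (sqrt c * (sqrt c * vnorm v))"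
    using norm[OF Rv] mult_left_mono[OF norm[OF v], of "sqrt c"] c
    by (intro mult_left_mono) auto
  also have "\<dots> = c * vnorm v * vnorm w"
  proof -
    have "vnorm w * (sqrt c * (sqrt c * vnorm v)) = (sqrt c * sqrt c) * vnorm v * vnorm w"
      by (simp only: mult_ac)
    then show ?thesis using c by simp
  qed
  finally show ?thesis .
qed

text \<open>
  The sequences \<open>\<theta>\<close> and \<open>\<Omega>\<close> matter from the phase transition time \<open>t0\<close> on; in the application \<open>\<theta> t0\<close> is the
  maximum a posteriori estimator. That the later iterates stay in the ball is the conclusion of
  \<open>localisation\<close>.
\<close>

locale newton_run = smooth_losses +
  fixes t0 :: nat and K2 lu :: real and \<Omega>0 :: rmat and \<theta>0 :: rvec
    and \<theta> :: "nat \<Rightarrow> rvec" and \<Omega> :: "nat \<Rightarrow> rmat"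
  assumes K2: "0 < K2" and t0: "3 \<le> t0"
    and curvature: "\<And>t \<eta>. t0 \<le> t \<Longrightarrow> (\<And>s. s \<in> {1..t} \<Longrightarrow> \<eta> s \<in> B) \<Longrightarrow>
      K2 * real t \<le> lambda_min (mat_sum p (\<lambda>s. hess s (\<eta> s)) {1..t})"
    and Omega0: "\<Omega>0 \<in> carrier_mat p p" "transpose_mat \<Omega>0 = \<Omega>0"
    and Omega0_min: "0 < lambda_min \<Omega>0" and Omega0_max: "lambda_max \<Omega>0 \<le> lu" and lu: "0 < lu"
    and theta0: "\<theta>0 \<in> carrier_vec p"
    and start: "\<theta> t0 \<in> B" and Omega_start: "\<Omega> t0 = \<Omega>0 + mat_sum p (\<lambda>s. hess s (\<theta> t0)) {1..t0}"
    and Omega_step: "\<And>t. t0 \<le> t \<Longrightarrow> \<Omega> (Suc t) = \<Omega> t + hess (Suc t) (\<theta> t)"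
    and theta_step: "\<And>t. t0 \<le> t \<Longrightarrow>
      \<theta> (Suc t) = \<theta> t - minv (\<Omega> (Suc t)) *\<^sub>v grad (Suc t) (\<theta> t)"
    and hess_step: "\<And>t. t0 \<le> t \<Longrightarrow> psd (hess (Suc t) (\<theta> t))"
begin

definition stays where "stays t \<longleftrightarrow> (\<forall>s. t0 \<le> s \<and> s < t \<longrightarrow> \<theta> s \<in> B)"

text \<open>The point at which the Hessian of the loss at time \<open>s\<close> enters \<open>\<Omega>\<close>.\<close>

definition knot where "knot s = (if s \<le> t0 then \<theta> t0 else \<theta> (s - 1))"

lemma stays_Suc: "t0 \<le> t \<Longrightarrow> stays (Suc t) \<longleftrightarrow> stays t \<and> \<theta> t \<in> B"
  by (auto simp: stays_def less_Suc_eq)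

lemma knot_in_B: "stays t \<Longrightarrow> s \<le> t \<Longrightarrow> knot s \<in> B"
  using start unfolding knot_def stays_def
  by (cases "s \<le> t0"; cases s) auto

lemma Omega0_form:
  assumes v: "v \<in> carrier_vec p"
  shows "0 \<le> v \<bullet> (\<Omega>0 *\<^sub>v v)" "v \<bullet> (\<Omega>0 *\<^sub>v v) \<le> lu * (v \<bullet> v)"
proof -
  have vv: "0 \<le> v \<bullet> v" by (simp flip: vnorm_sq)
  show "0 \<le> v \<bullet> (\<Omega>0 *\<^sub>v v)"
    using rayleigh_bounds(1)[OF Omega0 v] mult_nonneg_nonneg[OF _ vv, of "lambda_min \<Omega>0"] Omega0_min
    by linarith
  show "v \<bullet> (\<Omega>0 *\<^sub>v v) \<le> lu * (v \<bullet> v)"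
    using rayleigh_bounds(2)[OF Omega0 v] mult_right_mono[OF Omega0_max vv] by linarith
qed

lemma Omega0_bilinear_le:
  assumes "v \<in> carrier_vec p" "w \<in> carrier_vec p"
  shows "\<bar>w \<bullet> (\<Omega>0 *\<^sub>v v)\<bar> \<le> lu * vnorm v * vnorm w"
proof (rule psd_bilinear_le[OF _ Omega0(1) Omega0_form(2) _ assms])
  show "psd \<Omega>0"
    unfolding psd_def using Omega0 Omega0_form(1) by auto
qed (use lu in auto)

lemma Omega_carrier_sym:
  assumes "t0 \<le> t" "stays t"
  shows "\<Omega> t \<in> carrier_mat p p" "transpose_mat (\<Omega> t) = \<Omega> t"
proof -
  have "stays t \<longrightarrow> \<Omega> t \<in> carrier_mat p p \<and> transpose_mat (\<Omega> t) = \<Omega> t"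
    using assms(1)
  proof (induction t rule: dec_induct)
    case base
    have "transpose_mat (mat_sum p (\<lambda>s. hess s (\<theta> t0)) {1..t0}) = mat_sum p (\<lambda>s. hess s (\<theta> t0)) {1..t0}"
      using F_psd[OF _ start, of t0] t0 by (simp add: psd_def)
    then show ?case
      using Omega0 transpose_add[OF Omega0(1) mat_sum_carrier]
      by (simp add: Omega_start)
  next
    case (step t)
    show ?case
    proof
      assume "stays (Suc t)"
      then have IH: "\<Omega> t \<in> carrier_mat p p" "transpose_mat (\<Omega> t) = \<Omega> t" and th: "\<theta> t \<in> B"
        using step stays_Suc by auto
      have H: "hess (Suc t) (\<theta> t) \<in> carrier_mat p p"
        "transpose_mat (hess (Suc t) (\<theta> t)) = hess (Suc t) (\<theta> t)"
        using hess_carrier[OF _ B_carrier[OF th]] hess_symmetric[OF _ th] by auto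
      show "\<Omega> (Suc t) \<in> carrier_mat p p \<and> transpose_mat (\<Omega> (Suc t)) = \<Omega> (Suc t)"
        unfolding Omega_step[OF step(1)] using IH H transpose_add[OF IH(1) H(1)] by auto
    qed
  qed
  with assms show "\<Omega> t \<in> carrier_mat p p" "transpose_mat (\<Omega> t) = \<Omega> t" by auto
qed

lemma Omega_step_bilinear:
  assumes t: "t0 \<le> t" and st: "stays (Suc t)" and v: "v \<in> carrier_vec p" and w: "w \<in> carrier_vec p"
  shows "w \<bullet> (\<Omega> (Suc t) *\<^sub>v v) = w \<bullet> (\<Omega> t *\<^sub>v v) + w \<bullet> (hess (Suc t) (\<theta> t) *\<^sub>v v)"
proof -
  have th: "\<theta> t \<in> B" "stays t" using st stays_Suc[OF t] by auto
  have c: "\<Omega> t \<in> carrier_mat p p" "hess (Suc t) (\<theta> t) \<in> carrier_mat p p"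
    using Omega_carrier_sym(1)[OF t th(2)] hess_carrier[OF _ B_carrier[OF th(1)]] by auto
  have "\<Omega> t *\<^sub>v v \<in> carrier_vec p" "hess (Suc t) (\<theta> t) *\<^sub>v v \<in> carrier_vec p"
    using c v by auto
  then show ?thesis
    unfolding Omega_step[OF t] using c v w
    by (simp add: add_mult_distrib_mat_vec[of _ p p] scalar_prod_add_distrib[of _ p])
qed

lemma Omega_bilinear:
  assumes t: "t0 \<le> t" and st: "stays t" and v: "v \<in> carrier_vec p" and w: "w \<in> carrier_vec p"
  shows "w \<bullet> (\<Omega> t *\<^sub>v v) = w \<bullet> (\<Omega>0 *\<^sub>v v) + (\<Sum>s=1..t. w \<bullet> (hess s (knot s) *\<^sub>v v))"
proof -
  have "stays t \<longrightarrow> ?thesis"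
    using t
  proof (induction t rule: dec_induct)
    case base
    have "w \<bullet> (\<Omega> t0 *\<^sub>v v) = w \<bullet> (\<Omega>0 *\<^sub>v v) + w \<bullet> (mat_sum p (\<lambda>s. hess s (\<theta> t0)) {1..t0} *\<^sub>v v)"
    proof -
      have "\<Omega>0 *\<^sub>v v \<in> carrier_vec p" "mat_sum p (\<lambda>s. hess s (\<theta> t0)) {1..t0} *\<^sub>v v \<in> carrier_vec p"
        using Omega0 v by (auto intro: mult_mat_vec_carrier[OF mat_sum_carrier])
      then show ?thesis
        unfolding Omega_start using Omega0 v w
        by (simp add: add_mult_distrib_mat_vec[of _ p p] scalar_prod_add_distrib[of _ p])
    qed
    also have "w \<bullet> (mat_sum p (\<lambda>s. hess s (\<theta> t0)) {1..t0} *\<^sub>v v) = (\<Sum>s=1..t0. w \<bullet> (hess s (\<theta> t0) *\<^sub>v v))"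
      using hess_carrier[OF _ B_carrier[OF start]] v w by (intro bilinear_mat_sum) auto
    also have "\<dots> = (\<Sum>s=1..t0. w \<bullet> (hess s (knot s) *\<^sub>v v))"
      by (intro sum.cong) (auto simp: knot_def)
    finally show ?case by simp
  next
    case (step t)
    show ?case
    proof
      assume st: "stays (Suc t)"
      have "knot (Suc t) = \<theta> t" using step(1) by (simp add: knot_def)
      then show "w \<bullet> (\<Omega> (Suc t) *\<^sub>v v) = w \<bullet> (\<Omega>0 *\<^sub>v v) + (\<Sum>s=1..Suc t. w \<bullet> (hess s (knot s) *\<^sub>v v))"
        using step st stays_Suc[OF step(1)] Omega_step_bilinear[OF step(1) st v w] by simp
    qed
  qed
  with st show ?thesis by simp
qed

lemma hess_sum_coercive:
  assumes t: "t0 \<le> t" and eta: "\<And>s. s \<in> {1..t} \<Longrightarrow> \<eta> s \<in> B" and v: "v \<in> carrier_vec p"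
  shows "K2 * real t * (v \<bullet> v) \<le> (\<Sum>s=1..t. v \<bullet> (hess s (\<eta> s) *\<^sub>v v))"
proof -
  let ?A = "mat_sum p (\<lambda>s. hess s (\<eta> s)) {1..t}"
  have car: "\<And>s. s \<in> {1..t} \<Longrightarrow> hess s (\<eta> s) \<in> carrier_mat p p"
    using hess_carrier B_carrier eta by auto
  have "transpose_mat ?A = ?A"
  proof (rule eq_matI)
    fix i j assume "i < dim_row ?A" "j < dim_col ?A"
    then have ij: "i < p" "j < p" by (auto simp: mat_sum_def)
    have "hess s (\<eta> s) $$ (j, i) = hess s (\<eta> s) $$ (i, j)" if s: "s \<in> {1..t}" for s
      using hess_symmetric[OF _ eta[OF s]] car[OF s] s ij by (metis atLeastAtMost_iff carrier_matD index_transpose_mat(1))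
    then show "transpose_mat ?A $$ (i, j) = ?A $$ (i, j)"
      using ij by (simp add: mat_sum_def)
  qed (auto simp: mat_sum_def)
  then have "lambda_min ?A * (v \<bullet> v) \<le> v \<bullet> (?A *\<^sub>v v)"
    by (rule rayleigh_bounds(1)[OF mat_sum_carrier _ v])
  moreover have "K2 * real t * (v \<bullet> v) \<le> lambda_min ?A * (v \<bullet> v)"
    using curvature[OF t eta] by (intro mult_right_mono) (auto simp flip: vnorm_sq)
  ultimately show ?thesis
    using bilinear_mat_sum[of "{1..t}" "\<lambda>s. hess s (\<eta> s)" p v v] car v by simp
qed

lemma Omega_coercive:
  assumes t: "t0 \<le> t" and st: "stays t" and v: "v \<in> carrier_vec p"
  shows "K2 * real t * (v \<bullet> v) \<le> v \<bullet> (\<Omega> t *\<^sub>v v)"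
  using Omega_bilinear[OF t st v v] hess_sum_coercive[OF t, of knot v] knot_in_B[OF st] Omega0_form(1)[OF v] v
  by auto

lemma K2t_pos: "t0 \<le> t \<Longrightarrow> 0 < K2 * real t"
  using K2 t0 by simp

lemma Omega_posdef:
  assumes t: "t0 \<le> t" and st: "stays t"
  shows "posdef p (\<Omega> t)"
  unfolding posdef_def
proof (intro conjI ballI impI Omega_carrier_sym[OF t st])
  fix v :: rvec assume v: "v \<in> carrier_vec p" "v \<noteq> 0\<^sub>v p"
  have "0 < v \<bullet> v" using vnorm_pos[OF v] by (simp flip: vnorm_sq)
  then show "0 < v \<bullet> (\<Omega> t *\<^sub>v v)"
    using Omega_coercive[OF t st v(1)] K2t_pos[OF t] mult_pos_pos[of "K2 * real t" "v \<bullet> v"] by linarith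
qed

lemma minv_Omega:
  assumes t: "t0 \<le> t" and st: "stays t" and v: "v \<in> carrier_vec p"
  shows "minv (\<Omega> t) *\<^sub>v v \<in> carrier_vec p" "\<Omega> t *\<^sub>v (minv (\<Omega> t) *\<^sub>v v) = v"
proof -
  note c = Omega_carrier_sym[OF t st]
  have det: "Determinant.det (\<Omega> t) \<noteq> 0"
    using gaussian_integral(1)[OF Omega_posdef[OF t st] thetas] by simp
  note I = minv_inverts[OF c(1) det]
  show "minv (\<Omega> t) *\<^sub>v v \<in> carrier_vec p" using I v by auto
  show "\<Omega> t *\<^sub>v (minv (\<Omega> t) *\<^sub>v v) = v"
    using assoc_mult_mat_vec[OF c(1) I(1) v] I v by simp
qed

lemma theta_carrier:
  assumes "t0 \<le> t" "stays t"
  shows "\<theta> t \<in> carrier_vec p"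
proof (cases "t = t0")
  case True
  then show ?thesis using B_carrier[OF start] by simp
next
  case False
  then obtain n where n: "t = Suc n" "t0 \<le> n" using assms by (cases t) auto
  then have th: "\<theta> n \<in> B" using assms stays_Suc by auto
  show ?thesis
    unfolding n theta_step[OF n(2)]
    using minv_Omega(1)[of "Suc n" "grad (Suc n) (\<theta> n)"] n assms grad_carrier[OF _ B_carrier[OF th]] B_carrier[OF th]
    by simp
qed

definition dev where "dev t = \<theta> t - \<theta>s"

text \<open>The potential of the regret analysis.\<close>

definition energy where "energy t = dev t \<bullet> (\<Omega> t *\<^sub>v dev t)"

lemma dev_carrier: "t0 \<le> t \<Longrightarrow> stays t \<Longrightarrow> dev t \<in> carrier_vec p"
  using theta_carrier thetas by (simp add: dev_def)

lemma dev_step: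
  assumes t: "t0 \<le> t" and st: "stays (Suc t)"
  shows "dev (Suc t) = dev t - minv (\<Omega> (Suc t)) *\<^sub>v grad (Suc t) (\<theta> t)"
proof -
  have th: "\<theta> t \<in> carrier_vec p" using st stays_Suc[OF t] B_carrier by simp
  have t': "t0 \<le> Suc t" using t by simp
  have comm: "x - n - \<theta>s = x - \<theta>s - n" if "x \<in> carrier_vec p" "n \<in> carrier_vec p" for x n :: rvec
    using that thetas by (intro eq_vecI) auto
  show ?thesis
    unfolding dev_def theta_step[OF t]
    using minv_Omega(1)[OF t' st grad_carrier[OF _ th, of "Suc t"]] by (intro comm th) simp
qed

lemma dev_sq_le_energy:
  assumes "t0 \<le> t" "stays t"
  shows "K2 * real t * (vnorm (dev t))\<^sup>2 \<le> energy t"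
  using Omega_coercive[OF assms dev_carrier[OF assms]] by (simp add: energy_def vnorm_sq)

text \<open>
  Expanding the square in the metric \<open>\<Omega> (Suc t)\<close> produces the quadratic term of the Newton step and, besides
  the old energy, the curvature and gradient terms that \<open>step_gain\<close> bounds by a difference of losses.
\<close>

lemma energy_step:
  assumes t: "t0 \<le> t" and st: "stays (Suc t)"
  shows "energy (Suc t) \<le> energy t + 2 * (l (Suc t) \<theta>s - l (Suc t) (\<theta> t))
    + grad (Suc t) (\<theta> t) \<bullet> (minv (\<Omega> (Suc t)) *\<^sub>v grad (Suc t) (\<theta> t))
    + 2 * L1 * L2 * vnorm (dev t) ^ 3"
proof -
  let ?g = "grad (Suc t) (\<theta> t)" and ?O = "\<Omega> (Suc t)"
  let ?n = "minv ?O *\<^sub>v ?g"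
  have th: "\<theta> t \<in> B" and st': "stays t" using st stays_Suc[OF t] by auto
  have t': "t0 \<le> Suc t" using t by simp
  have g: "?g \<in> carrier_vec p" using grad_carrier[OF _ B_carrier[OF th]] by simp
  have d: "dev t \<in> carrier_vec p" by (rule dev_carrier[OF t st'])
  note n = minv_Omega[OF t' st g]
  have "energy (Suc t) = dev t \<bullet> (?O *\<^sub>v dev t) - 2 * (dev t \<bullet> ?g) + ?n \<bullet> ?g"
    unfolding energy_def dev_step[OF t st]
    using quadratic_diff_expand[OF Omega_carrier_sym[OF t' st] d n(1)] n(2) by simp
  also have "?n \<bullet> ?g = ?g \<bullet> ?n" using comm_scalar_prod[OF n(1) g] .
  also have "dev t \<bullet> (?O *\<^sub>v dev t) = energy t + dev t \<bullet> (hess (Suc t) (\<theta> t) *\<^sub>v dev t)"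
    unfolding energy_def by (rule Omega_step_bilinear[OF t st d d])
  finally have eq: "energy (Suc t) = energy t + (dev t \<bullet> (hess (Suc t) (\<theta> t) *\<^sub>v dev t)
      - 2 * (dev t \<bullet> ?g)) + ?g \<bullet> ?n" by simp
  have "0 \<le> dev t \<bullet> (hess (Suc t) (\<theta> t) *\<^sub>v dev t)"
    using hess_step[OF t] d hess_carrier[OF _ B_carrier[OF th], of "Suc t"] by (auto simp: psd_def)
  then have "dev t \<bullet> (hess (Suc t) (\<theta> t) *\<^sub>v dev t) - 2 * (dev t \<bullet> ?g)
      \<le> 2 * (l (Suc t) \<theta>s - l (Suc t) (\<theta> t)) + 2 * L1 * L2 * vnorm (dev t) ^ 3"
    unfolding dev_def by (intro step_gain th) auto
  then show ?thesis unfolding eq by simp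
qed

lemma energy_le:
  assumes t: "t0 \<le> t" and st: "stays t"
  shows "energy t \<le> energy t0 + 2 * (\<Sum>s=t0+1..t. l s \<theta>s - l s (\<theta> (s - 1)))
    + (\<Sum>s=t0+1..t. grad s (\<theta> (s - 1)) \<bullet> (minv (\<Omega> s) *\<^sub>v grad s (\<theta> (s - 1))))
    + 2 * L1 * L2 * (\<Sum>s=t0..<t. vnorm (dev s) ^ 3)"
proof -
  have "stays t \<longrightarrow> ?thesis"
    using t
  proof (induction t rule: dec_induct)
    case base
    show ?case by simp
  next
    case (step t)
    have set: "{t0 + 1..Suc t} = insert (Suc t) {t0 + 1..t}" using step(1) by auto
    show ?case
      using step energy_step[OF step(1)] stays_Suc[OF step(1)]
      unfolding set by (auto simp: algebra_simps)
  qed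
  with st show ?thesis by simp
qed

end

section \<open>Sums and rates\<close>

lemma sum_telescope_le:
  fixes f g :: "nat \<Rightarrow> real"
  assumes "m \<le> n" "\<And>s. m \<le> s \<Longrightarrow> f s \<le> g (Suc s) - g s"
  shows "(\<Sum>s=m..<n. f s) \<le> g n - g m"
proof -
  have "(\<Sum>s=m..<n. f s) \<le> (\<Sum>s=m..<n. g (Suc s) - g s)"
    using assms(2) by (intro sum_mono) auto
  also have "\<dots> = g n - g m" using assms(1) by (rule sum_Suc_diff')
  finally show ?thesis .
qed

lemma sum_inverse_le_ln:
  assumes "1 \<le> m" "m \<le> n"
  shows "(\<Sum>s=m..<n. 1 / real s) \<le> 1 / real m + ln (real n / real m)"
proof -
  have step: "1 / real (Suc s) \<le> ln (real (Suc s)) - ln (real s)" if "m \<le> s" for s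
  proof -
    have s: "0 < real s" using that assms by simp
    have "ln (real s / real (Suc s)) \<le> real s / real (Suc s) - 1"
      using s by (intro ln_le_minus_one) auto
    also have "\<dots> = - (1 / real (Suc s))" by (simp add: field_simps)
    finally show ?thesis using s by (simp add: ln_div)
  qed
  show ?thesis
  proof (cases "m = n")
    case False
    then obtain k where k: "n = Suc k" "m \<le> k" using assms by (cases n) auto
    have "(\<Sum>s=m..<n. 1 / real s) = 1 / real m + (\<Sum>s=Suc m..<Suc k. 1 / real s)"
      using k by (simp add: sum.atLeast_Suc_lessThan)
    also have "(\<Sum>s=Suc m..<Suc k. 1 / real s) = (\<Sum>s=m..<k. 1 / real (Suc s))"
      by (rule sum.shift_bounds_Suc_ivl)
    also have "\<dots> \<le> ln (real k) - ln (real m)"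
      by (rule sum_telescope_le[where f = "\<lambda>s. 1 / real (Suc s)" and g = "\<lambda>s. ln (real s)", OF k(2) step])
    also have "\<dots> \<le> ln (real n / real m)"
      using k assms by (simp add: ln_div)
    finally show ?thesis by simp
  qed simp
qed

lemma sum_inverse_sqrt_le:
  assumes "1 \<le> m" "m \<le> n"
  shows "(\<Sum>s=m..<n. 1 / sqrt (real s)) \<le> 2 * sqrt (real n)"
proof -
  have step: "1 / sqrt (real s) \<le> 2 * sqrt (real (Suc s) - 1) - 2 * sqrt (real s - 1)" if "m \<le> s" for s
  proof -
    define a b where "a = sqrt (real s)" and "b = sqrt (real s - 1)"
    have ab: "0 < a" "0 \<le> b" "a * a = real s" "b * b = real s - 1" "b \<le> a"
      using that assms by (auto simp: a_def b_def)
    have "1 = (a + b) * (a - b)" using ab by (simp add: algebra_simps)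
    also have "\<dots> \<le> (2 * a) * (a - b)" using ab by (intro mult_right_mono) auto
    finally have "1 / a \<le> 2 * (a - b)" using ab(1) by (simp add: field_simps)
    then show ?thesis by (simp add: a_def b_def)
  qed
  have "(\<Sum>s=m..<n. 1 / sqrt (real s)) \<le> 2 * sqrt (real n - 1) - 2 * sqrt (real m - 1)"
    by (rule sum_telescope_le[where g = "\<lambda>s. 2 * sqrt (real s - 1)", OF assms(2) step])
  also have "\<dots> \<le> 2 * sqrt (real n)"
  proof -
    have "sqrt (real n - 1) \<le> sqrt (real n)" "0 \<le> sqrt (real m - 1)" using assms by auto
    then show ?thesis by linarith
  qed
  finally show ?thesis .
qed

text \<open>
  The summand is \<open>m\<close> to the power \<open>1/4\<close> times \<open>s\<close> to the power \<open>-5/4\<close>, up to a constant a discrete derivative of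
  \<open>- (m / s)\<close> to the power \<open>1/4\<close>.
\<close>

lemma sum_power_five_quarters_le:
  assumes "1 \<le> m" "m \<le> n"
  shows "(\<Sum>s=m..<n. 1 / real s * sqrt (sqrt (real m / real s))) \<le> 8"
proof -
  define \<phi> where "\<phi> s = sqrt (sqrt (real m / real s))" for s
  have step: "1 / real s * \<phi> s \<le> - 8 * \<phi> (Suc s) - - 8 * \<phi> s" if "m \<le> s" for s
  proof -
    have s: "1 \<le> s" "0 < real s" using that assms by auto
    define \<rho> where "\<rho> = sqrt (sqrt (real s / real (Suc s)))"
    have \<rho>: "0 \<le> \<rho>" "\<rho> \<le> 1" by (auto simp: \<rho>_def)
    have "real s / real (Suc s) = (\<rho>\<^sup>2)\<^sup>2"
      using s by (simp add: \<rho>_def)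
    then have "1 / real (Suc s) = 1 - (\<rho>\<^sup>2)\<^sup>2"
      by (simp add: field_simps)
    also have "\<dots> = (1 - \<rho>) * ((1 + \<rho>) * (1 + \<rho>\<^sup>2))"
      by (simp add: algebra_simps power2_eq_square)
    also have "\<dots> \<le> (1 - \<rho>) * (2 * 2)"
      using \<rho> by (intro mult_left_mono mult_mono) (auto simp: power_le_one)
    finally have "1 / real (Suc s) \<le> 4 * (1 - \<rho>)" by simp
    moreover have "1 / real s \<le> 2 / real (Suc s)"
      using s by (simp add: field_simps)
    ultimately have "1 / real s \<le> 8 * (1 - \<rho>)" by simp
    then have "1 / real s * \<phi> s \<le> 8 * (1 - \<rho>) * \<phi> s"
      by (intro mult_right_mono) (auto simp: \<phi>_def)
    moreover have "\<phi> (Suc s) = \<rho> * \<phi> s"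
      using s by (simp add: \<phi>_def \<rho>_def real_sqrt_mult[symmetric] del: of_nat_Suc)
    ultimately show ?thesis by (simp add: algebra_simps)
  qed
  have "(\<Sum>s=m..<n. 1 / real s * \<phi> s) \<le> - 8 * \<phi> n - - 8 * \<phi> m"
    by (rule sum_telescope_le[where g = "\<lambda>s. - 8 * \<phi> s", OF assms(2) step])
  also have "\<dots> \<le> 8"
    using assms by (simp add: \<phi>_def)
  finally show ?thesis by (simp add: \<phi>_def)
qed

text \<open>The complexity term of the regret and estimation bounds.\<close>

definition rate :: "nat \<Rightarrow> real \<Rightarrow> nat \<Rightarrow> real" where
  "rate p x t = real p * ln (real t) + x"

lemma rate_mono: "1 \<le> s \<Longrightarrow> s \<le> t \<Longrightarrow> rate p x s \<le> rate p x t"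
  by (simp add: rate_def mult_left_mono)

lemma one_le_ln:
  assumes "3 \<le> t"
  shows "1 \<le> ln (real t)"
proof -
  have "exp 1 \<le> real t" using exp_le assms by (simp add: order_trans[of _ 3])
  then show ?thesis using assms by (simp add: ln_ge_iff)
qed

lemma rate_ge:
  assumes "3 \<le> t" "1 \<le> p" "0 < x"
  shows "real p + x \<le> rate p x t" "ln (real t) \<le> rate p x t" "real p + ln (real t) + x \<le> 2 * rate p x t"
    "1 \<le> rate p x t"
proof -
  have l: "1 \<le> ln (real t)" by (rule one_le_ln[OF assms(1)])
  have 1: "real p * 1 \<le> real p * ln (real t)" using l by (intro mult_left_mono) auto
  have 2: "1 * ln (real t) \<le> real p * ln (real t)" using l assms by (intro mult_right_mono) auto
  show "real p + x \<le> rate p x t" "ln (real t) \<le> rate p x t" "real p + ln (real t) + x \<le> 2 * rate p x t"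
    "1 \<le> rate p x t"
  proof -
    define Q where "Q = real p * ln (real t)"
    have "rate p x t = Q + x" "real p \<le> Q" "ln (real t) \<le> Q" "1 \<le> real p"
      using 1 2 assms by (auto simp: Q_def rate_def)
    then show "real p + x \<le> rate p x t" "ln (real t) \<le> rate p x t"
      "real p + ln (real t) + x \<le> 2 * rate p x t" "1 \<le> rate p x t"
      using assms(3) by auto
  qed
qed

text \<open>
  Splitting \<open>ln s\<close> at \<open>m = max p 3\<close>, the part \<open>p ln m + x\<close> of the rate is at most \<open>t\<^sub>0 / M\<close>, and the remainder
  \<open>p ln (s / m)\<close> is of order \<open>sqrt (p s)\<close>, where \<open>p \<le> t\<^sub>0 / M\<close>.
\<close>

lemma rate_le_after_burn_in:
  assumes M: "1 \<le> M" and p: "1 \<le> p" and x: "0 < x"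
    and t0: "M * (real p * ln (max (real p) 3) + x) \<le> real t0" and s: "t0 \<le> s"
  shows "rate p x s \<le> 3 / sqrt M * sqrt (real t0 * real s)"
proof -
  define m where "m = max (real p) 3"
  define P where "P = real p * ln m"
  have lnm: "1 \<le> ln m"
  proof -
    have "exp 1 \<le> m" using exp_le by (simp add: m_def)
    then show ?thesis by (subst ln_ge_iff) (auto simp: m_def)
  qed
  have pP: "real p \<le> P" using mult_left_mono[OF lnm, of "real p"] by (simp add: P_def)
  have PM: "M * (P + x) \<le> real t0" using t0 by (simp add: P_def m_def)
  have t0pos: "0 < real t0"
    using PM M x pP p mult_pos_pos[of M "P + x"] by linarith
  have spos: "0 < real s" using t0pos s by simp
  have Px: "P + x \<le> real t0 / M" using PM M by (simp add: field_simps)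
  \<comment> \<open>\<open>ln s = ln m + 2 ln y\<close>, and \<open>ln y \<le> y\<close> is of order \<open>sqrt s\<close>\<close>
  define y where "y = sqrt (real s / m)"
  have y: "0 < y" "y\<^sup>2 = real s / m" using spos by (auto simp: y_def m_def)
  have "ln (real s) = ln m + 2 * ln y"
  proof -
    have "real s = m * y\<^sup>2" using y by (simp add: m_def)
    then have "ln (real s) = ln m + ln (y\<^sup>2)"
      using y(1) by (simp only: ln_mult) (simp add: ln_mult m_def)
    then show ?thesis using y(1) by (simp add: ln_realpow)
  qed
  also have "\<dots> \<le> ln m + 2 * y" using ln_le_minus_one[OF y(1)] by simp
  finally have "rate p x s \<le> (P + x) + 2 * (real p * y)"
    using mult_left_mono[of "ln (real s)" "ln m + 2 * y" "real p"]
    by (simp add: rate_def P_def algebra_simps)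
  also have "real p * y \<le> sqrt (real p) * sqrt (real s)"
  proof -
    have "real p * y \<le> real p * sqrt (real s / real p)"
      using p by (intro mult_left_mono) (auto simp: y_def m_def divide_left_mono)
    also have "\<dots> = sqrt (real p) * sqrt (real s)"
      using p by (simp add: real_sqrt_divide) (simp add: field_simps)
    finally show ?thesis .
  qed
  also have "sqrt (real p) \<le> sqrt (real t0 / M)"
    using pP Px x by simp
  finally have "rate p x s \<le> (P + x) + 2 * (sqrt (real t0 / M) * sqrt (real s))"
    by (simp add: mult_right_mono)
  moreover have "real t0 / M \<le> sqrt (real t0 / M) * sqrt (real s)"
  proof -
    have "real t0 / M \<le> real t0 / sqrt M"
      using M t0pos by (intro divide_left_mono) (auto simp: sqrt_le_D real_le_lsqrt power2_eq_square)
    also have "\<dots> = sqrt (real t0 / M) * sqrt (real t0)"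
      using t0pos by (simp add: real_sqrt_divide)
    also have "\<dots> \<le> sqrt (real t0 / M) * sqrt (real s)"
      using s M by (intro mult_left_mono) auto
    finally show ?thesis .
  qed
  ultimately have "rate p x s \<le> 3 * (sqrt (real t0 / M) * sqrt (real s))"
    using Px by linarith
  then show ?thesis
    by (simp add: real_sqrt_divide real_sqrt_mult)
qed

section \<open>Localisation of the iterates\<close>

context newton_run
begin

lemma dev_sq_le:
  assumes t: "t0 \<le> t" and st: "stays t" and e: "energy t \<le> A * q"
  shows "(vnorm (dev t))\<^sup>2 \<le> A / K2 * q / real t"
proof -
  have "K2 * real t * (vnorm (dev t))\<^sup>2 \<le> A * q"
    using dev_sq_le_energy[OF t st] e by simp
  then show ?thesis
    using K2t_pos[OF t] K2 by (simp add: field_simps zero_less_mult_iff)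
qed

text \<open>
  As long as the iterates stay in the ball the energy is of the order of the rate; the cubic
  linearisation errors sum to a small multiple of the rate after a sufficiently long burn-in, which
  in turn keeps the next iterate in the ball.
\<close>

lemma localisation:
  fixes x K3 K4 K5 C \<kappa> :: real
  defines "A \<equiv> C + 2 * K3 + K4 + 2 * K5 + 1"
  assumes x: "0 < x" and const: "0 < C" "0 < K3" "0 < K4" "0 \<le> K5"
    and regret: "\<And>t. t0 < t \<Longrightarrow> (\<Sum>s=t0+1..t. l s \<theta>s - l s (\<theta> (s - 1))) \<le> K3 * x"
    and steps: "\<And>t. t0 < t \<Longrightarrow> stays t \<Longrightarrow>
      (\<Sum>s=t0+1..t. grad s (\<theta> (s - 1)) \<bullet> (minv (\<Omega> s) *\<^sub>v grad s (\<theta> (s - 1))))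
        \<le> K4 * real p * ln (real t) + K5 * (x + ln (real t))"
    and initial: "energy t0 \<le> C * (real p + x)"
    and burn_in: "\<And>s. t0 \<le> s \<Longrightarrow> rate p x s \<le> \<kappa> * sqrt (real t0 * real s)"
    and \<kappa>: "0 \<le> \<kappa>" "A / K2 * \<kappa> \<le> r\<^sup>2" "16 * L1 * L2 * (A / K2) * sqrt (A / K2 * \<kappa>) \<le> 1"
    and t: "t0 \<le> t"
  shows "\<theta> t \<in> B" "energy t \<le> A * rate p x t"
proof -
  define b where "b = A / K2"
  have A: "0 < A" using const by (simp add: A_def)
  have b: "0 < b" using A K2 by (simp add: b_def)
  have p1: "1 \<le> p" using p by simp
  have rate_pos: "1 \<le> rate p x s" if "t0 \<le> s" for s
    using rate_ge(4)[OF _ p1 x, of s] t0 that by simp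
  have main: "\<theta> t \<in> B \<and> energy t \<le> A * rate p x t" using t
  proof (induction t rule: less_induct)
    case (less t)
    note t = less.prems
    have st: "stays t" using less.IH by (simp add: stays_def)
    have qt: "1 \<le> rate p x t" by (rule rate_pos[OF t])
    have t3: "3 \<le> t" using t0 t by simp
    show ?case
    proof (cases "t = t0")
      case True
      have "C * (real p + x) \<le> A * rate p x t"
        using rate_ge(1)[OF t3 p1 x] const x by (intro mult_mono) (auto simp: A_def)
      then show ?thesis using True start initial by simp
    next
      case False
      then have t': "t0 < t" using t by simp
      have cube: "vnorm (dev s) ^ 3 \<le> b * sqrt (b * \<kappa>) * rate p x t * (1 / real s * sqrt (sqrt (real t0 / real s)))"
        if s: "s \<in> {t0..<t}" for s
      proof -
        have s0: "t0 \<le> s" "s < t" "0 < real s" "0 < real t0" using s t0 by auto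
        have sts: "stays s" using st s0 by (auto simp: stays_def)
        \<comment> \<open>\<open>|dev s|\<^sup>3 = y sqrt y\<close>: the first factor carries the rate, the second is small after the burn-in\<close>
        define y where "y = (vnorm (dev s))\<^sup>2"
        have y0: "0 \<le> y" by (simp add: y_def)
        have y1: "y \<le> b * rate p x s / real s"
          unfolding y_def b_def using less.IH[of s] s0 by (intro dev_sq_le sts) auto
        have "y \<le> b * rate p x t / real s"
        proof -
          have "b * rate p x s / real s \<le> b * rate p x t / real s"
            using rate_mono[of s t p x] s0 b t0 by (intro divide_right_mono mult_left_mono) auto
          then show ?thesis using y1 by simp
        qed
        moreover have "sqrt y \<le> sqrt (b * \<kappa>) * sqrt (sqrt (real t0 / real s))"
        proof -
          have "b * rate p x s / real s \<le> b * (\<kappa> * sqrt (real t0 * real s)) / real s"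
            using burn_in[OF s0(1)] s0 b by (intro divide_right_mono mult_left_mono) auto
          also have "\<dots> = (b * \<kappa>) * sqrt (real t0 / real s)"
            using s0 by (simp add: real_sqrt_mult real_sqrt_divide) (simp add: field_simps)
          finally have "y \<le> (b * \<kappa>) * sqrt (real t0 / real s)" using y1 by simp
          then have "sqrt y \<le> sqrt ((b * \<kappa>) * sqrt (real t0 / real s))" by (rule real_sqrt_le_mono)
          then show ?thesis by (simp only: real_sqrt_mult)
        qed
        ultimately have "y * sqrt y \<le> (b * rate p x t / real s) * (sqrt (b * \<kappa>) * sqrt (sqrt (real t0 / real s)))"
          using y0 by (intro mult_mono) auto
        moreover have "vnorm (dev s) ^ 3 = y * sqrt y"
          by (simp add: y_def power3_eq_cube power2_eq_square)
        ultimately show ?thesis by (simp add: mult_ac)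
      qed
      have "(\<Sum>s=t0..<t. vnorm (dev s) ^ 3)
          \<le> (\<Sum>s=t0..<t. b * sqrt (b * \<kappa>) * rate p x t * (1 / real s * sqrt (sqrt (real t0 / real s))))"
        by (rule sum_mono[OF cube])
      also have "\<dots> = b * sqrt (b * \<kappa>) * rate p x t * (\<Sum>s=t0..<t. 1 / real s * sqrt (sqrt (real t0 / real s)))"
        by (simp only: sum_distrib_left)
      also have "\<dots> \<le> b * sqrt (b * \<kappa>) * rate p x t * 8"
        using sum_power_five_quarters_le[of t0 t] t t0 b qt \<kappa> by (intro mult_left_mono) auto
      finally have cubes: "(\<Sum>s=t0..<t. vnorm (dev s) ^ 3) \<le> b * sqrt (b * \<kappa>) * rate p x t * 8" .
      have "2 * L1 * L2 * (\<Sum>s=t0..<t. vnorm (dev s) ^ 3)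
          \<le> 2 * L1 * L2 * (b * sqrt (b * \<kappa>) * rate p x t * 8)"
        using cubes L1 L2 by (intro mult_left_mono) auto
      also have "\<dots> = (16 * L1 * L2 * b * sqrt (b * \<kappa>)) * rate p x t" by simp
      also have "\<dots> \<le> 1 * rate p x t"
        using \<kappa>(3) qt unfolding b_def by (intro mult_right_mono) auto
      finally have err: "2 * L1 * L2 * (\<Sum>s=t0..<t. vnorm (dev s) ^ 3) \<le> rate p x t" by simp
      have lnt: "1 \<le> ln (real t)" by (rule one_le_ln[OF t3])
      note rg = rate_ge[OF t3 p1 x]
      have xr: "x \<le> rate p x t" and pl: "real p * ln (real t) \<le> rate p x t"
        using lnt x by (auto simp: rate_def)
      have e1: "C * (real p + x) \<le> C * rate p x t" using rg const by (intro mult_left_mono) auto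
      have e2: "K3 * x \<le> K3 * rate p x t" using xr const by (intro mult_left_mono) auto
      have e3: "K4 * real p * ln (real t) \<le> K4 * rate p x t"
        using mult_left_mono[OF pl, of K4] const by (simp add: mult_ac)
      have e4: "K5 * (x + ln (real t)) \<le> K5 * (2 * rate p x t)"
        using xr rg const by (intro mult_left_mono) auto
      have en: "energy t \<le> A * rate p x t"
        using energy_le[OF t st] regret[OF t'] steps[OF t' st] initial err e1 e2 e3 e4
        unfolding A_def by (simp add: algebra_simps)
      have "(vnorm (dev t))\<^sup>2 \<le> b * rate p x t / real t"
        unfolding b_def by (rule dev_sq_le[OF t st en])
      also have "\<dots> \<le> b * (\<kappa> * sqrt (real t0 * real t)) / real t"
        using burn_in[OF t] b t3 by (intro divide_right_mono mult_left_mono) auto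
      also have "\<dots> \<le> b * \<kappa>"
      proof -
        have "sqrt (real t0 * real t) \<le> real t"
          using t by (intro real_le_lsqrt) (auto simp: power2_eq_square mult_right_mono)
        then have "b * (\<kappa> * sqrt (real t0 * real t)) \<le> b * (\<kappa> * real t)"
          using b \<kappa> by (intro mult_left_mono) auto
        then show ?thesis using t3 by (simp add: divide_le_eq mult_ac)
      qed
      finally have "(vnorm (dev t))\<^sup>2 \<le> r\<^sup>2" using \<kappa>(2) by (simp add: b_def)
      then have "vnorm (dev t) \<le> r" using r by (rule power2_le_imp_le[OF _ less_imp_le])
      then have "\<theta> t \<in> B" using theta_carrier[OF t st] by (simp add: B_def dev_def)
      then show ?thesis using en by simp
    qed
  qed
  from main show "\<theta> t \<in> B" "energy t \<le> A * rate p x t" by auto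
qed

end

section \<open>Distance to the maximum likelihood estimator\<close>

context newton_run
begin

text \<open>The observed information at the true parameter.\<close>

definition info where "info t = mat_sum p (\<lambda>s. hess s \<theta>s) {1..t}"

lemma info_carrier [simp]: "info t \<in> carrier_mat p p"
  by (simp add: info_def)

lemma info_bilinear:
  assumes "v \<in> carrier_vec p" "w \<in> carrier_vec p"
  shows "w \<bullet> (info t *\<^sub>v v) = (\<Sum>s=1..t. w \<bullet> (hess s \<theta>s *\<^sub>v v))"
  unfolding info_def using hess_carrier thetas assms by (intro bilinear_mat_sum) auto

lemma info_coercive:
  assumes "t0 \<le> t" "v \<in> carrier_vec p"
  shows "K2 * real t * (v \<bullet> v) \<le> v \<bullet> (info t *\<^sub>v v)"
  using hess_sum_coercive[OF assms(1) _ assms(2), of "\<lambda>_. \<theta>s"] thetas_in_B info_bilinear assms by simp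

lemma info_posdef:
  assumes t: "t0 \<le> t"
  shows "posdef p (info t)"
  unfolding posdef_def
proof (intro conjI ballI impI info_carrier)
  show "transpose_mat (info t) = info t"
    using F_psd[OF _ thetas_in_B, of t] t t0 by (simp add: psd_def info_def)
  fix v :: rvec assume v: "v \<in> carrier_vec p" "v \<noteq> 0\<^sub>v p"
  have "0 < v \<bullet> v" using vnorm_pos[OF v] by (simp flip: vnorm_sq)
  then show "0 < v \<bullet> (info t *\<^sub>v v)"
    using info_coercive[OF t v(1)] K2t_pos[OF t] mult_pos_pos[of "K2 * real t" "v \<bullet> v"] by linarith
qed

lemma sum_knot:
  fixes g :: "rvec \<Rightarrow> real"
  assumes "t0 \<le> t"
  shows "(\<Sum>s=1..t. g (knot s)) = real t0 * g (\<theta> t0) + (\<Sum>s=t0..<t. g (\<theta> s))"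
  using assms
proof (induction t rule: dec_induct)
  case base
  have "(\<Sum>s=1..t0. g (knot s)) = (\<Sum>s=1..t0. g (\<theta> t0))"
    by (intro sum.cong) (auto simp: knot_def)
  then show ?case by simp
next
  case (step t)
  have "knot (Suc t) = \<theta> t" using step(1) by (simp add: knot_def)
  then show ?case using step by simp
qed

text \<open>
  \<open>\<Omega>\<^sub>t dev\<^sub>t\<close> obeys a linear recursion driven by the gradients at the true parameter, so that \<open>\<theta>\<^sub>t\<close> solves
  the linearised likelihood equation up to second-order errors.
\<close>

lemma linearised_score:
  assumes t: "t0 \<le> t" and st: "stays t" and w: "w \<in> carrier_vec p"
    and foc: "\<And>w. w \<in> carrier_vec p \<Longrightarrow>
      w \<bullet> (\<Omega>0 *\<^sub>v (\<theta> t0 - \<theta>0)) + (\<Sum>s=1..t0. w \<bullet> grad s (\<theta> t0)) = 0"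
  shows "\<bar>w \<bullet> (\<Omega> t *\<^sub>v dev t) + (\<Sum>s=1..t. w \<bullet> grad s \<theta>s) - w \<bullet> (\<Omega>0 *\<^sub>v (\<theta>0 - \<theta>s))\<bar>
    \<le> L3 * vnorm w * (\<Sum>s=1..t. (vnorm (knot s - \<theta>s))\<^sup>2)"
proof -
  have err: "\<bar>w \<bullet> (hess s \<eta> *\<^sub>v (\<eta> - \<theta>s)) + w \<bullet> grad s \<theta>s - w \<bullet> grad s \<eta>\<bar> \<le> L3 * vnorm w * (vnorm (\<eta> - \<theta>s))\<^sup>2"
    if s: "1 \<le> s" and eta: "\<eta> \<in> B" for s \<eta>
  proof -
    have c: "\<eta> \<in> carrier_vec p" by (rule B_carrier[OF eta])
    have H: "hess s \<eta> \<in> carrier_mat p p" by (rule hess_carrier[OF s c])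
    have d: "\<eta> - \<theta>s \<in> carrier_vec p" using c thetas by simp
    have "\<theta>s - \<eta> = (- 1 :: real) \<cdot>\<^sub>v (\<eta> - \<theta>s)" using c thetas by (intro eq_vecI) auto
    then have "w \<bullet> (hess s \<eta> *\<^sub>v (\<theta>s - \<eta>)) = - (w \<bullet> (hess s \<eta> *\<^sub>v (\<eta> - \<theta>s)))"
      using mult_mat_vec[OF H d, of "- 1"] scalar_prod_smult_distrib[OF w mult_mat_vec_carrier[OF H d], of "- 1"]
      by (simp del: scalar_prod_smult_right)
    moreover have "\<bar>w \<bullet> grad s \<theta>s - w \<bullet> grad s \<eta> - w \<bullet> (hess s \<eta> *\<^sub>v (\<theta>s - \<eta>))\<bar>
        \<le> L3 * (vnorm (\<theta>s - \<eta>))\<^sup>2 * vnorm w"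
      by (rule grad_taylor[OF s eta thetas_in_B w])
    ultimately show ?thesis
      using vnorm_minus_commute[OF thetas c] by (simp add: algebra_simps)
  qed
  have "stays t \<longrightarrow> ?thesis"
    using t
  proof (induction t rule: dec_induct)
    case base
    have d: "dev t0 \<in> carrier_vec p" "\<theta> t0 \<in> carrier_vec p"
      using B_carrier[OF start] thetas by (auto simp: dev_def)
    have st0: "stays t0" by (auto simp: stays_def)
    have kn: "s \<in> {1..t0} \<Longrightarrow> knot s = \<theta> t0" for s by (simp add: knot_def)
    have split: "w \<bullet> (\<Omega>0 *\<^sub>v dev t0) = w \<bullet> (\<Omega>0 *\<^sub>v (\<theta> t0 - \<theta>0)) + w \<bullet> (\<Omega>0 *\<^sub>v (\<theta>0 - \<theta>s))"
    proof -
      have "dev t0 = (\<theta> t0 - \<theta>0) + (\<theta>0 - \<theta>s)"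
        unfolding dev_def using d theta0 thetas by (intro eq_vecI) auto
      moreover have "\<Omega>0 *\<^sub>v (\<theta> t0 - \<theta>0) \<in> carrier_vec p" "\<Omega>0 *\<^sub>v (\<theta>0 - \<theta>s) \<in> carrier_vec p"
        using Omega0 d theta0 thetas by auto
      ultimately show ?thesis
        using Omega0 d theta0 thetas w
        by (simp add: mult_add_distrib_mat_vec[of _ p p] scalar_prod_add_distrib[of _ p])
    qed
    have "w \<bullet> (\<Omega> t0 *\<^sub>v dev t0) = w \<bullet> (\<Omega>0 *\<^sub>v dev t0) + (\<Sum>s=1..t0. w \<bullet> (hess s (\<theta> t0) *\<^sub>v dev t0))"
      using Omega_bilinear[OF order_refl st0 d(1) w] kn by simp
    then have "w \<bullet> (\<Omega> t0 *\<^sub>v dev t0) + (\<Sum>s=1..t0. w \<bullet> grad s \<theta>s) - w \<bullet> (\<Omega>0 *\<^sub>v (\<theta>0 - \<theta>s))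
        = (\<Sum>s=1..t0. w \<bullet> (hess s (\<theta> t0) *\<^sub>v dev t0) + w \<bullet> grad s \<theta>s - w \<bullet> grad s (\<theta> t0))"
      using foc[OF w] unfolding split by (simp add: sum.distrib sum_subtractf)
    also have "\<bar>\<dots>\<bar> \<le> (\<Sum>s=1..t0. L3 * vnorm w * (vnorm (\<theta> t0 - \<theta>s))\<^sup>2)"
      unfolding dev_def using err[OF _ start]
      by (intro order_trans[OF sum_abs] sum_mono) auto
    also have "\<dots> = L3 * vnorm w * (\<Sum>s=1..t0. (vnorm (knot s - \<theta>s))\<^sup>2)"
      using kn by (simp add: sum_distrib_left)
    finally show ?case by simp
  next
    case (step t)
    show ?case
    proof
      assume st: "stays (Suc t)"
      have st': "stays t" and th: "\<theta> t \<in> B" using st stays_Suc[OF step(1)] by auto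
      have t': "t0 \<le> Suc t" using step(1) by simp
      have kn: "knot (Suc t) = \<theta> t" using step(1) by (simp add: knot_def)
      have d: "dev t \<in> carrier_vec p" by (rule dev_carrier[OF step(1) st'])
      have g: "grad (Suc t) (\<theta> t) \<in> carrier_vec p" using grad_carrier[OF _ B_carrier[OF th]] by simp
      note n = minv_Omega[OF t' st g]
      have O: "\<Omega> (Suc t) \<in> carrier_mat p p" by (rule Omega_carrier_sym(1)[OF t' st])
      have Od: "\<Omega> (Suc t) *\<^sub>v dev t \<in> carrier_vec p" using O d by auto
      have "w \<bullet> (\<Omega> (Suc t) *\<^sub>v dev (Suc t)) = w \<bullet> (\<Omega> (Suc t) *\<^sub>v dev t) - w \<bullet> grad (Suc t) (\<theta> t)"
        unfolding dev_step[OF step(1) st] mult_minus_distrib_mat_vec[OF O d n(1)] n(2)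
        by (rule scalar_prod_minus_distrib[OF w Od g])
      then have "w \<bullet> (\<Omega> (Suc t) *\<^sub>v dev (Suc t)) = w \<bullet> (\<Omega> t *\<^sub>v dev t)
          + w \<bullet> (hess (Suc t) (\<theta> t) *\<^sub>v dev t) - w \<bullet> grad (Suc t) (\<theta> t)"
        using Omega_step_bilinear[OF step(1) st d w] by simp
      moreover have "\<bar>w \<bullet> (hess (Suc t) (\<theta> t) *\<^sub>v dev t) + w \<bullet> grad (Suc t) \<theta>s - w \<bullet> grad (Suc t) (\<theta> t)\<bar>
          \<le> L3 * vnorm w * (vnorm (knot (Suc t) - \<theta>s))\<^sup>2"
        unfolding dev_def kn by (intro err th) simp
      moreover have "\<bar>w \<bullet> (\<Omega> t *\<^sub>v dev t) + (\<Sum>s=1..t. w \<bullet> grad s \<theta>s) - w \<bullet> (\<Omega>0 *\<^sub>v (\<theta>0 - \<theta>s))\<bar>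
          \<le> L3 * vnorm w * (\<Sum>s=1..t. (vnorm (knot s - \<theta>s))\<^sup>2)"
        using step st' by simp
      ultimately show "\<bar>w \<bullet> (\<Omega> (Suc t) *\<^sub>v dev (Suc t)) + (\<Sum>s=1..Suc t. w \<bullet> grad s \<theta>s)
            - w \<bullet> (\<Omega>0 *\<^sub>v (\<theta>0 - \<theta>s))\<bar>
          \<le> L3 * vnorm w * (\<Sum>s=1..Suc t. (vnorm (knot s - \<theta>s))\<^sup>2)"
        by (simp add: distrib_left)
    qed
  qed
  with st show ?thesis by simp
qed

text \<open>
  The maximum likelihood estimator solves the same linearised equation as \<open>\<theta>\<^sub>t\<close>, with \<open>info\<close> in place of \<open>\<Omega>\<close>
  and without a prior.
\<close>

lemma ml_score:
  assumes t: "t0 \<le> t" and m: "m \<in> B" and w: "w \<in> carrier_vec p"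
    and foc: "(\<Sum>s=1..t. w \<bullet> grad s m) = 0"
  shows "\<bar>w \<bullet> (info t *\<^sub>v (m - \<theta>s)) + (\<Sum>s=1..t. w \<bullet> grad s \<theta>s)\<bar>
    \<le> L3 * vnorm w * (real t * (vnorm (m - \<theta>s))\<^sup>2)"
proof -
  have d: "m - \<theta>s \<in> carrier_vec p" using B_carrier[OF m] thetas by simp
  have "w \<bullet> (info t *\<^sub>v (m - \<theta>s)) + (\<Sum>s=1..t. w \<bullet> grad s \<theta>s)
      = (\<Sum>s=1..t. w \<bullet> (hess s \<theta>s *\<^sub>v (m - \<theta>s)) + w \<bullet> grad s \<theta>s - w \<bullet> grad s m)"
    using foc by (simp add: info_bilinear[OF d w] sum.distrib sum_subtractf)
  also have "\<bar>\<dots>\<bar> \<le> (\<Sum>s=1..t. L3 * (vnorm (m - \<theta>s))\<^sup>2 * vnorm w)"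
  proof (rule order_trans[OF sum_abs], rule sum_mono)
    fix s assume "s \<in> {1..t}"
    then show "\<bar>w \<bullet> (hess s \<theta>s *\<^sub>v (m - \<theta>s)) + w \<bullet> grad s \<theta>s - w \<bullet> grad s m\<bar>
        \<le> L3 * (vnorm (m - \<theta>s))\<^sup>2 * vnorm w"
      using grad_taylor[OF _ thetas_in_B m w, of s] by (simp add: abs_le_iff)
  qed
  finally show ?thesis by (simp add: mult_ac)
qed

context
  fixes x b :: real
  assumes x: "0 < x" and b: "0 \<le> b"
    and in_B: "\<And>t. t0 \<le> t \<Longrightarrow> \<theta> t \<in> B"
    and dev: "\<And>t. t0 \<le> t \<Longrightarrow> (vnorm (dev t))\<^sup>2 \<le> b * rate p x t / real t"
begin

lemma stays_always: "stays t"
  by (simp add: stays_def in_B)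

lemma rate_pos: "t0 \<le> t \<Longrightarrow> 1 \<le> rate p x t"
  using rate_ge(4)[of t p x] t0 p x by simp

lemma dev_le:
  assumes "t0 \<le> s" "s \<le> t"
  shows "(vnorm (dev s))\<^sup>2 \<le> b * rate p x t * (1 / real s)"
    "vnorm (dev s) \<le> sqrt (b * rate p x t) * (1 / sqrt (real s))"
proof -
  have "b * rate p x s / real s \<le> b * rate p x t / real s"
    using rate_mono[of s t p x] assms t0 b by (intro divide_right_mono mult_left_mono) auto
  then show *: "(vnorm (dev s))\<^sup>2 \<le> b * rate p x t * (1 / real s)"
    using dev[OF assms(1)] by simp
  have "vnorm (dev s) \<le> sqrt (b * rate p x t * (1 / real s))"
    using * by (rule real_le_rsqrt)
  then show "vnorm (dev s) \<le> sqrt (b * rate p x t) * (1 / sqrt (real s))"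
    by (simp add: real_sqrt_mult real_sqrt_divide)
qed

text \<open>
  Every Hessian in \<open>\<Omega>\<close> is evaluated at a knot whose distance from the true parameter is of order
  \<open>sqrt (rate / s)\<close>; Lipschitz continuity and summation over \<open>s\<close> give \<open>sqrt (rate * t)\<close>.
\<close>

lemma covariance_gap:
  assumes t: "t0 \<le> t" and v: "v \<in> carrier_vec p"
  shows "vnorm ((\<Omega> t - info t) *\<^sub>v v) \<le> (lu + 3 * L3 * sqrt b) * sqrt (rate p x t * real t) * vnorm v"
proof (rule vnorm_le_by_testing)
  note st = stays_always
  let ?q = "rate p x t"
  have O: "\<Omega> t \<in> carrier_mat p p" by (rule Omega_carrier_sym(1)[OF t st])
  show "(\<Omega> t - info t) *\<^sub>v v \<in> carrier_vec p"
    using v by (intro mult_mat_vec_carrier[OF minus_carrier_mat[OF info_carrier]])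
  have q: "1 \<le> ?q" by (rule rate_pos[OF t])
  have qt: "1 \<le> sqrt (?q * real t)"
  proof -
    have "1 * 1 \<le> ?q * real t" using q t t0 by (intro mult_mono) auto
    then show ?thesis by simp
  qed
  show "0 \<le> (lu + 3 * L3 * sqrt b) * sqrt (?q * real t) * vnorm v"
    using lu L3 b q by (intro mult_nonneg_nonneg) auto
  fix w :: rvec assume w: "w \<in> carrier_vec p"
  have Ov: "\<Omega> t *\<^sub>v v \<in> carrier_vec p" "info t *\<^sub>v v \<in> carrier_vec p"
    using O v by (auto intro: mult_mat_vec_carrier[OF info_carrier])
  have "w \<bullet> ((\<Omega> t - info t) *\<^sub>v v) = w \<bullet> (\<Omega> t *\<^sub>v v) - w \<bullet> (info t *\<^sub>v v)"
    using minus_mult_distrib_mat_vec[OF O info_carrier v] scalar_prod_minus_distrib[OF w Ov] by simp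
  also have "\<dots> = w \<bullet> (\<Omega>0 *\<^sub>v v) + (\<Sum>s=1..t. w \<bullet> (hess s (knot s) *\<^sub>v v) - w \<bullet> (hess s \<theta>s *\<^sub>v v))"
    using Omega_bilinear[OF t st v w] info_bilinear[OF v w] by (simp add: sum_subtractf)
  also have "\<dots> \<le> lu * vnorm v * vnorm w + (\<Sum>s=1..t. L3 * vnorm (knot s - \<theta>s) * vnorm v * vnorm w)"
  proof (intro add_mono sum_mono)
    show "w \<bullet> (\<Omega>0 *\<^sub>v v) \<le> lu * vnorm v * vnorm w" using Omega0_bilinear_le[OF v w] by simp
    fix s assume s: "s \<in> {1..t}"
    then have "knot s \<in> B" using knot_in_B[OF st, of s t] by simp
    with s show "w \<bullet> (hess s (knot s) *\<^sub>v v) - w \<bullet> (hess s \<theta>s *\<^sub>v v) \<le> L3 * vnorm (knot s - \<theta>s) * vnorm v * vnorm w"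
      using hess_diff_le[OF _ _ thetas_in_B v w, of s "knot s"] by simp
  qed
  also have "\<dots> = (lu + L3 * (\<Sum>s=1..t. vnorm (knot s - \<theta>s))) * (vnorm v * vnorm w)"
    by (simp add: sum_distrib_left sum_distrib_right algebra_simps)
  also have "\<dots> \<le> ((lu + 3 * L3 * sqrt b) * sqrt (?q * real t)) * (vnorm v * vnorm w)"
  proof (rule mult_right_mono)
    have "(\<Sum>s=1..t. vnorm (knot s - \<theta>s)) = real t0 * vnorm (dev t0) + (\<Sum>s=t0..<t. vnorm (dev s))"
      unfolding dev_def by (rule sum_knot[OF t])
    also have "\<dots> \<le> real t0 * (sqrt (b * ?q) * (1 / sqrt (real t0))) + (\<Sum>s=t0..<t. sqrt (b * ?q) * (1 / sqrt (real s)))"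
      using dev_le(2) t by (intro add_mono mult_left_mono sum_mono) auto
    also have "\<dots> = sqrt (b * ?q) * (real t0 / sqrt (real t0) + (\<Sum>s=t0..<t. 1 / sqrt (real s)))"
      by (simp add: sum_distrib_left distrib_left)
    also have "\<dots> \<le> sqrt (b * ?q) * (sqrt (real t) + 2 * sqrt (real t))"
    proof (intro mult_left_mono add_mono)
      show "real t0 / sqrt (real t0) \<le> sqrt (real t)"
        using t by (simp add: real_div_sqrt)
      show "(\<Sum>s=t0..<t. 1 / sqrt (real s)) \<le> 2 * sqrt (real t)"
        using t t0 by (intro sum_inverse_sqrt_le) auto
    qed (use b q in auto)
    also have "\<dots> = 3 * sqrt b * sqrt (?q * real t)"
      by (simp add: real_sqrt_mult)
    finally have "L3 * (\<Sum>s=1..t. vnorm (knot s - \<theta>s)) \<le> L3 * (3 * sqrt b * sqrt (?q * real t))"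
      using L3 by (intro mult_left_mono) auto
    moreover have "lu * 1 \<le> lu * sqrt (?q * real t)"
      using qt lu by (intro mult_left_mono) auto
    ultimately show "lu + L3 * (\<Sum>s=1..t. vnorm (knot s - \<theta>s)) \<le> (lu + 3 * L3 * sqrt b) * sqrt (?q * real t)"
      by (simp add: algebra_simps)
  qed simp
  finally show "w \<bullet> ((\<Omega> t - info t) *\<^sub>v v) \<le> (lu + 3 * L3 * sqrt b) * sqrt (?q * real t) * vnorm v * vnorm w"
    by (simp add: mult_ac)
qed

text \<open>
  Subtracting the two linearised equations cancels the score at the true parameter. There remain the prior
  bias, the quadratic errors, whose sum over \<open>s\<close> of \<open>rate / s\<close> brings in the logarithm, and the covariance gap
  applied to \<open>dev t\<close>.
\<close>

lemma mean_gap: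
  assumes t: "t0 \<le> t" and \<Lambda>: "1 \<le> ln (real t / real t0)"
    and map_foc: "\<And>w. w \<in> carrier_vec p \<Longrightarrow>
      w \<bullet> (\<Omega>0 *\<^sub>v (\<theta> t0 - \<theta>0)) + (\<Sum>s=1..t0. w \<bullet> grad s (\<theta> t0)) = 0"
    and m: "m \<in> B" and ml_foc: "\<And>w. w \<in> carrier_vec p \<Longrightarrow> (\<Sum>s=1..t. w \<bullet> grad s m) = 0"
    and m_rate: "(vnorm (m - \<theta>s))\<^sup>2 \<le> c * rate p x t / real t" and c: "0 \<le> c"
    and bias: "vnorm (\<Omega>0 *\<^sub>v (\<theta>0 - \<theta>s)) \<le> \<beta> * rate p x t" and \<beta>: "0 \<le> \<beta>"
  shows "vnorm (info t *\<^sub>v (m - \<theta> t))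
    \<le> (\<beta> + 3 * L3 * b + (lu + 3 * L3 * sqrt b) * sqrt b + L3 * c) * rate p x t * ln (real t / real t0)"
proof (rule vnorm_le_by_testing)
  note st = stays_always
  let ?q = "rate p x t" and ?L = "ln (real t / real t0)"
  have q: "1 \<le> ?q" by (rule rate_pos[OF t])
  have tpos: "0 < real t" "0 < real t0" using t t0 by auto
  have th: "\<theta> t \<in> carrier_vec p" and mc: "m \<in> carrier_vec p"
    using B_carrier[OF in_B[OF t]] B_carrier[OF m] .
  have d: "dev t \<in> carrier_vec p" by (rule dev_carrier[OF t st])
  have md: "m - \<theta>s \<in> carrier_vec p" using mc thetas by simp
  show "info t *\<^sub>v (m - \<theta> t) \<in> carrier_vec p"
    using th mc by (intro mult_mat_vec_carrier[OF info_carrier]) auto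
  show "0 \<le> (\<beta> + 3 * L3 * b + (lu + 3 * L3 * sqrt b) * sqrt b + L3 * c) * ?q * ?L"
    using \<beta> L3 b lu c q \<Lambda> by (intro mult_nonneg_nonneg add_nonneg_nonneg) auto
  fix w :: rvec assume w: "w \<in> carrier_vec p"
  have O: "\<Omega> t \<in> carrier_mat p p" by (rule Omega_carrier_sym(1)[OF t st])
  have cc: "info t *\<^sub>v (m - \<theta>s) \<in> carrier_vec p" "info t *\<^sub>v dev t \<in> carrier_vec p" "\<Omega> t *\<^sub>v dev t \<in> carrier_vec p"
    "(\<Omega> t - info t) *\<^sub>v dev t \<in> carrier_vec p"
    using O d md mult_mat_vec_carrier[OF info_carrier] mult_mat_vec_carrier[OF minus_carrier_mat[OF info_carrier]] by auto
  have "m - \<theta> t = (m - \<theta>s) - dev t"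
    unfolding dev_def using mc th thetas by (intro eq_vecI) auto
  then have e1: "w \<bullet> (info t *\<^sub>v (m - \<theta> t)) = w \<bullet> (info t *\<^sub>v (m - \<theta>s)) - w \<bullet> (info t *\<^sub>v dev t)"
    using mult_minus_distrib_mat_vec[OF info_carrier md d, of t] scalar_prod_minus_distrib[OF w cc(1,2)] by simp
  have e2: "w \<bullet> ((\<Omega> t - info t) *\<^sub>v dev t) = w \<bullet> (\<Omega> t *\<^sub>v dev t) - w \<bullet> (info t *\<^sub>v dev t)"
    using minus_mult_distrib_mat_vec[OF O info_carrier d] scalar_prod_minus_distrib[OF w cc(3,2)] by simp
  have t1: "\<bar>w \<bullet> ((\<Omega> t - info t) *\<^sub>v dev t)\<bar> \<le> vnorm w * ((lu + 3 * L3 * sqrt b) * sqrt b * ?q)"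
  proof -
    have "\<bar>w \<bullet> ((\<Omega> t - info t) *\<^sub>v dev t)\<bar> \<le> vnorm w * vnorm ((\<Omega> t - info t) *\<^sub>v dev t)"
      by (rule scalar_prod_le_vnorm[OF w cc(4)])
    also have "\<dots> \<le> vnorm w * ((lu + 3 * L3 * sqrt b) * sqrt (?q * real t) * (sqrt (b * ?q) * (1 / sqrt (real t))))"
    proof (rule mult_left_mono[OF order_trans[OF covariance_gap[OF t d]]])
      show "(lu + 3 * L3 * sqrt b) * sqrt (?q * real t) * vnorm (dev t)
          \<le> (lu + 3 * L3 * sqrt b) * sqrt (?q * real t) * (sqrt (b * ?q) * (1 / sqrt (real t)))"
        using dev_le(2)[OF t order_refl] lu L3 b q by (intro mult_left_mono mult_nonneg_nonneg) auto
    qed simp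
    also have "sqrt (?q * real t) * (sqrt (b * ?q) * (1 / sqrt (real t))) = sqrt b * ?q"
      using tpos q by (simp add: real_sqrt_mult)
    then have "(lu + 3 * L3 * sqrt b) * sqrt (?q * real t) * (sqrt (b * ?q) * (1 / sqrt (real t)))
        = (lu + 3 * L3 * sqrt b) * sqrt b * ?q"
      by (simp only: mult.assoc)
    finally show ?thesis .
  qed
  have t2: "\<bar>w \<bullet> (info t *\<^sub>v (m - \<theta>s)) + (\<Sum>s=1..t. w \<bullet> grad s \<theta>s)\<bar> \<le> vnorm w * (L3 * c * ?q)"
  proof -
    have "real t * (vnorm (m - \<theta>s))\<^sup>2 \<le> c * ?q"
      using m_rate tpos by (simp add: field_simps)
    then have "L3 * vnorm w * (real t * (vnorm (m - \<theta>s))\<^sup>2) \<le> L3 * vnorm w * (c * ?q)"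
      using L3 by (intro mult_left_mono) auto
    then show ?thesis
      using ml_score[OF t m w ml_foc[OF w]] by (simp add: mult_ac)
  qed
  have t3: "\<bar>w \<bullet> (\<Omega> t *\<^sub>v dev t) + (\<Sum>s=1..t. w \<bullet> grad s \<theta>s) - w \<bullet> (\<Omega>0 *\<^sub>v (\<theta>0 - \<theta>s))\<bar>
      \<le> vnorm w * (3 * L3 * b * (?q * ?L))"
  proof -
    have "(\<Sum>s=1..t. (vnorm (knot s - \<theta>s))\<^sup>2) = real t0 * (vnorm (dev t0))\<^sup>2 + (\<Sum>s=t0..<t. (vnorm (dev s))\<^sup>2)"
      unfolding dev_def by (rule sum_knot[OF t, of "\<lambda>v. (vnorm (v - \<theta>s))\<^sup>2"])
    also have "\<dots> \<le> real t0 * (b * ?q * (1 / real t0)) + (\<Sum>s=t0..<t. b * ?q * (1 / real s))"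
      using dev_le(1) t by (intro add_mono mult_left_mono sum_mono) auto
    also have "\<dots> = b * ?q * (1 + (\<Sum>s=t0..<t. 1 / real s))"
      using tpos by (simp add: sum_distrib_left distrib_left)
    also have "\<dots> \<le> b * ?q * (3 * ?L)"
    proof (intro mult_left_mono)
      have "(\<Sum>s=t0..<t. 1 / real s) \<le> 1 / real t0 + ?L"
        using t t0 by (intro sum_inverse_le_ln) auto
      moreover have "1 / real t0 \<le> 1" using t0 by simp
      ultimately show "1 + (\<Sum>s=t0..<t. 1 / real s) \<le> 3 * ?L" using \<Lambda> by linarith
    qed (use b q in auto)
    finally have "L3 * vnorm w * (\<Sum>s=1..t. (vnorm (knot s - \<theta>s))\<^sup>2) \<le> L3 * vnorm w * (b * ?q * (3 * ?L))"
      using L3 by (intro mult_left_mono) auto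
    then show ?thesis
      using linearised_score[OF t st w map_foc] by (simp add: mult_ac)
  qed
  have t4: "\<bar>w \<bullet> (\<Omega>0 *\<^sub>v (\<theta>0 - \<theta>s))\<bar> \<le> vnorm w * (\<beta> * ?q)"
  proof -
    have "\<Omega>0 *\<^sub>v (\<theta>0 - \<theta>s) \<in> carrier_vec p" using Omega0 theta0 thetas by auto
    from scalar_prod_le_vnorm[OF w this] show ?thesis
      using mult_left_mono[OF bias, of "vnorm w"] by simp
  qed
  define s where "s = (lu + 3 * L3 * sqrt b) * sqrt b"
  have s0: "0 \<le> s" using lu L3 b by (simp add: s_def)
  have "w \<bullet> (info t *\<^sub>v (m - \<theta> t))
      \<le> vnorm w * (s * ?q) + vnorm w * (L3 * c * ?q) + vnorm w * (3 * L3 * b * (?q * ?L)) + vnorm w * (\<beta> * ?q)"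
    using e1 e2 t1 t2 t3 t4 unfolding s_def by linarith
  also have "\<dots> = vnorm w * ((s + L3 * c + \<beta>) * ?q * 1 + 3 * L3 * b * (?q * ?L))"
    by (simp add: algebra_simps)
  also have "\<dots> \<le> vnorm w * ((s + L3 * c + \<beta>) * ?q * ?L + 3 * L3 * b * (?q * ?L))"
    using \<Lambda> s0 L3 c \<beta> q by (intro mult_left_mono add_right_mono mult_nonneg_nonneg) auto
  also have "\<dots> = (\<beta> + 3 * L3 * b + s + L3 * c) * ?q * ?L * vnorm w"
    by (simp add: algebra_simps)
  finally show "w \<bullet> (info t *\<^sub>v (m - \<theta> t))
      \<le> (\<beta> + 3 * L3 * b + (lu + 3 * L3 * sqrt b) * sqrt b + L3 * c) * ?q * ?L * vnorm w"
    unfolding s_def .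
qed

end
end

section \<open>First-order conditions\<close>

lemma sum_line_derivative:
  assumes tw: "\<And>s. s \<in> {1..t} \<Longrightarrow> twice_differentiable p (l s)" and th: "\<theta> \<in> carrier_vec p" and w: "w \<in> carrier_vec p"
  shows "((\<lambda>u. \<Sum>s=1..t. l s (\<theta> + u \<cdot>\<^sub>v w)) has_real_derivative (\<Sum>s=1..t. w \<bullet> gradient p (l s) \<theta>)) (at 0)"
proof (rule DERIV_sum)
  fix s assume s: "s \<in> {1..t}"
  have "\<theta> + 0 \<cdot>\<^sub>v w = \<theta>" using th w by (intro eq_vecI) auto
  then show "((\<lambda>u. l s (\<theta> + u \<cdot>\<^sub>v w)) has_real_derivative w \<bullet> gradient p (l s) \<theta>) (at 0)"
    using loss_line_derivative[OF tw[OF s] th w, of 0] gradient_carrier[OF tw[OF s] th] w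
    by (simp add: comm_scalar_prod[of w p])
qed

lemma quadratic_line_derivative:
  fixes A :: rmat
  assumes A: "A \<in> carrier_mat p p" "transpose_mat A = A" and a: "a \<in> carrier_vec p" and w: "w \<in> carrier_vec p"
  shows "((\<lambda>u. 1 / 2 * ((a + u \<cdot>\<^sub>v w) \<bullet> (A *\<^sub>v (a + u \<cdot>\<^sub>v w)))) has_real_derivative w \<bullet> (A *\<^sub>v a)) (at 0)"
proof -
  have Aa: "A *\<^sub>v a \<in> carrier_vec p" "A *\<^sub>v w \<in> carrier_vec p" using A a w by auto
  have sym: "a \<bullet> (A *\<^sub>v w) = w \<bullet> (A *\<^sub>v a)" by (rule bilinear_symmetric[OF A w a])
  have "(a + u \<cdot>\<^sub>v w) \<bullet> (A *\<^sub>v (a + u \<cdot>\<^sub>v w))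
      = a \<bullet> (A *\<^sub>v a) + 2 * u * (w \<bullet> (A *\<^sub>v a)) + u\<^sup>2 * (w \<bullet> (A *\<^sub>v w))" for u
  proof -
    have "A *\<^sub>v (a + u \<cdot>\<^sub>v w) = A *\<^sub>v a + u \<cdot>\<^sub>v (A *\<^sub>v w)"
      using A a w by (simp add: mult_add_distrib_mat_vec[of _ p p] mult_mat_vec[of _ p p])
    then show ?thesis
      using a w Aa sym
      by (simp add: scalar_prod_add_distrib[of _ p] add_scalar_prod_distrib[of _ p] power2_eq_square algebra_simps)
  qed
  then show ?thesis
    by (auto intro!: derivative_eq_intros)
qed

lemma derivative_zero_at_minimum:
  fixes f :: "real \<Rightarrow> real"
  assumes "(f has_real_derivative D) (at 0)" "\<And>u. f 0 \<le> f u"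
  shows "D = 0"
  by (rule DERIV_local_min[OF assms(1), of 1]) (use assms(2) in auto)

lemma ml_first_order:
  assumes min: "minimises S (ml_objective S \<omega> t) m"
    and tw: "\<And>s. s \<in> {1..t} \<Longrightarrow> twice_differentiable (dim S) (loss S \<omega> s)"
    and w: "w \<in> carrier_vec (dim S)"
  shows "(\<Sum>s=1..t. w \<bullet> gradient (dim S) (loss S \<omega> s) m) = 0"
proof (rule derivative_zero_at_minimum)
  have m: "m \<in> carrier_vec (dim S)" using min by (simp add: is_arg_min_def)
  show "((\<lambda>u. \<Sum>s=1..t. loss S \<omega> s (m + u \<cdot>\<^sub>v w)) has_real_derivative
      (\<Sum>s=1..t. w \<bullet> gradient (dim S) (loss S \<omega> s) m)) (at 0)"
    by (rule sum_line_derivative[OF tw m w])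
  fix u :: real
  have "m + 0 \<cdot>\<^sub>v w = m" using m w by (intro eq_vecI) auto
  moreover have "m + u \<cdot>\<^sub>v w \<in> carrier_vec (dim S)" using m w by simp
  ultimately show "(\<Sum>s=1..t. loss S \<omega> s (m + 0 \<cdot>\<^sub>v w)) \<le> (\<Sum>s=1..t. loss S \<omega> s (m + u \<cdot>\<^sub>v w))"
    using min by (auto simp: is_arg_min_linorder ml_objective_def)
qed

lemma map_first_order:
  assumes min: "minimises S (map_objective S \<omega> t) m"
    and tw: "\<And>s. s \<in> {1..t} \<Longrightarrow> twice_differentiable (dim S) (loss S \<omega> s)"
    and O: "psd (Omega0 S)" "Omega0 S \<in> carrier_mat (dim S) (dim S)"
    and th0: "theta0 S \<in> carrier_vec (dim S)" and w: "w \<in> carrier_vec (dim S)"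
  shows "w \<bullet> (Omega0 S *\<^sub>v (m - theta0 S)) + (\<Sum>s=1..t. w \<bullet> gradient (dim S) (loss S \<omega> s) m) = 0"
proof (rule derivative_zero_at_minimum)
  have m: "m \<in> carrier_vec (dim S)" using min by (simp add: is_arg_min_def)
  let ?a = "m - theta0 S"
  have a: "?a \<in> carrier_vec (dim S)" using m th0 by simp
  let ?f = "\<lambda>u. 1 / 2 * ((?a + u \<cdot>\<^sub>v w) \<bullet> (Omega0 S *\<^sub>v (?a + u \<cdot>\<^sub>v w))) + (\<Sum>s=1..t. loss S \<omega> s (m + u \<cdot>\<^sub>v w))"
  show "(?f has_real_derivative
      w \<bullet> (Omega0 S *\<^sub>v ?a) + (\<Sum>s=1..t. w \<bullet> gradient (dim S) (loss S \<omega> s) m)) (at 0)"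
    using O by (intro DERIV_add sum_line_derivative[OF tw m w] quadratic_line_derivative[OF O(2) _ a w])
      (auto simp: psd_def)
  have obj: "?f u = map_objective S \<omega> t (m + u \<cdot>\<^sub>v w)" for u
  proof -
    have "m + u \<cdot>\<^sub>v w - theta0 S = ?a + u \<cdot>\<^sub>v w" using m w th0 by (intro eq_vecI) auto
    moreover have "?a + u \<cdot>\<^sub>v w \<in> carrier_vec (dim S)" using a w by simp
    ultimately show ?thesis
      using vnorm_mat_sqrt_sq[OF O, of "?a + u \<cdot>\<^sub>v w"] by (simp add: map_objective_def)
  qed
  fix u :: real
  have "m + 0 \<cdot>\<^sub>v w = m" using m w by (intro eq_vecI) auto
  moreover have "m + u \<cdot>\<^sub>v w \<in> carrier_vec (dim S)" using m w by simp
  ultimately show "?f 0 \<le> ?f u"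
    unfolding obj using min by (auto simp: is_arg_min_linorder)
qed

section \<open>Realisations of the model\<close>

lemma loewner_double_psd:
  fixes F :: rmat
  assumes F: "F \<in> carrier_mat p p" and le: "F \<preceq> 2 \<cdot>\<^sub>m F"
  shows "psd F"
proof -
  have "2 \<cdot>\<^sub>m F - F = F" using F by (intro eq_matI) auto
  then show ?thesis using le by (simp add: loewner_le_def)
qed

text \<open>
  At \<open>h = 0\<close> the regularity condition says that the cumulative Hessians are positive semi-definite. The
  constant \<open>L1\<close> is enlarged because the comparison of second derivatives works with a positive rate.
\<close>

lemma smooth_losses_model:
  assumes spec: "correctly_specified S" and bas: "basic S Kb ll lu" and sm: "smoothness S r L1 L2"
    and reg: "hessian_regularity S r L3 K6" and \<omega>: "\<omega> \<in> space (prob S)"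
    and c: "0 < r" "0 \<le> L1" "0 < L2" "0 < L3"
  shows "smooth_losses (dim S) (loss S \<omega>) (theta_star S) r (L1 + 1) L2 L3"
proof
  show "0 < dim S" and ts: "theta_star S \<in> carrier_vec (dim S)"
    using spec by (auto simp: correctly_specified_def)
  show "twice_differentiable (dim S) (loss S \<omega> t)" if "1 \<le> t" for t
    using bas \<omega> that by (auto simp: basic_def)
  note B = Theta_ball_def[of S r, symmetric]
  fix t :: nat and \<theta> assume t: "1 \<le> t" and th: "\<theta> \<in> {\<theta> \<in> carrier_vec (dim S). vnorm (\<theta> - theta_star S) \<le> r}"
  then have th: "\<theta> \<in> Theta_ball S r" by (simp add: Theta_ball_def)
  show "op_norm (hessian (dim S) (loss S \<omega> t) \<theta>) \<le> L2"
    using sm \<omega> t th by (auto simp: smoothness_def hess_loss_def)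
  have thc: "\<theta> \<in> carrier_vec (dim S)" using th by (simp add: Theta_ball_def)
  have z: "\<theta> + 0\<^sub>v (dim S) = \<theta>" using thc by simp
  have "F_mat S \<omega> t (\<theta> + 0\<^sub>v (dim S)) \<preceq> (1 + exp (K6 * vnorm (0\<^sub>v (dim S)))) \<cdot>\<^sub>m F_mat S \<omega> t \<theta>"
    using reg \<omega> t th z unfolding hessian_regularity_def by (metis zero_carrier_vec)
  then have "F_mat S \<omega> t \<theta> \<preceq> 2 \<cdot>\<^sub>m F_mat S \<omega> t \<theta>"
    unfolding z by simp
  then have "psd (F_mat S \<omega> t \<theta>)"
    by (rule loewner_double_psd[of _ "dim S", rotated]) (simp add: F_mat_def)
  then show "psd (mat_sum (dim S) (\<lambda>s. hessian (dim S) (loss S \<omega> s) \<theta>) {1..t})"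
    by (simp add: F_mat_def hess_loss_def)
  fix \<theta>' assume "\<theta>' \<in> {\<theta> \<in> carrier_vec (dim S). vnorm (\<theta> - theta_star S) \<le> r}"
  then have th': "\<theta>' \<in> Theta_ball S r" by (simp add: Theta_ball_def)
  show "op_norm (hessian (dim S) (loss S \<omega> t) \<theta> - hessian (dim S) (loss S \<omega> t) \<theta>') \<le> L3 * vnorm (\<theta> - \<theta>')"
    using reg \<omega> t th th' by (auto simp: hessian_regularity_def hess_loss_def)
  obtain \<phi> where phi: "0 \<le> \<phi>" "\<phi> \<le> L1 * vnorm (\<theta> - \<theta>')"
    and ex: "\<exists>u\<in>{0..1}. let \<eta> = \<theta>' + u \<cdot>\<^sub>v (\<theta> - \<theta>') in
             hess_loss S \<omega> t \<theta> \<preceq> (1 + \<phi>) \<cdot>\<^sub>m hess_loss S \<omega> t \<eta> \<and>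
             loss S \<omega> t \<theta> = loss S \<omega> t \<theta>' + grad_loss S \<omega> t \<theta>' \<bullet> (\<theta> - \<theta>') +
               1 / 2 * mat_inner (hess_loss S \<omega> t \<eta>) (outer (\<theta> - \<theta>'))"
    using sm \<omega> t th th' unfolding smoothness_def by blast
  have "\<phi> \<le> (L1 + 1) * vnorm (\<theta> - \<theta>')"
    using phi(2) vnorm_nonneg[of "\<theta> - \<theta>'"] by (simp add: distrib_right del: vnorm_nonneg)
  with phi(1) ex show "\<exists>\<phi>\<ge>0. \<phi> \<le> (L1 + 1) * vnorm (\<theta> - \<theta>') \<and>
        (\<exists>u\<in>{0..1}. let \<eta> = \<theta>' + u \<cdot>\<^sub>v (\<theta> - \<theta>') in
           hessian (dim S) (loss S \<omega> t) \<theta> \<preceq> (1 + \<phi>) \<cdot>\<^sub>m hessian (dim S) (loss S \<omega> t) \<eta> \<and>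
           loss S \<omega> t \<theta> = loss S \<omega> t \<theta>' + gradient (dim S) (loss S \<omega> t) \<theta>' \<bullet> (\<theta> - \<theta>') +
             1 / 2 * mat_inner (hessian (dim S) (loss S \<omega> t) \<eta>) (outer (\<theta> - \<theta>')))"
    unfolding hess_loss_def grad_loss_def by blast
qed (use c in auto)

lemma Omega0_psd:
  assumes "basic S Kb ll lu"
  shows "psd (Omega0 S)" "\<And>v. v \<in> carrier_vec (dim S) \<Longrightarrow> v \<bullet> (Omega0 S *\<^sub>v v) \<le> lu * (v \<bullet> v)" "0 < lu"
proof -
  have O: "Omega0 S \<in> carrier_mat (dim S) (dim S)" "transpose_mat (Omega0 S) = Omega0 S"
    and l: "0 < lambda_min (Omega0 S)" "lambda_max (Omega0 S) \<le> lu" "0 < lu"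
    using assms by (auto simp: basic_def)
  show "0 < lu" by (rule l(3))
  have vv: "0 \<le> v \<bullet> v" for v :: rvec by (simp flip: vnorm_sq)
  have "0 \<le> v \<bullet> (Omega0 S *\<^sub>v v)" if v: "v \<in> carrier_vec (dim S)" for v
    using rayleigh_bounds(1)[OF O v] mult_nonneg_nonneg[OF less_imp_le[OF l(1)] vv[of v]] by linarith
  then show "psd (Omega0 S)" using O by (auto simp: psd_def)
  show "v \<bullet> (Omega0 S *\<^sub>v v) \<le> lu * (v \<bullet> v)" if v: "v \<in> carrier_vec (dim S)" for v
    using rayleigh_bounds(2)[OF O v] mult_right_mono[OF l(2) vv[of v]] by linarith
qed

lemma run_at_phase_transition:
  assumes "1 \<le> t0"
  shows "theta_run S t0 \<omega> t0 = map_est S t0 \<omega>"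
    "Omega_run S t0 \<omega> t0 = Omega0 S + F_mat S \<omega> t0 (map_est S t0 \<omega>)"
  using assms by (cases t0; simp add: theta_run_def Omega_run_def)+

lemma run_after_phase_transition:
  assumes "t0 \<le> t"
  shows "Omega_run S t0 \<omega> (Suc t) = Omega_run S t0 \<omega> t + hess_loss S \<omega> (Suc t) (theta_run S t0 \<omega> t)"
    "theta_run S t0 \<omega> (Suc t) = theta_run S t0 \<omega> t -
      minv (Omega_run S t0 \<omega> (Suc t)) *\<^sub>v grad_loss S \<omega> (Suc t) (theta_run S t0 \<omega> t)"
  using assms by (simp_all add: theta_run_def Omega_run_def Let_def)

lemma le_t_exit:
  assumes "\<And>s. t0 < s \<Longrightarrow> s < t \<Longrightarrow> theta_run S t0 \<omega> s \<in> Theta_ball S r"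
  shows "enat t \<le> t_exit S t0 r \<omega>"
  unfolding t_exit_def
proof (rule Inf_greatest)
  fix i assume "i \<in> enat ` {t. t0 < t \<and> theta_run S t0 \<omega> t \<notin> Theta_ball S r}"
  then obtain s where s: "i = enat s" "t0 < s" "theta_run S t0 \<omega> s \<notin> Theta_ball S r" by auto
  then have "t \<le> s" using assms[of s] by (meson not_le)
  then show "enat t \<le> i" using s(1) by simp
qed

text \<open>
  The integral over a set is bounded through the simple functions below the integrand, so that densities
  of any kind are covered. If the normalising constant is \<open>0\<close> or \<open>\<infinity>\<close>, the posterior takes values in
  \<open>{0, \<infinity>}\<close>, and the real-valued \<^const>\<open>measure\<close> vanishes.
\<close>

lemma posterior_measure_le_1:
  "measure (posterior S \<omega> t) A \<le> 1"
proof -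
  define f where "f \<theta> = ennreal (exp (- (\<Sum>s=1..t. loss S \<omega> s \<theta>)))" for \<theta>
  define Z where "Z = (\<integral>\<^sup>+\<theta>. f \<theta> \<partial>prior S)"
  have post: "posterior S \<omega> t = density (prior S) (\<lambda>\<theta>. f \<theta> / Z)"
    by (simp add: posterior_def f_def Z_def)
  have em: "emeasure (density M g) A = 0 \<or> emeasure (density M g) A = (\<integral>\<^sup>+x. g x * indicator A x \<partial>M)" for M :: "rvec measure" and g
    unfolding density_def by (auto simp: emeasure_measure_of_conv)
  consider "Z = 0" | "Z = \<infinity>" | "0 < Z" "Z < \<infinity>"
    by (metis ennreal_zero_neq_top infinity_ennreal_def less_top not_gr_zero)
  then show ?thesis
  proof cases
    case 1
    have f0: "f \<theta> / Z = \<infinity>" for \<theta> using 1 by (simp add: f_def divide_ennreal_def ennreal_mult_eq_top_iff)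
    have "emeasure (posterior S \<omega> t) A = 0 \<or> emeasure (posterior S \<omega> t) A = \<infinity>"
    proof (cases "A \<in> sets (prior S)")
      case True
      have "emeasure (posterior S \<omega> t) A = \<infinity> * emeasure (prior S) A"
        unfolding post f0 using True
        by (subst emeasure_density) (simp_all only: nn_integral_cmult_indicator borel_measurable_const)
      then show ?thesis by (simp add: ennreal_top_mult)
    next
      case False
      then show ?thesis unfolding post by (simp add: emeasure_notin_sets)
    qed
    then show ?thesis by (auto simp: measure_def)
  next
    case 2
    then have f0: "(\<lambda>\<theta>. f \<theta> / Z) = (\<lambda>_. 0)" by simp
    have "emeasure (posterior S \<omega> t) A = 0"
      using em[of "prior S" "\<lambda>_. 0"] unfolding post f0 by simp
    then show ?thesis by (simp add: measure_def)
  next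
    case 3
    have "(\<integral>\<^sup>+x. f x / Z * indicator A x \<partial>prior S) \<le> 1"
      unfolding nn_integral_def
    proof (rule SUP_least)
      fix g assume g: "g \<in> {g. simple_function (prior S) g \<and> g \<le> (\<lambda>x. f x / Z * indicator A x)}"
      have "Z * integral\<^sup>S (prior S) g = (\<integral>\<^sup>+x. Z * g x \<partial>prior S)"
        using g by (simp add: nn_integral_cmult borel_measurable_simple_function nn_integral_eq_simple_integral)
      also have "\<dots> \<le> Z"
        unfolding Z_def[symmetric]
      proof (subst (2) Z_def, rule nn_integral_mono)
        fix x
        have "g x \<le> f x / Z * indicator A x" using g by (auto simp: le_fun_def)
        then have "g x \<le> f x / Z" by (cases "x \<in> A") auto
        then have "Z * g x \<le> Z * (f x / Z)" by (rule mult_left_mono) simp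
        also have "\<dots> = f x"
          using 3 ennreal_mult_divide_eq[of Z "f x"] by (simp add: ennreal_times_divide mult.commute)
        finally show "Z * g x \<le> f x" .
      qed
      finally have "Z * integral\<^sup>S (prior S) g \<le> Z * 1" by simp
      then show "integral\<^sup>S (prior S) g \<le> 1"
        using 3 by (subst (asm) ennreal_mult_le_mult_iff) auto
    qed
    then have "emeasure (posterior S \<omega> t) A \<le> 1"
      using em[of "prior S" "\<lambda>\<theta>. f \<theta> / Z"] unfolding post by auto
    then show ?thesis
      unfolding measure_def using enn2real_mono[of _ 1] by auto
  qed
qed

section \<open>Constants and the main bound\<close>

text \<open>The factor \<open>b\<close> in the bound \<open>b * rate p x t / t\<close> on the squared distance of \<open>\<theta>\<^sub>t\<close> from the true parameter.\<close>

definition energy_const :: "real \<Rightarrow> real \<Rightarrow> real \<Rightarrow> real \<Rightarrow> real \<Rightarrow> real" where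
  "energy_const C K2 K3 K4 K5 = (C + 2 * K3 + K4 + 2 * K5 + 1) / K2"

definition bias_const :: "real \<Rightarrow> real \<Rightarrow> real \<Rightarrow> real \<Rightarrow> real" where
  "bias_const C L2 lu M = C * sqrt 2 * (lu + 2 * L2 * sqrt (M + 1))"

definition gap_const :: "real \<Rightarrow> real \<Rightarrow> real \<Rightarrow> real" where
  "gap_const b L3 lu = lu + 3 * L3 * sqrt b"

definition tv_const :: "real \<Rightarrow> real \<Rightarrow> real \<Rightarrow> real \<Rightarrow> real \<Rightarrow> real \<Rightarrow> real \<Rightarrow> real" where
  "tv_const C K2 b L2 L3 lu M =
     (bias_const C L2 lu M + 3 * L3 * b + gap_const b L3 lu * sqrt b + L3 * (2 * C\<^sup>2)) / sqrt K2
     + gap_const b L3 lu / K2"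

text \<open>
  Large enough for the estimators and the iterates to stay in the ball and for the cubic errors of the
  Newton steps to sum to at most the rate; \<open>b\<close> stands for the energy constant.
\<close>

definition burn_in :: "real \<Rightarrow> real \<Rightarrow> real \<Rightarrow> real \<Rightarrow> real \<Rightarrow> real" where
  "burn_in C b L1 L2 r =
     max 3 ((3 / min (r\<^sup>2 / (2 * C\<^sup>2)) (min (r\<^sup>2 / b) (1 / (b * (16 * (L1 + 1) * L2 * b)\<^sup>2))))\<^sup>2)"

lemma burn_in_suffices:
  assumes "0 < C" "0 < b" "0 \<le> L1" "0 < L2" "0 < r"
  shows "3 \<le> burn_in C b L1 L2 r"
    and "2 * C\<^sup>2 * (3 / sqrt (burn_in C b L1 L2 r)) \<le> r\<^sup>2"
    and "b * (3 / sqrt (burn_in C b L1 L2 r)) \<le> r\<^sup>2"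
    and "16 * (L1 + 1) * L2 * b * sqrt (b * (3 / sqrt (burn_in C b L1 L2 r))) \<le> 1"
proof -
  define c where "c = 16 * (L1 + 1) * L2 * b"
  have c: "0 < c" using assms by (simp add: c_def)
  define k where "k = min (r\<^sup>2 / (2 * C\<^sup>2)) (min (r\<^sup>2 / b) (1 / (b * c\<^sup>2)))"
  have k: "0 < k" "k \<le> r\<^sup>2 / (2 * C\<^sup>2)" "k \<le> r\<^sup>2 / b" "k \<le> 1 / (b * c\<^sup>2)"
    using assms c by (auto simp: k_def)
  define M where "M = burn_in C b L1 L2 r"
  have M: "3 \<le> M" "(3 / k)\<^sup>2 \<le> M" by (simp_all add: M_def burn_in_def k_def c_def)
  have "3 / k \<le> sqrt M" using M(2) by (rule real_le_rsqrt)
  then have small: "3 / sqrt M \<le> k" using k(1) M(1) by (simp add: field_simps)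
  show "3 \<le> burn_in C b L1 L2 r" using M(1) by (simp add: M_def)
  show "2 * C\<^sup>2 * (3 / sqrt (burn_in C b L1 L2 r)) \<le> r\<^sup>2"
    using order_trans[OF small k(2)] assms unfolding M_def[symmetric] by (simp add: pos_le_divide_eq mult_ac)
  show "b * (3 / sqrt (burn_in C b L1 L2 r)) \<le> r\<^sup>2"
    using order_trans[OF small k(3)] assms unfolding M_def[symmetric] by (simp add: pos_le_divide_eq mult_ac)
  have "b * (3 / sqrt M) \<le> b * (1 / (b * c\<^sup>2))"
    using order_trans[OF small k(4)] assms by (intro mult_left_mono) auto
  also have "\<dots> = (1 / c)\<^sup>2" using assms by (simp add: power_divide)
  finally have "sqrt (b * (3 / sqrt M)) \<le> 1 / c"
    using c by (intro real_le_lsqrt) auto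
  then have "c * sqrt (b * (3 / sqrt M)) \<le> 1" using c by (simp add: pos_le_divide_eq mult.commute)
  then show "16 * (L1 + 1) * L2 * b * sqrt (b * (3 / sqrt (burn_in C b L1 L2 r))) \<le> 1"
    by (simp add: c_def M_def)
qed

text \<open>The hypotheses of the theorem on the model, for fixed constants.\<close>

locale model_setting =
  fixes S :: "('w, 'y) model"
    and Kb C K1 K2 K3 K4 K5 K6 L1 L2 L3 lu r x ll M :: real
    and E1 :: "'w set" and E4 :: "nat \<Rightarrow> 'w set"
  assumes C: "0 < C" and K: "0 < K2" "0 < K3" "0 < K4" "0 \<le> K5"
    and L: "0 \<le> L1" "0 < L2" "0 < L3" and r: "0 < r" and x: "0 < x"
    and spec: "correctly_specified S" and est: "estimators S" and bas: "basic S Kb ll lu"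
    and curv: "curvature S r x K1 K2 E1" and sm: "smoothness S r L1 L2"
    and reg: "hessian_regularity S r L3 K6"
    and warm: "\<And>t0. warm_start_time (dim S) x M t0 \<Longrightarrow> warm_start S t0 x C (E4 t0)"
    and M3: "3 \<le> M"
    and M_est: "2 * C\<^sup>2 * (3 / sqrt M) \<le> r\<^sup>2"
    and M_dev: "energy_const C K2 K3 K4 K5 * (3 / sqrt M) \<le> r\<^sup>2"
    and M_cubic: "16 * (L1 + 1) * L2 * energy_const C K2 K3 K4 K5 *
      sqrt (energy_const C K2 K3 K4 K5 * (3 / sqrt M)) \<le> 1"
begin

abbreviation p where "p \<equiv> dim S"
abbreviation \<theta>s where "\<theta>s \<equiv> theta_star S"

abbreviation b where "b \<equiv> energy_const C K2 K3 K4 K5"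
abbreviation \<kappa> where "\<kappa> \<equiv> 3 / sqrt M"
abbreviation bias where "bias \<equiv> bias_const C L2 lu M"
abbreviation gap where "gap \<equiv> gap_const b L3 lu"
abbreviation K_tv where "K_tv \<equiv> tv_const C K2 b L2 L3 lu M"

lemma p1: "1 \<le> p" and thetas: "\<theta>s \<in> carrier_vec p"
  using spec by (auto simp: correctly_specified_def)

lemma b_pos: "0 < b"
  using C K by (simp add: energy_const_def)

lemma kappa_pos: "0 < \<kappa>"
  using M3 by simp

definition P where "P = real p * ln (max (real p) 3)"

lemma P_ge: "real p \<le> P" "1 \<le> P"
proof -
  have "exp 1 \<le> max (real p) 3" using exp_le by simp
  then have "1 \<le> ln (max (real p) 3)" by (subst ln_ge_iff) auto
  then have "real p * 1 \<le> P" unfolding P_def by (intro mult_left_mono) auto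
  then show "real p \<le> P" "1 \<le> P" using p1 by auto
qed

lemma warm_time_iff: "warm_start_time p x M t0 \<longleftrightarrow> M * (P + x) \<le> real t0"
  by (simp add: warm_start_time_def P_def ceiling_le_iff)

lemma warm_time_ge:
  assumes "warm_start_time p x M t0"
  shows "3 \<le> t0" "real p \<le> real t0" "P + x \<le> real t0"
proof -
  define y where "y = P + x"
  have y: "1 \<le> y" "real p \<le> y" using P_ge x by (auto simp: y_def)
  have t0: "M * y \<le> real t0" using assms by (simp add: warm_time_iff y_def)
  have "3 * y \<le> M * y" using M3 y by (intro mult_right_mono) auto
  then have le: "3 * y \<le> real t0" using t0 by simp
  then have "3 \<le> real t0" using y by linarith
  then show "3 \<le> t0" by simp
  have "y \<le> real t0" using le y by linarith
  then show "real p \<le> real t0" "P + x \<le> real t0" using y by (auto simp: y_def)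
qed

lemma rate_small:
  assumes "warm_start_time p x M t0" "t0 \<le> s"
  shows "rate p x s \<le> \<kappa> * sqrt (real t0 * real s)"
  using assms M3 p1 x unfolding warm_time_iff P_def
  by (intro rate_le_after_burn_in) auto

lemma rate_div_le:
  assumes "warm_start_time p x M t0" "t0 \<le> t"
  shows "rate p x t / real t \<le> \<kappa>"
proof -
  have t: "0 < real t" using warm_time_ge(1)[OF assms(1)] assms(2) by simp
  have "sqrt (real t0 * real t) \<le> real t"
    using assms(2) by (intro real_le_lsqrt) (auto simp: power2_eq_square mult_right_mono)
  then have "\<kappa> * sqrt (real t0 * real t) \<le> \<kappa> * real t"
    using kappa_pos by (intro mult_left_mono) auto
  with rate_small[OF assms] have "rate p x t \<le> \<kappa> * real t"
    by (rule order_trans)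
  then show ?thesis
    by (simp only: pos_divide_le_eq[OF t])
qed

lemma estimates:
  assumes t0: "warm_start_time p x M t0" and \<omega>: "\<omega> \<in> E4 t0" and t: "t0 \<le> t"
  shows "minimises S (map_objective S \<omega> t) (map_est S t \<omega>)" "minimises S (ml_objective S \<omega> t) (ml_est S t \<omega>)"
    "vnorm (map_est S t \<omega> - \<theta>s) \<le> C * sqrt (2 * rate p x t / real t)"
    "vnorm (ml_est S t \<omega> - \<theta>s) \<le> C * sqrt (2 * rate p x t / real t)"
proof -
  note ws = warm[OF t0]
  have sp: "\<omega> \<in> space (prob S)"
    using ws \<omega> sets.sets_into_space by (fastforce simp: warm_start_def event_at_level_def)
  have t3: "3 \<le> t" using warm_time_ge(1)[OF t0] t by simp
  have ex: "Ex (minimises S (map_objective S \<omega> t))" "Ex (minimises S (ml_objective S \<omega> t))"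
    and le: "max (vnorm (map_est S t \<omega> - \<theta>s)) (vnorm (ml_est S t \<omega> - \<theta>s))
          \<le> C * sqrt ((real p + ln (real t) + x) / real t)"
    using ws \<omega> t by (auto simp: warm_start_def)
  show "minimises S (map_objective S \<omega> t) (map_est S t \<omega>)" "minimises S (ml_objective S \<omega> t) (ml_est S t \<omega>)"
    using est sp t3 ex unfolding estimators_def by auto
  have "C * sqrt ((real p + ln (real t) + x) / real t) \<le> C * sqrt (2 * rate p x t / real t)"
    using rate_ge(3)[OF t3 p1 x] C by (intro mult_left_mono real_sqrt_le_mono divide_right_mono) auto
  with le show "vnorm (map_est S t \<omega> - \<theta>s) \<le> C * sqrt (2 * rate p x t / real t)"
    "vnorm (ml_est S t \<omega> - \<theta>s) \<le> C * sqrt (2 * rate p x t / real t)" by auto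
qed

lemma in_ball:
  assumes t0: "warm_start_time p x M t0" and t: "t0 \<le> t" and v: "v \<in> carrier_vec p"
    and le: "vnorm (v - \<theta>s) \<le> C * sqrt (2 * rate p x t / real t)"
  shows "v \<in> Theta_ball S r" "(vnorm (v - \<theta>s))\<^sup>2 \<le> 2 * C\<^sup>2 * rate p x t / real t"
proof -
  have t3: "3 \<le> t" using warm_time_ge(1)[OF t0] t by simp
  have q: "0 \<le> rate p x t" using rate_ge(4)[OF t3 p1 x] by simp
  have "(vnorm (v - \<theta>s))\<^sup>2 \<le> (C * sqrt (2 * rate p x t / real t))\<^sup>2"
    using le by (intro power_mono) auto
  also have "\<dots> = 2 * C\<^sup>2 * rate p x t / real t"
    using q by (simp add: power_mult_distrib)
  finally show sq: "(vnorm (v - \<theta>s))\<^sup>2 \<le> 2 * C\<^sup>2 * rate p x t / real t" .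
  also have "\<dots> = 2 * C\<^sup>2 * (rate p x t / real t)" by simp
  also have "\<dots> \<le> 2 * C\<^sup>2 * \<kappa>"
    by (intro mult_left_mono rate_div_le[OF t0 t]) simp
  finally have "(vnorm (v - \<theta>s))\<^sup>2 \<le> r\<^sup>2" using M_est by simp
  then have "vnorm (v - \<theta>s) \<le> r" using r by (rule power2_le_imp_le[OF _ less_imp_le])
  then show "v \<in> Theta_ball S r" using v by (simp add: Theta_ball_def)
qed

lemma smooth_path: "\<omega> \<in> space (prob S) \<Longrightarrow> smooth_losses p (loss S \<omega>) \<theta>s r (L1 + 1) L2 L3"
  using smooth_losses_model[OF spec bas sm reg _ r L] .

text \<open>
  The prior bias is non-random, so it may be bounded on any event of positive probability. At the
  smallest admissible time the difference of the first-order conditions of the two estimators expresses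
  the bias through their distances from the true parameter and from each other.
\<close>

lemma prior_bias:
  assumes t0: "warm_start_time p x M t0" and t: "t0 \<le> t"
  shows "vnorm (Omega0 S *\<^sub>v (theta0 S - \<theta>s)) \<le> bias * rate p x t"
proof -
  \<comment> \<open>the smallest admissible phase transition time\<close>
  define t' where "t' = nat \<lceil>M * (P + x)\<rceil>"
  have Px: "1 \<le> P + x" using P_ge x by simp
  have MPx: "0 < M * (P + x)" using M3 Px by (intro mult_pos_pos) auto
  have t'ge: "M * (P + x) \<le> real t'" and t'le: "real t' \<le> M * (P + x) + 1"
    unfolding t'_def using MPx by linarith+
  have wt': "warm_start_time p x M t'" using t'ge by (simp add: warm_time_iff)
  have t'3: "3 \<le> t'" by (rule warm_time_ge(1)[OF wt'])
  have t't: "t' \<le> t"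
  proof -
    have "M * (P + x) \<le> real t" using t0 t by (simp add: warm_time_iff)
    then show ?thesis unfolding t'_def by linarith
  qed
  interpret ps: prob_space "prob S" using spec by (simp add: correctly_specified_def)
  have ev: "E4 t' \<in> sets (prob S)" "1 - exp (- x) \<le> measure (prob S) (E4 t')"
    using warm[OF wt'] by (auto simp: warm_start_def event_at_level_def)
  have "E4 t' \<noteq> {}"
  proof
    assume "E4 t' = {}"
    then have "1 - exp (- x) \<le> 0" using ev(2) by simp
    then show False using x by simp
  qed
  then obtain \<omega> where \<omega>: "\<omega> \<in> E4 t'" by blast
  have sp: "\<omega> \<in> space (prob S)" using \<omega> sets.sets_into_space[OF ev(1)] by blast
  interpret smooth_losses p "loss S \<omega>" \<theta>s r "L1 + 1" L2 L3 "Theta_ball S r"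
    using smooth_path[OF sp] by (simp_all add: Theta_ball_def)
  let ?q = "rate p x t'" and ?a = "map_est S t' \<omega>" and ?m = "ml_est S t' \<omega>"
  note e = estimates[OF wt' \<omega> order_refl]
  have c: "?a \<in> carrier_vec p" "?m \<in> carrier_vec p" using e(1,2) by (auto simp: is_arg_min_def)
  have aB: "?a \<in> Theta_ball S r" and mB: "?m \<in> Theta_ball S r"
    using in_ball(1)[OF wt' order_refl] c e by auto
  note O = Omega0_psd[OF bas]
  have Oc: "Omega0 S \<in> carrier_mat p p" and th0: "theta0 S \<in> carrier_vec p"
    using bas by (auto simp: basic_def)
  have tw: "\<And>s. s \<in> {1..t'} \<Longrightarrow> twice_differentiable p (loss S \<omega> s)" using twice by simp
  define s where "s = C * sqrt (2 * ?q / real t')"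
  have q1: "1 \<le> ?q" by (rule rate_ge(4)[OF t'3 p1 x])
  have s0: "0 \<le> s" using C q1 by (simp add: s_def)
  have "?a - ?m \<in> carrier_vec p" using c by simp
  have am: "vnorm (?a - ?m) \<le> 2 * s"
    using vnorm_diff_triangle[OF c(1) thetas c(2)] e(3,4) vnorm_minus_commute[OF thetas c(2)]
    by (simp add: s_def)
  have step1: "vnorm (Omega0 S *\<^sub>v (theta0 S - \<theta>s)) \<le> lu * s + L2 * real t' * (2 * s)"
  proof (rule vnorm_le_by_testing)
    show "Omega0 S *\<^sub>v (theta0 S - \<theta>s) \<in> carrier_vec p" using Oc th0 thetas by auto
    show "0 \<le> lu * s + L2 * real t' * (2 * s)" using O(3) L s0 by simp
    fix w :: rvec assume w: "w \<in> carrier_vec p"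
    have split: "w \<bullet> (Omega0 S *\<^sub>v (theta0 S - \<theta>s))
        = w \<bullet> (Omega0 S *\<^sub>v (?a - \<theta>s)) - w \<bullet> (Omega0 S *\<^sub>v (?a - theta0 S))"
    proof -
      have "theta0 S - \<theta>s = (?a - \<theta>s) - (?a - theta0 S)"
        using c th0 thetas by (intro eq_vecI) auto
      moreover have "Omega0 S *\<^sub>v (?a - \<theta>s) \<in> carrier_vec p" "Omega0 S *\<^sub>v (?a - theta0 S) \<in> carrier_vec p"
        using Oc c th0 thetas by auto
      ultimately show ?thesis
        using Oc c th0 thetas w
        by (simp add: mult_minus_distrib_mat_vec[of _ p p] scalar_prod_minus_distrib[of _ p])
    qed
    have foc: "w \<bullet> (Omega0 S *\<^sub>v (?a - theta0 S)) + (\<Sum>s=1..t'. w \<bullet> grad s ?a) = 0"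
      by (rule map_first_order[OF e(1) tw O(1) Oc th0 w])
    have foc': "(\<Sum>s=1..t'. w \<bullet> grad s ?m) = 0"
      by (rule ml_first_order[OF e(2) tw w])
    have "w \<bullet> (Omega0 S *\<^sub>v (theta0 S - \<theta>s))
        = w \<bullet> (Omega0 S *\<^sub>v (?a - \<theta>s)) + (\<Sum>s=1..t'. w \<bullet> grad s ?a - w \<bullet> grad s ?m)"
      unfolding split sum_subtractf using foc foc' by linarith
    also have "\<dots> \<le> lu * vnorm (?a - \<theta>s) * vnorm w + (\<Sum>s=1..t'. L2 * vnorm (?a - ?m) * vnorm w)"
    proof (intro add_mono sum_mono)
      have "\<bar>w \<bullet> (Omega0 S *\<^sub>v (?a - \<theta>s))\<bar> \<le> lu * vnorm (?a - \<theta>s) * vnorm w"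
        by (rule psd_bilinear_le[OF O(1) Oc O(2)]) (use O(3) c thetas w in auto)
      then show "w \<bullet> (Omega0 S *\<^sub>v (?a - \<theta>s)) \<le> lu * vnorm (?a - \<theta>s) * vnorm w" by simp
      fix s assume "s \<in> {1..t'}"
      then show "w \<bullet> grad s ?a - w \<bullet> grad s ?m \<le> L2 * vnorm (?a - ?m) * vnorm w"
        using grad_lipschitz[OF _ mB aB w, of s] by simp
    qed
    also have "\<dots> = (lu * vnorm (?a - \<theta>s) + L2 * real t' * vnorm (?a - ?m)) * vnorm w"
      by (simp add: algebra_simps)
    also have "\<dots> \<le> (lu * s + L2 * real t' * (2 * s)) * vnorm w"
      using e(3) am O(3) L by (intro mult_right_mono add_mono mult_left_mono) (auto simp: s_def)
    finally show "w \<bullet> (Omega0 S *\<^sub>v (theta0 S - \<theta>s)) \<le> (lu * s + L2 * real t' * (2 * s)) * vnorm w" .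
  qed
  have qq: "?q \<le> rate p x t" using t't t'3 by (intro rate_mono) auto
  have s_le: "s \<le> C * sqrt 2 * rate p x t"
  proof -
    have "2 * ?q / real t' \<le> 2 * ?q" using t'3 q1 by (simp add: divide_le_eq)
    also have "\<dots> \<le> 2 * (rate p x t)\<^sup>2"
      using qq q1 self_le_power[of "rate p x t" 2] by simp
    finally have "sqrt (2 * ?q / real t') \<le> sqrt (2 * (rate p x t)\<^sup>2)" by (rule real_sqrt_le_mono)
    also have "\<dots> = sqrt 2 * rate p x t" using qq q1 by (simp add: real_sqrt_mult)
    finally show ?thesis unfolding s_def using C by (simp add: mult.assoc)
  qed
  have ts_le: "real t' * s \<le> C * sqrt 2 * sqrt (M + 1) * rate p x t"
  proof -
    have "P + x \<le> rate p x t"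
    proof -
      have pt: "max (real p) 3 \<le> real t"
        using warm_time_ge[OF t0] t by auto
      have "P \<le> real p * ln (real t)"
        unfolding P_def using pt by (intro mult_left_mono) auto
      then show ?thesis by (simp add: rate_def)
    qed
    then have "M * (P + x) \<le> M * rate p x t" using M3 by (intro mult_left_mono) auto
    then have t'q: "real t' \<le> (M + 1) * rate p x t"
      using t'le q1 qq by (simp add: algebra_simps)
    have "real t' * ?q \<le> ((M + 1) * rate p x t) * rate p x t"
      using t'q qq q1 M3 by (intro mult_mono) auto
    then have "sqrt (2 * (real t' * ?q)) \<le> sqrt (2 * ((M + 1) * (rate p x t * rate p x t)))"
      by (intro real_sqrt_le_mono) (simp add: mult.assoc)
    also have "\<dots> = sqrt 2 * (sqrt (M + 1) * rate p x t)"
      using qq q1 by (simp add: real_sqrt_mult)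
    finally have "sqrt (2 * (real t' * ?q)) \<le> sqrt 2 * (sqrt (M + 1) * rate p x t)" .
    moreover have "real t' * sqrt (2 * ?q / real t') = sqrt (2 * (real t' * ?q))"
    proof -
      have "real t' = sqrt (real t') * sqrt (real t')" by simp
      then show ?thesis using t'3 by (simp add: real_sqrt_mult real_sqrt_divide) (simp add: field_simps)
    qed
    ultimately have "real t' * sqrt (2 * ?q / real t') \<le> sqrt 2 * (sqrt (M + 1) * rate p x t)" by simp
    then have "C * (real t' * sqrt (2 * ?q / real t')) \<le> C * (sqrt 2 * (sqrt (M + 1) * rate p x t))"
      using C by (intro mult_left_mono) auto
    then show ?thesis by (simp add: s_def mult_ac)
  qed
  have "lu * s \<le> lu * (C * sqrt 2 * rate p x t)" using s_le O(3) by (intro mult_left_mono) auto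
  moreover have "2 * L2 * (real t' * s) \<le> 2 * L2 * (C * sqrt 2 * sqrt (M + 1) * rate p x t)"
    using ts_le L by (intro mult_left_mono) auto
  ultimately have "lu * s + L2 * real t' * (2 * s) \<le> bias * rate p x t"
    by (simp add: bias_const_def algebra_simps)
  then show ?thesis using step1 by simp
qed

lemma const_pos: "0 < bias" "0 < gap" "0 < K_tv"
proof -
  have lu: "0 < lu" by (rule Omega0_psd(3)[OF bas])
  show "0 < bias" unfolding bias_const_def
    using C lu L M3 by (intro mult_pos_pos add_pos_nonneg) auto
  moreover show "0 < gap" unfolding gap_const_def
    using lu L b_pos by (intro add_pos_nonneg) auto
  ultimately show "0 < K_tv" unfolding tv_const_def
    using b_pos L K by (intro add_pos_pos divide_pos_pos add_pos_nonneg mult_nonneg_nonneg) auto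
qed

lemma run_close_to_bvm:
  assumes wt: "warm_start_time p x M t0" and incr: "psd_increments S t0"
    and fl: "fluctuation S t0 r x K1 K3 K4 K5 E2 E3"
    and \<omega>: "\<omega> \<in> E1" "\<omega> \<in> E2" "\<omega> \<in> E3" "\<omega> \<in> E4 t0" and t: "3 * real t0 < real t"
  shows "tv_dist (Q_BvM S \<omega> t) (Pi_t S t0 \<omega> t) \<le> K_tv * eps_app p x t0 t"
    and "tv_dist (Pi_t S t0 \<omega> t) (posterior S \<omega> t)
      \<le> K_tv * eps_app p x t0 t + tv_dist (Q_BvM S \<omega> t) (posterior S \<omega> t)"
proof -
  have sp: "\<omega> \<in> space (prob S)"
    using curv \<omega>(1) sets.sets_into_space by (fastforce simp: curvature_def event_at_level_def)
  have t03: "3 \<le> t0" by (rule warm_time_ge(1)[OF wt])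
  have t0t: "t0 \<le> t" using t by simp
  have t3: "3 \<le> t" using t03 t0t by simp
  note e0 = estimates[OF wt \<omega>(4) order_refl]
  note e = estimates[OF wt \<omega>(4) t0t]
  note O = Omega0_psd[OF bas]
  have Oc: "Omega0 S \<in> carrier_mat p p" "transpose_mat (Omega0 S) = Omega0 S"
    and Ol: "0 < lambda_min (Omega0 S)" "lambda_max (Omega0 S) \<le> lu" and th0: "theta0 S \<in> carrier_vec p"
    using bas by (auto simp: basic_def)
  let ?\<theta> = "theta_run S t0 \<omega>" and ?\<Omega> = "Omega_run S t0 \<omega>"
  have run0: "?\<theta> t0 = map_est S t0 \<omega>" "?\<Omega> t0 = Omega0 S + F_mat S \<omega> t0 (map_est S t0 \<omega>)"
    using t03 by (intro run_at_phase_transition; simp)+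
  have a: "map_est S t0 \<omega> \<in> carrier_vec p" and m: "ml_est S t \<omega> \<in> carrier_vec p"
    using e0(1) e(2) by (auto simp: is_arg_min_def)
  note aB = in_ball[OF wt order_refl a e0(3)] and mB = in_ball[OF wt t0t m e(4)]
  interpret newton_run p "loss S \<omega>" \<theta>s r "L1 + 1" L2 L3 "Theta_ball S r" t0 K2 lu "Omega0 S" "theta0 S" ?\<theta> ?\<Omega>
  proof (intro newton_run.intro smooth_path[OF sp], unfold newton_run_axioms_def, intro conjI allI impI)
    fix n :: nat and \<eta> :: "nat \<Rightarrow> rvec"
    assume n: "t0 \<le> n" and \<eta>: "\<forall>s. s \<in> {1..n} \<longrightarrow> \<eta> s \<in> {\<theta> \<in> carrier_vec p. vnorm (\<theta> - \<theta>s) \<le> r}"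
    have "K1 * (real p + x) \<le> real n" "1 \<le> n" using fl n t03 by (auto simp: fluctuation_def)
    moreover have "\<forall>s\<in>{1..n}. \<eta> s \<in> Theta_ball S r" using \<eta> by (simp add: Theta_ball_def)
    ultimately show "K2 * real n \<le> lambda_min (mat_sum p (\<lambda>s. hessian p (loss S \<omega> s) (\<eta> s)) {1..n})"
      using curv \<omega>(1) by (auto simp: curvature_def hess_loss_def)
  next
    show "?\<theta> t0 \<in> {\<theta> \<in> carrier_vec p. vnorm (\<theta> - \<theta>s) \<le> r}"
      using aB(1) by (simp add: run0 Theta_ball_def)
    show "?\<Omega> t0 = Omega0 S + mat_sum p (\<lambda>s. hessian p (loss S \<omega> s) (?\<theta> t0)) {1..t0}"
      by (simp add: run0 F_mat_def hess_loss_def)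
    fix n assume n: "t0 \<le> n"
    show "?\<Omega> (Suc n) = ?\<Omega> n + hessian p (loss S \<omega> (Suc n)) (?\<theta> n)"
      using run_after_phase_transition(1)[OF n] by (simp add: hess_loss_def)
    show "?\<theta> (Suc n) = ?\<theta> n - minv (?\<Omega> (Suc n)) *\<^sub>v gradient p (loss S \<omega> (Suc n)) (?\<theta> n)"
      using run_after_phase_transition(2)[OF n] by (simp add: grad_loss_def)
    have "\<forall>t>t0. psd (H_run S t0 \<omega> t)" using incr sp e0(1) unfolding psd_increments_def by blast
    then have "psd (H_run S t0 \<omega> (Suc n))" using n by simp
    then show "psd (hessian p (loss S \<omega> (Suc n)) (?\<theta> n))" by (simp add: H_run_def hess_loss_def)
  qed (use K t03 Oc Ol O(3) th0 in \<open>auto simp: Theta_ball_def\<close>)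
  have initial: "energy t0 \<le> C * (real p + x)"
  proof -
    have "psd (?\<Omega> t0)" "?\<Omega> t0 \<in> carrier_mat p p"
    proof -
      have st: "stays t0" by (auto simp: stays_def)
      note pd = Omega_posdef[OF order_refl st]
      show "?\<Omega> t0 \<in> carrier_mat p p" using pd by (simp add: posdef_def)
      have "0 \<le> v \<bullet> (?\<Omega> t0 *\<^sub>v v)" if "v \<in> carrier_vec p" for v
        using pd that by (cases "v = 0\<^sub>v p") (auto simp: posdef_def less_imp_le intro!: mult_mat_vec_carrier)
      then show "psd (?\<Omega> t0)" using pd by (auto simp: posdef_def psd_def)
    qed
    moreover have "?\<theta> t0 - \<theta>s \<in> carrier_vec p" using a thetas by (simp add: run0)
    ultimately have "energy t0 = (vnorm (mat_sqrt (?\<Omega> t0) *\<^sub>v (map_est S t0 \<omega> - \<theta>s)))\<^sup>2"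
      unfolding energy_def dev_def by (simp add: vnorm_mat_sqrt_sq run0(1))
    then show ?thesis using warm[OF wt] \<omega>(4) by (simp add: warm_start_def)
  qed
  have loc: "?\<theta> s \<in> Theta_ball S r" and en: "energy s \<le> (C + 2 * K3 + K4 + 2 * K5 + 1) * rate p x s"
    if s: "t0 \<le> s" for s
  proof -
    note loc = localisation[OF x C K(2,3,4) _ _ initial rate_small[OF wt] less_imp_le[OF kappa_pos] _ _ s]
    have regret: "(\<Sum>s=t0+1..n. loss S \<omega> s \<theta>s - loss S \<omega> s (?\<theta> (s - 1))) \<le> K3 * x" if "t0 < n" for n
      using fl \<omega>(2) that by (simp add: fluctuation_def)
    have steps: "(\<Sum>s=t0+1..n. grad s (?\<theta> (s - 1)) \<bullet> (minv (?\<Omega> s) *\<^sub>v grad s (?\<theta> (s - 1))))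
        \<le> K4 * real p * ln (real n) + K5 * (x + ln (real n))" if "t0 < n" "stays n" for n
    proof -
      have "enat n \<le> t_exit S t0 r \<omega>"
        using that by (intro le_t_exit) (auto simp: stays_def)
      then show ?thesis using fl \<omega>(3) that by (auto simp: fluctuation_def g_run_def grad_loss_def)
    qed
    show "?\<theta> s \<in> Theta_ball S r" "energy s \<le> (C + 2 * K3 + K4 + 2 * K5 + 1) * rate p x s"
      by (rule loc[OF regret steps]; use M_dev M_cubic in \<open>simp add: energy_const_def\<close>)+
  qed
  have devs: "(vnorm (dev s))\<^sup>2 \<le> b * rate p x s / real s" if "t0 \<le> s" for s
    unfolding energy_const_def using that loc en by (intro dev_sq_le) (auto simp: stays_def)
  have b0: "0 \<le> b" using b_pos by simp
  let ?q = "rate p x t" and ?L = "ln (real t / real t0)"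
  have lnL: "1 \<le> ?L"
  proof -
    have "3 \<le> real t / real t0" using t t03 by (simp add: pos_le_divide_eq)
    then have "exp 1 \<le> real t / real t0" using exp_le by linarith
    then show ?thesis using t03 t0t by (subst ln_ge_iff) auto
  qed
  have q1: "1 \<le> ?q" by (rule rate_ge(4)[OF t3 p1 x])
  have map_foc: "w \<bullet> (Omega0 S *\<^sub>v (?\<theta> t0 - theta0 S)) + (\<Sum>s=1..t0. w \<bullet> grad s (?\<theta> t0)) = 0"
    if "w \<in> carrier_vec p" for w
    unfolding run0(1) using twice by (intro map_first_order[OF e0(1) _ O(1) Oc(1) th0 that]) simp
  have ml_foc: "(\<Sum>s=1..t. w \<bullet> grad s (ml_est S t \<omega>)) = 0" if "w \<in> carrier_vec p" for w
    using twice by (intro ml_first_order[OF e(2) _ that]) simp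
  let ?ce = "bias + 3 * L3 * b + gap * sqrt b + L3 * (2 * C\<^sup>2)"
  have ce: "0 < ?ce"
    using const_pos b_pos L by (intro add_pos_nonneg mult_nonneg_nonneg) auto
  have mean: "vnorm (info t *\<^sub>v (ml_est S t \<omega> - ?\<theta> t)) \<le> ?ce * ?q * ?L"
    unfolding gap_const_def
    by (rule mean_gap[OF x b0 loc devs t0t lnL map_foc mB(1) ml_foc mB(2)])
       (use prior_bias[OF wt t0t] const_pos in auto)
  have cov: "vnorm ((?\<Omega> t - info t) *\<^sub>v v) \<le> (gap * sqrt (?q * real t)) * vnorm v" if "v \<in> carrier_vec p" for v
    unfolding gap_const_def by (rule covariance_gap[OF x b0 loc devs t0t that])
  have st: "stays t" using loc by (auto simp: stays_def)
  have QB: "Q_BvM S \<omega> t = gaussian p (ml_est S t \<omega>) (minv (info t))"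
    by (simp add: Q_BvM_def info_def F_mat_def hess_loss_def)
  have thc: "?\<theta> t \<in> carrier_vec p" by (rule theta_carrier[OF t0t st])
  have "tv_dist (Q_BvM S \<omega> t) (Pi_t S t0 \<omega> t)
      \<le> (?ce * ?q * ?L) / sqrt (K2 * real t) + sqrt p * (gap * sqrt (?q * real t)) / (K2 * real t)"
    unfolding QB Pi_t_def
  proof (rule tv_dist_gaussian[OF info_posdef[OF t0t] Omega_posdef[OF t0t st] m thc K2t_pos[OF t0t]])
    show "0 < gap * sqrt (?q * real t)" using const_pos q1 t3 by simp
    show "0 < ?ce * ?q * ?L" using ce q1 lnL by (intro mult_pos_pos) auto
    show "0 < p" using p1 by simp
  qed (use info_coercive[OF t0t] Omega_coercive[OF t0t st] cov mean in auto)
  also have "\<dots> \<le> K_tv * (?L * ?q / sqrt (real t))"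
  proof -
    have "(?ce * ?q * ?L) / sqrt (K2 * real t) = ?ce / sqrt K2 * (?L * ?q / sqrt (real t))"
      by (simp add: real_sqrt_mult)
    moreover have "sqrt p * (gap * sqrt (?q * real t)) / (K2 * real t) \<le> gap / K2 * (?L * ?q / sqrt (real t))"
    proof -
      have pq: "real p \<le> ?q" using rate_ge(1)[OF t3 p1 x] x by simp
      have "sqrt p * sqrt ?q \<le> sqrt ?q * sqrt ?q"
        using pq q1 by (intro mult_right_mono) auto
      also have "\<dots> = 1 * ?q" using q1 by simp
      also have "\<dots> \<le> ?L * ?q" using lnL q1 by (intro mult_right_mono) auto
      finally have pqL: "sqrt p * sqrt ?q \<le> ?L * ?q" .
      have "sqrt p * (gap * sqrt (?q * real t)) / (K2 * real t)
          = gap / K2 * (sqrt p * sqrt ?q * (sqrt (real t) / real t))"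
        by (simp add: real_sqrt_mult)
      also have "sqrt (real t) / real t = 1 / sqrt (real t)"
        using t3 by (simp add: sqrt_divide_self_eq inverse_eq_divide)
      also have "gap / K2 * (sqrt p * sqrt ?q * (1 / sqrt (real t))) \<le> gap / K2 * (?L * ?q * (1 / sqrt (real t)))"
        using pqL const_pos K by (intro mult_left_mono mult_right_mono) auto
      finally show ?thesis by simp
    qed
    ultimately show ?thesis
      unfolding tv_const_def distrib_right[of _ "gap / K2"] by (intro add_mono) simp_all
  qed
  also have "?L * ?q / sqrt (real t) = eps_app p x t0 t"
    using lnL q1 by (simp add: eps_app_def rate_def real_sqrt_divide real_sqrt_mult)
  finally show first: "tv_dist (Q_BvM S \<omega> t) (Pi_t S t0 \<omega> t) \<le> K_tv * eps_app p x t0 t" .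
  have "tv_dist (Pi_t S t0 \<omega> t) (posterior S \<omega> t)
      \<le> tv_dist (Q_BvM S \<omega> t) (Pi_t S t0 \<omega> t) + tv_dist (Q_BvM S \<omega> t) (posterior S \<omega> t)"
  proof (rule tv_dist_triangle)
    show "sets (Pi_t S t0 \<omega> t) = sets (Q_BvM S \<omega> t)" by (simp add: Pi_t_def Q_BvM_def)
    show "sets (Q_BvM S \<omega> t) = sets (posterior S \<omega> t)" by (simp add: posterior_def prior_def Q_BvM_def)
    have "prob_space (Pi_t S t0 \<omega> t)" unfolding Pi_t_def
      by (rule prob_space_gaussian[OF Omega_posdef[OF t0t st] thc])
    then show "measure (Pi_t S t0 \<omega> t) A \<le> 1" for A by (rule prob_space.prob_le_1)
    have "prob_space (Q_BvM S \<omega> t)" unfolding QB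
      by (rule prob_space_gaussian[OF info_posdef[OF t0t] m])
    then show "measure (Q_BvM S \<omega> t) A \<le> 1" for A by (rule prob_space.prob_le_1)
  qed (rule posterior_measure_le_1)
  with first show "tv_dist (Pi_t S t0 \<omega> t) (posterior S \<omega> t)
      \<le> K_tv * eps_app p x t0 t + tv_dist (Q_BvM S \<omega> t) (posterior S \<omega> t)" by linarith
qed

end

theorem theorem3p2:
  fixes Kbar C :: real
  assumes "Kbar > 0" and "C > 0"
  shows "\<exists>(M :: real \<Rightarrow> real \<Rightarrow> real \<Rightarrow> real \<Rightarrow> real \<Rightarrow> real \<Rightarrow> real \<Rightarrow> real \<Rightarrow> real)
          (M2 :: real \<Rightarrow> real \<Rightarrow> real \<Rightarrow> real)
          (K :: real \<Rightarrow> real \<Rightarrow> real \<Rightarrow> real \<Rightarrow> real \<Rightarrow> real \<Rightarrow> real \<Rightarrow> real \<Rightarrow> real \<Rightarrow> real \<Rightarrow> real).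
    \<forall>K1 K2 K3 K4 K5 K6 L1 L2 L3 lu r.
      K1 > 0 \<and> K2 > 0 \<and> K3 > 0 \<and> K4 > 0 \<and> K5 \<ge> 0 \<and> K6 > 0 \<and> L1 \<ge> 0 \<and> L2 > 0 \<and> L3 > 0 \<and>
      lu > 0 \<and> r > 0 \<longrightarrow>
      M K1 K2 K3 K4 K5 L1 L2 r > 0 \<and> M2 K6 L3 lu > 0 \<and> K K1 K2 K3 K4 K5 L1 L2 L3 lu r > 0 \<and>
      (\<forall>(S :: ('w, 'y) model) x ll E1.
         x > 0 \<and> correctly_specified S \<and> estimators S \<and>
         basic S Kbar ll lu \<and> curvature S r x K1 K2 E1 \<and> smoothness S r L1 L2 \<and>
         hessian_regularity S r L3 K6 \<longrightarrow>
         (\<forall>E4 :: nat \<Rightarrow> 'w set.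
            (\<forall>t0. warm_start_time (dim S) x (M K1 K2 K3 K4 K5 L1 L2 r) t0 \<longrightarrow>
                  warm_start S t0 x C (E4 t0)) \<longrightarrow>
            (\<forall>t0 E2 E3.
               warm_start_time (dim S) x (M K1 K2 K3 K4 K5 L1 L2 r) t0 \<and> psd_increments S t0 \<and>
               fluctuation S t0 r x K1 K3 K4 K5 E2 E3 \<longrightarrow>
               (\<forall>\<omega> \<in> E1 \<inter> E2 \<inter> E3 \<inter> E4 t0. \<forall>t. real t > M2 K6 L3 lu * real t0 \<longrightarrow>
                  tv_dist (Q_BvM S \<omega> t) (Pi_t S t0 \<omega> t)
                    \<le> K K1 K2 K3 K4 K5 L1 L2 L3 lu r * eps_app (dim S) x t0 t \<and>
                  tv_dist (Pi_t S t0 \<omega> t) (posterior S \<omega> t)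
                    \<le> K K1 K2 K3 K4 K5 L1 L2 L3 lu r * eps_app (dim S) x t0 t +
                       tv_dist (Q_BvM S \<omega> t) (posterior S \<omega> t)))))"
proof -
  let ?b = "\<lambda>K2 K3 K4 K5. energy_const C K2 K3 K4 K5"
  let ?M = "\<lambda>K1 K2 K3 K4 K5 L1 L2 r. burn_in C (?b K2 K3 K4 K5) L1 L2 r"
  let ?K = "\<lambda>K1 K2 K3 K4 K5 L1 L2 L3 lu r.
    tv_const C K2 (?b K2 K3 K4 K5) L2 L3 lu (?M K1 K2 K3 K4 K5 L1 L2 r)"
  have b: "0 < ?b K2 K3 K4 K5" if "0 < K2" "0 < K3" "0 < K4" "0 \<le> K5" for K2 K3 K4 K5 :: real
    using that \<open>C > 0\<close> by (simp add: energy_const_def)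
  \<comment> \<open>\<open>3 > exp 1\<close>, so that \<open>ln (t / t0) \<ge> 1\<close> absorbs the terms without a logarithm\<close>
  show ?thesis
  proof (intro exI[of _ ?M] exI[of _ "\<lambda>_ _ _. 3"] exI[of _ ?K] allI impI, elim conjE, intro conjI allI impI ballI; (elim conjE)?)
    fix K1 K2 K3 K4 K5 K6 L1 L2 L3 lu r :: real
    assume pos: "K1 > 0" "K2 > 0" "K3 > 0" "K4 > 0" "K5 \<ge> 0" "K6 > 0" "L1 \<ge> 0" "L2 > 0" "L3 > 0" "lu > 0" "r > 0"
    note burn = burn_in_suffices[OF \<open>C > 0\<close> b[OF pos(2-5)] pos(7,8,11)]
    show "?M K1 K2 K3 K4 K5 L1 L2 r > 0" using burn(1) by simp
    show "(3::real) > 0" by simp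
    show "?K K1 K2 K3 K4 K5 L1 L2 L3 lu r > 0"
      using \<open>C > 0\<close> pos b[OF pos(2-5)] burn(1)
      by (auto simp: tv_const_def bias_const_def gap_const_def intro!: add_pos_nonneg add_pos_pos mult_pos_pos divide_pos_pos)
    fix S :: "('w, 'y) model" and x ll E1 E4 t0 E2 E3 \<omega> t
    assume asm: "x > 0" "correctly_specified S" "estimators S" "basic S Kbar ll lu" "curvature S r x K1 K2 E1"
      "smoothness S r L1 L2" "hessian_regularity S r L3 K6"
      and warm: "\<forall>t0. warm_start_time (dim S) x (?M K1 K2 K3 K4 K5 L1 L2 r) t0 \<longrightarrow> warm_start S t0 x C (E4 t0)"
      and t0: "warm_start_time (dim S) x (?M K1 K2 K3 K4 K5 L1 L2 r) t0" "psd_increments S t0"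
        "fluctuation S t0 r x K1 K3 K4 K5 E2 E3"
      and \<omega>: "\<omega> \<in> E1 \<inter> E2 \<inter> E3 \<inter> E4 t0" and t: "real t > 3 * real t0"
    interpret model_setting S Kbar C K1 K2 K3 K4 K5 K6 L1 L2 L3 lu r x ll "?M K1 K2 K3 K4 K5 L1 L2 r" E1 E4
      using \<open>C > 0\<close> pos asm warm burn by unfold_locales auto
    have \<omega>': "\<omega> \<in> E1" "\<omega> \<in> E2" "\<omega> \<in> E3" "\<omega> \<in> E4 t0" using \<omega> by auto
    show "tv_dist (Q_BvM S \<omega> t) (Pi_t S t0 \<omega> t) \<le> ?K K1 K2 K3 K4 K5 L1 L2 L3 lu r * eps_app (dim S) x t0 t"
      by (rule run_close_to_bvm(1)[OF t0 \<omega>' t])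
    show "tv_dist (Pi_t S t0 \<omega> t) (posterior S \<omega> t)
        \<le> ?K K1 K2 K3 K4 K5 L1 L2 L3 lu r * eps_app (dim S) x t0 t + tv_dist (Q_BvM S \<omega> t) (posterior S \<omega> t)"
      by (rule run_close_to_bvm(2)[OF t0 \<omega>' t])
  qed
qed

end
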